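(* There is an algorithm (the graphcode algorithm) which, given a presentation of size $N$ of a persistence module $M\colon G(m,n)\to\mathbf{Vec}$, computes in $O(N^3)$ time a compressed graphcode of $M$, i.e. a compression of the graphcode $\mathcal{GC}_\mu(M)$ for some barcode basis $\mu$ of $M$; and the resulting compressed graphcode has size $O(N^2)$.
   Context: $G(m,n)$ is the poset $\{1,\ldots,m\}\times\{1,\ldots,n\}$ with the product order. A persistence module is a functor $M\colon G(m,n)\to\mathbf{Vec}$ into finite-dimensional vector spaces over $\mathbb{Z}_2$. Its slice $M_{(-,i)}$ is the one-parameter module $G(m,1)\to\mathbf{Vec}$ obtained by fixing the second coordinate to $i$; the maps of $M$ from second coordinate $i$ to $i+1$ form a morphism $M_{(-,i)}^{(-,i+1)}\colon M_{(-,i)}\to M_{(-,i+1)}$. Presentations. $P[y]$ denotes the persistence module with support $\{x\mid y\le x\}$, equal to $\mathbb{Z}_2$ there with identity maps. A presentation of $M$ is a morphism $p\colon\bigoplus_j P[y_j]\to\bigoplus_i P[x_i]$ (finite sums) with $M\cong\mathrm{coker}\,p$. It is given as a matrix over $\mathbb{Z}_2$ with rows (generators) labeled by the bi-grades $x_i$ and columns (relations) labeled by the bi-grades $y_j$; its size is the total number of generators and relations. One-parameter intervals. For $1\le b<d\le m+1$, $[b,d)\colon G(m,1)\to\mathbf{Vec}$ is $\mathbb{Z}_2$ at $b\le x<d$ and zero elsewhere, with identity maps inside. For $I=[b_1,d_1)$, $J=[b_2,d_2)$ write $J\lhd I$ if $b_2\le b_1<d_2\le d_1$; $\mathrm{Hom}(I,J)\cong\mathbb{Z}_2$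 if $J\lhd I$ and $0$ otherwise, so morphisms between direct sums of intervals are matrices over $\mathbb{Z}_2$. Graphcode of $M$. A barcode basis of $M$ is a tuple $\mu=(\mu_1,\ldots,\mu_n)$ of isomorphisms $\mu_i\colon M_{(-,i)}\to\bigoplus_{k=1}^{s_i}I^i_k$ onto direct sums of intervals. Put $\eta^i=\mu_{i+1}\circ M_{(-,i)}^{(-,i+1)}\circ\mu_i^{-1}$, viewed as a matrix $(\eta^i_{lk})$ over $\mathbb{Z}_2$. The graphcode $\mathcal{GC}_\mu(M)$ is the directed graph with one vertex for each $I^i_k=[b,d)$, labeled $(b,d,i)$ (birth, death, height), and an edge $(I^i_k,I^{i+1}_l)$ exactly when $\eta^i_{lk}=1$. Compression. A generalized graphcode is a directed graph with vertex labels $c(v)=(b(v),d(v),h(v))\in\{1,\ldots,m\}\times\{1,\ldots,m+1\}\times\{1,\ldots,n\}$ such that $b(v)<d(v)$ for all $v$, all out-neighbors of any vertex have the same height, and $[b(w),d(w))\lhd[b(v),d(v))$ for every edge $(v,w)$. A vertex $w$ is superfluous if it has exactly one incoming edge $(v,w)$, $v$ and $w$ have the same birth and death values, $w$ has at least one outgoing edge, and $v$ has no outgoing edge other than $(v,w)$. Removing a superfluous vertex $w$ means deleting $w$ and its incident edges and adding the edges $(v,x)$ for all former out-neighbors $x$ of $w$. A compression of a graphcode is any generalized graphcode obtained from it by successively removing superfluous vertices (not necessarily all of them). The size of a (generalized) graphcode is its number of vertices plus its number of edges. Running time counts elementary operations. *)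

theory Defs
  imports
    "HOL-Library.Z2"
    "HOL-Library.Product_Order"
    "HOL-Library.Landau_Symbols"
    "HOL-Algebra.AbelCoset"
    "Jordan_Normal_Form.VS_Connect"
    "Graph_Theory.Pair_Digraph"
begin

hide_const (open) Multiset.mult Modules.module Polynomial.smult

section \<open>Persistence modules over \<open>\<int>\<^sub>2\<close>\<close>

text \<open>
  The field \<open>\<int>\<^sub>2\<close> is \<open>class_ring :: bit ring\<close>. A persistence module assigns to every index
  in a poset \<open>I\<close> a finite-dimensional vector space; everything is relative to carriers, so
  the values of the two record fields outside \<open>I\<close> are irrelevant.
\<close>

record ('i, 'v) pmod =
  vsp :: "'i \<Rightarrow> (bit, 'v) module"
  tmap :: "'i \<Rightarrow> 'i \<Rightarrow> 'v \<Rightarrow> 'v"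

locale persistence_module =
  fixes I :: "'i :: order set" and M :: "('i, 'v) pmod"
  assumes vectorspace_vsp: "z \<in> I \<Longrightarrow> vectorspace class_ring (vsp M z)"
    and fin_dim_vsp: "z \<in> I \<Longrightarrow> vectorspace.fin_dim class_ring (vsp M z)"
    and linear_tmap: "z \<in> I \<Longrightarrow> z' \<in> I \<Longrightarrow> z \<le> z' \<Longrightarrow>
          linear_map class_ring (vsp M z) (vsp M z') (tmap M z z')"
    and tmap_refl: "z \<in> I \<Longrightarrow> v \<in> carrier (vsp M z) \<Longrightarrow> tmap M z z v = v"
    and tmap_comp: "x \<in> I \<Longrightarrow> y \<in> I \<Longrightarrow> z \<in> I \<Longrightarrow> x \<le> y \<Longrightarrow> y \<le> z \<Longrightarrow>
          v \<in> carrier (vsp M x) \<Longrightarrow> tmap M y z (tmap M x y v) = tmap M x z v"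

definition pm_morphism ::
    "'i :: order set \<Rightarrow> ('i, 'v) pmod \<Rightarrow> ('i, 'w) pmod \<Rightarrow> ('i \<Rightarrow> 'v \<Rightarrow> 'w) \<Rightarrow> bool" where
  "pm_morphism I M N \<phi> \<longleftrightarrow>
     (\<forall>z\<in>I. linear_map class_ring (vsp M z) (vsp N z) (\<phi> z)) \<and>
     (\<forall>z\<in>I. \<forall>z'\<in>I. z \<le> z' \<longrightarrow>
        (\<forall>v\<in>carrier (vsp M z). \<phi> z' (tmap M z z' v) = tmap N z z' (\<phi> z v)))"

definition pm_iso ::
    "'i :: order set \<Rightarrow> ('i, 'v) pmod \<Rightarrow> ('i, 'w) pmod \<Rightarrow> ('i \<Rightarrow> 'v \<Rightarrow> 'w) \<Rightarrow> bool" where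
  "pm_iso I M N \<phi> \<longleftrightarrow> pm_morphism I M N \<phi> \<and>
     (\<forall>z\<in>I. bij_betw (\<phi> z) (carrier (vsp M z)) (carrier (vsp N z)))"

definition direct_sum_pm :: "('i, 'v) pmod list \<Rightarrow> ('i, nat \<Rightarrow> 'v) pmod" where
  "direct_sum_pm Fs = \<lparr>
     vsp = (\<lambda>z. \<lparr>
       carrier = (\<Pi>\<^sub>E k\<in>{..<length Fs}. carrier (vsp (Fs ! k) z)),
       mult = undefined, one = undefined,
       zero = (\<lambda>k\<in>{..<length Fs}. \<zero>\<^bsub>vsp (Fs ! k) z\<^esub>),
       add = (\<lambda>v w. \<lambda>k\<in>{..<length Fs}. v k \<oplus>\<^bsub>vsp (Fs ! k) z\<^esub> w k),
       smult = (\<lambda>a v. \<lambda>k\<in>{..<length Fs}. a \<odot>\<^bsub>vsp (Fs ! k) z\<^esub> v k)\<rparr>),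
     tmap = (\<lambda>z z' v. \<lambda>k\<in>{..<length Fs}. tmap (Fs ! k) z z' (v k))\<rparr>"

definition quotient_space :: "(bit, 'v) module \<Rightarrow> 'v set \<Rightarrow> (bit, 'v set) module" where
  "quotient_space V U = \<lparr>
     carrier = a_rcosets\<^bsub>V\<^esub> U,
     mult = undefined, one = undefined,
     zero = U,
     add = (<+>\<^bsub>V\<^esub>),
     smult = (\<lambda>a A. \<Union>x\<in>A. U +>\<^bsub>V\<^esub> (a \<odot>\<^bsub>V\<^esub> x))\<rparr>"

definition coker_pm ::
    "('i, 'v) pmod \<Rightarrow> ('i, 'w) pmod \<Rightarrow> ('i \<Rightarrow> 'v \<Rightarrow> 'w) \<Rightarrow> ('i, 'w set) pmod" where
  "coker_pm M N \<phi> = \<lparr>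
     vsp = (\<lambda>z. quotient_space (vsp N z) (\<phi> z ` carrier (vsp M z))),
     tmap = (\<lambda>z z' A. \<Union>x\<in>A. (\<phi> z' ` carrier (vsp M z')) +>\<^bsub>vsp N z'\<^esub> tmap N z z' x)\<rparr>"

definition grid :: "nat \<Rightarrow> nat \<Rightarrow> (nat \<times> nat) set" where
  "grid m n = {1..m} \<times> {1..n}"

definition bit_space :: "bool \<Rightarrow> (bit, bit) module" where
  "bit_space supp = \<lparr>carrier = (if supp then UNIV else {0}),
     mult = (*), one = 1, zero = 0, add = (+), smult = (*)\<rparr>"


section \<open>Presentations\<close>

text \<open>For \<open>z \<le> z'\<close> with \<open>z\<close> outside the support, the source space is \<open>{0}\<close>, so the
  identity is the correct structure map there as well.\<close>

definition free_pm :: "'i :: order \<Rightarrow> ('i, bit) pmod" where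
  "free_pm y = \<lparr>vsp = (\<lambda>z. bit_space (y \<le> z)), tmap = (\<lambda>z z' v. v)\<rparr>"

record presentation =
  gens :: "(nat \<times> nat) list"
  rels :: "(nat \<times> nat) list"
  pmat :: "bit mat"

definition presentation_map ::
    "presentation \<Rightarrow> nat \<times> nat \<Rightarrow> (nat \<Rightarrow> bit) \<Rightarrow> (nat \<Rightarrow> bit)" where
  "presentation_map P z v =
     (\<lambda>i\<in>{..<length (gens P)}. \<Sum>j<length (rels P). pmat P $$ (i, j) * v j)"

definition presents :: "nat \<Rightarrow> nat \<Rightarrow> presentation \<Rightarrow> (nat \<times> nat, 'v) pmod \<Rightarrow> bool" where
  "presents m n P M \<longleftrightarrow>
     set (gens P) \<subseteq> grid m n \<and> set (rels P) \<subseteq> grid m n \<and>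
     pmat P \<in> carrier_mat (length (gens P)) (length (rels P)) \<and>
     (let F = direct_sum_pm (map free_pm (rels P));
          G = direct_sum_pm (map free_pm (gens P))
      in pm_morphism (grid m n) F G (presentation_map P) \<and>
         (\<exists>\<psi>. pm_iso (grid m n) M (coker_pm F G (presentation_map P)) \<psi>))"

definition pres_size :: "presentation \<Rightarrow> nat" where
  "pres_size P = length (gens P) + length (rels P)"


section \<open>Graphcodes\<close>

text \<open>The pair \<open>(b, d)\<close> stands for the interval \<open>[b, d)\<close>.\<close>

definition interval_pm :: "nat \<times> nat \<Rightarrow> (nat, bit) pmod" where
  "interval_pm J = \<lparr>
     vsp = (\<lambda>x. bit_space (fst J \<le> x \<and> x < snd J)),
     tmap = (\<lambda>x x' v. if x \<in> {fst J..<snd J} \<and> x' \<in> {fst J..<snd J} then v else 0)\<rparr>"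

definition lhd_interval :: "nat \<times> nat \<Rightarrow> nat \<times> nat \<Rightarrow> bool" where
  "lhd_interval J I \<longleftrightarrow> fst J \<le> fst I \<and> fst I < snd J \<and> snd J \<le> snd I"

definition slice :: "(nat \<times> nat, 'v) pmod \<Rightarrow> nat \<Rightarrow> (nat, 'v) pmod" where
  "slice M i = \<lparr>vsp = (\<lambda>x. vsp M (x, i)), tmap = (\<lambda>x x'. tmap M (x, i) (x', i))\<rparr>"

text \<open>\<open>B i\<close> is the list of intervals at height \<open>i\<close>, and \<open>\<mu> i\<close> the isomorphism from the
  slice at height \<open>i\<close> onto their direct sum.\<close>

definition barcode_basis ::
    "nat \<Rightarrow> nat \<Rightarrow> (nat \<times> nat, 'v) pmod \<Rightarrow> (nat \<Rightarrow> (nat \<times> nat) list) \<Rightarrow>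
     (nat \<Rightarrow> nat \<Rightarrow> 'v \<Rightarrow> (nat \<Rightarrow> bit)) \<Rightarrow> bool" where
  "barcode_basis m n M B \<mu> \<longleftrightarrow> (\<forall>i\<in>{1..n}.
     (\<forall>(b, d)\<in>set (B i). 1 \<le> b \<and> b < d \<and> d \<le> m + 1) \<and>
     pm_iso {1..m} (slice M i) (direct_sum_pm (map interval_pm (B i))) (\<mu> i))"

definition eta ::
    "(nat \<times> nat, 'v) pmod \<Rightarrow> (nat \<Rightarrow> nat \<Rightarrow> 'v \<Rightarrow> (nat \<Rightarrow> bit)) \<Rightarrow>
     nat \<Rightarrow> nat \<Rightarrow> (nat \<Rightarrow> bit) \<Rightarrow> (nat \<Rightarrow> bit)" where
  "eta M \<mu> i x =
     \<mu> (i + 1) x \<circ> tmap M (x, i) (x, i + 1) \<circ> inv_into (carrier (vsp M (x, i))) (\<mu> i x)"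

text \<open>The component \<open>I\<^sub>k \<rightarrow> J\<^sub>l\<close> of a morphism out of a direct sum of intervals. As
  \<open>Hom(I\<^sub>k, J\<^sub>l)\<close> is \<open>\<int>\<^sub>2\<close> or \<open>0\<close>, the matrix entry is \<open>1\<close> iff this component is nonzero.\<close>

definition component ::
    "(nat \<times> nat) list \<Rightarrow> (nat \<Rightarrow> (nat \<Rightarrow> bit) \<Rightarrow> (nat \<Rightarrow> bit)) \<Rightarrow> nat \<Rightarrow> nat \<Rightarrow> nat \<Rightarrow> bit \<Rightarrow> bit"
  where "component Is \<phi> l k x a = \<phi> x (\<lambda>k'\<in>{..<length Is}. if k' = k then a else 0) l"

definition matrix_entry ::
    "nat \<Rightarrow> (nat \<times> nat) list \<Rightarrow> (nat \<Rightarrow> (nat \<Rightarrow> bit) \<Rightarrow> (nat \<Rightarrow> bit)) \<Rightarrow> nat \<Rightarrow> nat \<Rightarrow> bit" where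
  "matrix_entry m Is \<phi> l k =
     (if \<exists>x\<in>{1..m}. \<exists>a\<in>carrier (vsp (interval_pm (Is ! k)) x). component Is \<phi> l k x a \<noteq> 0
      then 1 else 0)"

record 'a labeled_graph =
  graph :: "'a pair_pre_digraph"
  birth :: "'a \<Rightarrow> nat"
  death :: "'a \<Rightarrow> nat"
  height :: "'a \<Rightarrow> nat"

definition graph_size :: "'a labeled_graph \<Rightarrow> nat" where
  "graph_size G = card (pverts (graph G)) + card (parcs (graph G))"

text \<open>The vertex \<open>(i, k)\<close> is the \<open>k\<close>-th interval at height \<open>i\<close> (with \<open>k\<close> counted from 0).\<close>

definition graphcode ::
    "nat \<Rightarrow> nat \<Rightarrow> (nat \<times> nat, 'v) pmod \<Rightarrow> (nat \<Rightarrow> (nat \<times> nat) list) \<Rightarrow>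
     (nat \<Rightarrow> nat \<Rightarrow> 'v \<Rightarrow> (nat \<Rightarrow> bit)) \<Rightarrow> (nat \<times> nat) labeled_graph" where
  "graphcode m n M B \<mu> = \<lparr>
     graph = \<lparr>
       pverts = {(i, k). i \<in> {1..n} \<and> k < length (B i)},
       parcs = {((i, k), (i', l)) | i k i' l.
         i \<in> {1..n} \<and> i' = i + 1 \<and> i' \<le> n \<and> k < length (B i) \<and> l < length (B i') \<and>
         matrix_entry m (B i) (eta M \<mu> i) l k = 1}\<rparr>,
     birth = (\<lambda>(i, k). fst (B i ! k)),
     death = (\<lambda>(i, k). snd (B i ! k)),
     height = fst\<rparr>"

definition generalized_graphcode :: "nat \<Rightarrow> nat \<Rightarrow> 'a labeled_graph \<Rightarrow> bool" where
  "generalized_graphcode m n G \<longleftrightarrow>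
     pair_fin_digraph (graph G) \<and>
     (\<forall>v\<in>pverts (graph G). birth G v \<in> {1..m} \<and> death G v \<in> {1..m + 1} \<and>
        height G v \<in> {1..n} \<and> birth G v < death G v) \<and>
     (\<forall>v w w'. (v, w) \<in> parcs (graph G) \<and> (v, w') \<in> parcs (graph G) \<longrightarrow>
        height G w = height G w') \<and>
     (\<forall>(v, w)\<in>parcs (graph G). lhd_interval (birth G w, death G w) (birth G v, death G v))"

definition superfluous :: "'a labeled_graph \<Rightarrow> 'a \<Rightarrow> 'a \<Rightarrow> bool" where
  "superfluous G v w \<longleftrightarrow>
     v \<in> pverts (graph G) \<and> w \<in> pverts (graph G) \<and>
     (parcs (graph G))\<inverse> `` {w} = {v} \<and> parcs (graph G) `` {v} = {w} \<and>
     birth G v = birth G w \<and> death G v = death G w \<and>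
     parcs (graph G) `` {w} \<noteq> {}"

definition remove_vertex :: "'a labeled_graph \<Rightarrow> 'a \<Rightarrow> 'a \<Rightarrow> 'a labeled_graph" where
  "remove_vertex G v w = G\<lparr>graph := \<lparr>
     pverts = pverts (graph G) - {w},
     parcs = {e \<in> parcs (graph G). fst e \<noteq> w \<and> snd e \<noteq> w} \<union>
             {v} \<times> (parcs (graph G) `` {w})\<rparr>\<rparr>"

definition removal_step :: "'a labeled_graph \<Rightarrow> 'a labeled_graph \<Rightarrow> bool" where
  "removal_step G H \<longleftrightarrow> (\<exists>v w. superfluous G v w \<and> H = remove_vertex G v w)"

definition compression :: "nat \<Rightarrow> nat \<Rightarrow> 'a labeled_graph \<Rightarrow> 'a labeled_graph \<Rightarrow> bool" where
  "compression m n G H \<longleftrightarrow> removal_step\<^sup>*\<^sup>* G H \<and> generalized_graphcode m n H"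

definition labeled_graph_iso :: "'a labeled_graph \<Rightarrow> 'b labeled_graph \<Rightarrow> bool" where
  "labeled_graph_iso G H \<longleftrightarrow> (\<exists>f. bij_betw f (pverts (graph G)) (pverts (graph H)) \<and>
     parcs (graph H) = map_prod f f ` parcs (graph G) \<and>
     (\<forall>v\<in>pverts (graph G). birth H (f v) = birth G v \<and> death H (f v) = death G v \<and>
        height H (f v) = height G v))"


section \<open>Machine model\<close>

text \<open>
  A unit-cost random access machine, programmed in a while language. The memory consists of
  named arrays of natural numbers; as a fixed program mentions only finitely many
  names, the arrays can be interleaved in a single linear memory, so that an array access costs one
  indirect memory access. The arithmetic operations are addition and truncated
  subtraction only: unit-cost multiplication on unbounded numbers would be unrealistically
  powerful.
\<close>

type_synonym store = "string \<Rightarrow> nat \<Rightarrow> nat"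

datatype aexp = Const nat | Get string aexp | Plus aexp aexp | Minus aexp aexp

datatype bexp = Less aexp aexp | Equal aexp aexp | Neg bexp | Conj bexp bexp

datatype com =
    Skip
  | Put string aexp aexp
  | Seq com com
  | Cond bexp com com
  | Loop bexp com

primrec aval :: "aexp \<Rightarrow> store \<Rightarrow> nat" where
  "aval (Const k) s = k"
| "aval (Get a e) s = s a (aval e s)"
| "aval (Plus e1 e2) s = aval e1 s + aval e2 s"
| "aval (Minus e1 e2) s = aval e1 s - aval e2 s"

primrec bval :: "bexp \<Rightarrow> store \<Rightarrow> bool" where
  "bval (Less e1 e2) s \<longleftrightarrow> aval e1 s < aval e2 s"
| "bval (Equal e1 e2) s \<longleftrightarrow> aval e1 s = aval e2 s"
| "bval (Neg b) s \<longleftrightarrow> \<not> bval b s"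
| "bval (Conj b1 b2) s \<longleftrightarrow> bval b1 s \<and> bval b2 s"

primrec acost :: "aexp \<Rightarrow> nat" where
  "acost (Const k) = 1"
| "acost (Get a e) = 1 + acost e"
| "acost (Plus e1 e2) = 1 + acost e1 + acost e2"
| "acost (Minus e1 e2) = 1 + acost e1 + acost e2"

primrec bcost :: "bexp \<Rightarrow> nat" where
  "bcost (Less e1 e2) = 1 + acost e1 + acost e2"
| "bcost (Equal e1 e2) = 1 + acost e1 + acost e2"
| "bcost (Neg b) = 1 + bcost b"
| "bcost (Conj b1 b2) = 1 + bcost b1 + bcost b2"

text \<open>\<open>run c s t s'\<close>: started in \<open>s\<close>, the program \<open>c\<close> halts in \<open>s'\<close> after \<open>t\<close> elementary
  operations.\<close>

inductive run :: "com \<Rightarrow> store \<Rightarrow> nat \<Rightarrow> store \<Rightarrow> bool" where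
  run_Skip: "run Skip s 1 s"
| run_Put: "run (Put a e1 e2) s (1 + acost e1 + acost e2)
    (s(a := (s a)(aval e1 s := aval e2 s)))"
| run_Seq: "run c1 s t1 s1 \<Longrightarrow> run c2 s1 t2 s2 \<Longrightarrow> run (Seq c1 c2) s (t1 + t2) s2"
| run_Cond_True: "bval b s \<Longrightarrow> run c1 s t s' \<Longrightarrow> run (Cond b c1 c2) s (1 + bcost b + t) s'"
| run_Cond_False: "\<not> bval b s \<Longrightarrow> run c2 s t s' \<Longrightarrow> run (Cond b c1 c2) s (1 + bcost b + t) s'"
| run_Loop_False: "\<not> bval b s \<Longrightarrow> run (Loop b c) s (1 + bcost b) s"
| run_Loop_True: "bval b s \<Longrightarrow> run c s t1 s1 \<Longrightarrow> run (Loop b c) s1 t2 s2 \<Longrightarrow>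
    run (Loop b c) s (1 + bcost b + t1 + t2) s2"

inductive_cases run_SkipE: "run Skip s t s'"
inductive_cases run_PutE: "run (Put a e1 e2) s t s'"
inductive_cases run_SeqE: "run (Seq c1 c2) s t s'"
inductive_cases run_CondE: "run (Cond b c1 c2) s t s'"
inductive_cases run_LoopE: "run (Loop b c) s t s'"

lemma run_deterministic:
  "run c s t s' \<Longrightarrow> run c s u r \<Longrightarrow> u = t \<and> r = s'"
proof (induction arbitrary: u r rule: run.induct)
  case (run_Skip s)
  then show ?case by (rule run_SkipE) simp
next
  case (run_Put a e1 e2 s)
  then show ?case by (rule run_PutE) simp
next
  case (run_Seq c1 s t1 s1 c2 t2 s2)
  from run_Seq.prems show ?case
    by (rule run_SeqE) (auto dest!: run_Seq.IH)
next
  case (run_Cond_True b s c1 t s' c2)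
  from run_Cond_True.prems show ?case
    by (rule run_CondE) (auto simp: run_Cond_True.hyps dest!: run_Cond_True.IH)
next
  case (run_Cond_False b s c2 t s' c1)
  from run_Cond_False.prems show ?case
    by (rule run_CondE) (auto simp: run_Cond_False.hyps dest!: run_Cond_False.IH)
next
  case (run_Loop_False b s c)
  from run_Loop_False.prems show ?case
    by (rule run_LoopE) (auto simp: run_Loop_False.hyps)
next
  case (run_Loop_True b s c t1 s1 t2 s2)
  from run_Loop_True.prems show ?case
    by (rule run_LoopE) (auto simp: run_Loop_True.hyps dest!: run_Loop_True.IH)
qed

text \<open>The matrix of the presentation is stored row by row.\<close>

definition array_of :: "nat list \<Rightarrow> nat \<Rightarrow> nat" where
  "array_of xs k = (if k < length xs then xs ! k else 0)"

definition input_store :: "nat \<Rightarrow> nat \<Rightarrow> presentation \<Rightarrow> store" where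
  "input_store m n P = (\<lambda>_ _. 0)(
     ''m'' := array_of [m],
     ''n'' := array_of [n],
     ''gens'' := array_of [length (gens P)],
     ''rels'' := array_of [length (rels P)],
     ''genx'' := array_of (map fst (gens P)),
     ''geny'' := array_of (map snd (gens P)),
     ''relx'' := array_of (map fst (rels P)),
     ''rely'' := array_of (map snd (rels P)),
     ''mat'' := (\<lambda>k. if k < length (gens P) * length (rels P)
        then of_bool (pmat P $$ (k div length (rels P), k mod length (rels P)) = 1) else 0))"

definition output_graph :: "store \<Rightarrow> nat labeled_graph" where
  "output_graph s = \<lparr>
     graph = \<lparr>pverts = {..<s ''verts'' 0},
              parcs = (\<lambda>e. (s ''source'' e, s ''target'' e)) ` {..<s ''arcs'' 0}\<rparr>,
     birth = s ''birth'', death = s ''death'', height = s ''height''\<rparr>"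

text \<open>The final store lists every edge exactly once, and vertices are
  numbered from \<open>0\<close>, hence the isomorphism.\<close>

definition outputs :: "store \<Rightarrow> 'a labeled_graph \<Rightarrow> bool" where
  "outputs s G \<longleftrightarrow>
     inj_on (\<lambda>e. (s ''source'' e, s ''target'' e)) {..<s ''arcs'' 0} \<and>
     labeled_graph_iso G (output_graph s)"

end

theory Submission
  imports Defs
begin

text \<open>
  Add to the relations of the presentation one relation at grade \<open>(m + 1, y)\<close> for every generator of
  grade \<open>(x, y)\<close>; the module on the grid is unchanged and all bars become finite. At each height,
  reduce the columns of the relation matrix from left to right until the pivots are distinct,
  starting from the matrix of the previous height. The nonzero reduced columns, read
  as combinations of generators, induce a barcode basis: a column with pivot of grade \<open>b\<close> and own grade \<open>d\<close>
  is a bar \<open>[b, d)\<close>. If the step to the next height adds the (already reduced) columns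
  \<open>A\<close> to column \<open>j\<close>, then the old column \<open>j\<close> is the sum of the new columns \<open>{j} \<union> A\<close>, which
  are therefore the only candidates for targets of edges. Every addition lowers a pivot, so over all heights there are only
  quadratically many additions, hence edges, and each costs linear time. Heights at which nothing changes, and
  whose successor changes nothing either, contribute only superfluous vertices and are skipped.
\<close>

text \<open>A basis of each slice alone does not suffice: the maps between heights must be readable
  without inverting a matrix. Since additions are recorded in terms of the new columns, an old
  column is literally a sum of new ones, and up to terms that are zero or dead this sum is already a
  column of the matrix of the morphism. The matrix is never restarted. A column keeps its value from
  one height to the next and an inactive one keeps its input value, so the sum of all pivots starts
  at no more than \<open>C * R\<close> and never grows; both the reduction time and the number of
  edges are charged to it. Vertices are bounded separately: a grade \<open>y\<close> forces only the
  heights \<open>y\<close> and \<open>y - 1\<close> to be kept, so at most \<open>2 * C + 1\<close>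
  heights carry at most \<open>C\<close> vertices each. Ranks break ties between equal grades, so
  that a pivot determines a row, yet they respect the order of births. Hence adding a column from
  the left with no larger pivot can neither raise a birth nor leave the grade of the column. The
  relations at \<open>m + 1\<close> also make every active row a pivot, which replaces dimension
  counts.\<close>

declare add_bit_eq_xor [simp del] mult_bit_eq_and [simp del]

section \<open>Linear algebra over \<open>\<int>\<^sub>2\<close>\<close>

lemma bit_add_self [simp]: "x + x = (0 :: bit)"
  by (cases x) auto

lemma bit_add_eq_0_iff: "x + y = (0 :: bit) \<longleftrightarrow> x = y"
  by (cases x; cases y) auto

lemma bit_add_nonzero_cases:
  assumes "x + y \<noteq> (0 :: bit)"
  obtains "x \<noteq> 0" | "y \<noteq> 0"
  using assms by (cases "x = 0") auto

text \<open>Over the two-element field repeated addition of generators already gives the span, so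
  inductions need no coefficients.\<close>

inductive_set bit_span :: "(nat \<Rightarrow> bit) set \<Rightarrow> (nat \<Rightarrow> bit) set" for S where
  zero: "(\<lambda>_. 0) \<in> bit_span S"
| add: "s \<in> S \<Longrightarrow> v \<in> bit_span S \<Longrightarrow> (\<lambda>i. s i + v i) \<in> bit_span S"

lemma bit_span_base: "s \<in> S \<Longrightarrow> s \<in> bit_span S"
  using bit_span.add [OF _ bit_span.zero, of s S] by simp

lemma bit_span_plus:
  assumes "v \<in> bit_span S" "w \<in> bit_span S"
  shows "(\<lambda>i. v i + w i) \<in> bit_span S"
  using assms(1)
proof induction
  case zero
  then show ?case using assms(2) by simp
next
  case (add s v)
  then show ?case using bit_span.add [OF add.hyps(1) add.IH] by (simp add: add.assoc)
qed

lemma bit_span_sum: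
  "finite J \<Longrightarrow> (\<And>j. j \<in> J \<Longrightarrow> u j \<in> bit_span S) \<Longrightarrow> (\<lambda>i. \<Sum>j\<in>J. u j i) \<in> bit_span S"
  by (induction J rule: finite_induct) (auto intro: bit_span.zero bit_span_plus)

lemma bit_span_scale: "v \<in> bit_span S \<Longrightarrow> (\<lambda>i. a * v i) \<in> bit_span S"
  by (cases a) (auto intro: bit_span.zero)

lemma bit_span_subset: "S \<subseteq> bit_span T \<Longrightarrow> bit_span S \<subseteq> bit_span T"
proof
  fix v assume "S \<subseteq> bit_span T" and "v \<in> bit_span S"
  from this(2,1) show "v \<in> bit_span T"
    by induction (auto intro: bit_span.zero bit_span_plus)
qed

text \<open>Adding the vector of index \<open>j\<close> flips the coefficient of \<open>j\<close>.
  Coefficients belong to indices and not to vectors, so \<open>u\<close> may repeat values; several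
  reduced columns may indeed be zero.\<close>

lemma bit_span_lincomb:
  assumes "v \<in> bit_span (u ` J)" "finite J"
  obtains a where "v = (\<lambda>i. \<Sum>j\<in>J. a j * u j i)"
proof -
  from assms have "\<exists>a. v = (\<lambda>i. \<Sum>j\<in>J. a j * u j i)"
  proof induction
    case zero
    show ?case by (rule exI [of _ "\<lambda>_. 0"]) simp
  next
    case (add s v)
    then obtain a j where a: "v = (\<lambda>i. \<Sum>j\<in>J. a j * u j i)" and j: "j \<in> J" "s = u j"
      by auto
    have "(\<lambda>i. s i + v i) = (\<lambda>i. \<Sum>j'\<in>J. (a(j := a j + 1)) j' * u j' i)"
    proof
      fix i
      have "(\<Sum>j'\<in>J. (a(j := a j + 1)) j' * u j' i)
          = (\<Sum>j'\<in>J. a j' * u j' i + (if j' = j then u j i else 0))"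
        by (rule sum.cong) (auto simp: algebra_simps)
      also have "\<dots> = (\<Sum>j'\<in>J. a j' * u j' i) + u j i"
        using j(1) add.prems by (simp add: sum.distrib)
      finally show "s i + v i = (\<Sum>j'\<in>J. (a(j := a j + 1)) j' * u j' i)"
        by (simp add: a j(2) add.commute)
    qed
    then show ?case by blast
  qed
  with that show ?thesis by blast
qed

section \<open>Pivots of vectors over ranked rows\<close>

definition max_on_support :: "nat \<Rightarrow> (nat \<Rightarrow> nat) \<Rightarrow> (nat \<Rightarrow> bit) \<Rightarrow> nat" where
  "max_on_support R f u = Max (insert 0 (f ` {i. i < R \<and> u i \<noteq> 0}))"

lemma max_on_support_ge: "i < R \<Longrightarrow> u i \<noteq> 0 \<Longrightarrow> f i \<le> max_on_support R f u"
  unfolding max_on_support_def by (rule Max_ge) auto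

lemma max_on_support_le_iff:
  "max_on_support R f u \<le> b \<longleftrightarrow> (\<forall>i<R. u i \<noteq> 0 \<longrightarrow> f i \<le> b)"
  unfolding max_on_support_def by (subst Max_le_iff) auto

lemma max_on_support_cases:
  "max_on_support R f u = 0 \<or> (\<exists>i<R. u i \<noteq> 0 \<and> f i = max_on_support R f u)"
proof -
  have "max_on_support R f u \<in> insert 0 (f ` {i. i < R \<and> u i \<noteq> 0})"
    unfolding max_on_support_def by (rule Max_in) auto
  then show ?thesis by auto
qed

text \<open>\<open>max_on_support\<close> serves twice, with the row rank for the pivot and with the
  first coordinate of the grade for the birth. Ranks are positive because the value 0 stands for a
  vector that vanishes on all rows.\<close>

locale row_ranking =
  fixes R :: nat and rk :: "nat \<Rightarrow> nat"
  assumes rk_inj: "inj_on rk {..<R}"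
    and rk_pos: "i < R \<Longrightarrow> 0 < rk i"
begin

abbreviation piv :: "(nat \<Rightarrow> bit) \<Rightarrow> nat" where
  "piv \<equiv> max_on_support R rk"

lemma piv_eq_0_iff: "piv u = 0 \<longleftrightarrow> (\<forall>i<R. u i = 0)"
  using max_on_support_le_iff [of R rk u 0] rk_pos by fastforce

lemma piv_row:
  assumes "0 < piv u"
  obtains i where "i < R" "u i = 1" "rk i = piv u"
  using max_on_support_cases [of R rk u] assms by auto

lemma zero_above_piv: "i < R \<Longrightarrow> piv u < rk i \<Longrightarrow> u i = 0"
  using max_on_support_ge [of i R u rk] by force

text \<open>Injectivity of \<open>rk\<close> puts both leading entries in the same row, where 1 + 1
  vanishes. This strict decrease drives the termination and the amortized cost of the
  reduction.\<close>

lemma piv_add_less: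
  assumes "piv u = piv v" "0 < piv u"
  shows "piv (\<lambda>i. u i + v i) < piv u"
proof -
  have "rk i \<le> piv u - 1" if i: "i < R" "u i + v i \<noteq> 0" for i
  proof -
    from i(2) have le: "rk i \<le> piv u"
      using max_on_support_ge [of i R u rk] max_on_support_ge [of i R v rk] i(1) assms(1)
      by (cases rule: bit_add_nonzero_cases) auto
    moreover have "rk i \<noteq> piv u"
    proof
      assume eq: "rk i = piv u"
      obtain a where a: "a < R" "u a = 1" "rk a = piv u" using piv_row assms by metis
      obtain b where b: "b < R" "v b = 1" "rk b = piv u" using piv_row assms by metis
      have "a = i" using inj_onD [OF rk_inj, of a i] a i(1) eq by simp
      moreover have "b = i" using inj_onD [OF rk_inj, of b i] b i(1) eq by simp
      ultimately show False using a b i by simp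
    qed
    ultimately show ?thesis using assms(2) by linarith
  qed
  then have "piv (\<lambda>i. u i + v i) \<le> piv u - 1"
    by (subst max_on_support_le_iff) auto
  with assms(2) show ?thesis by linarith
qed

text \<open>Among the columns used, the largest pivot is attained only once, so the leading entry
  cannot cancel. Independence of the reduced columns and surjectivity of their pivots both rest on
  this.\<close>

lemma piv_lincomb:
  assumes J: "finite J" "inj_on (\<lambda>j. piv (u j)) J" "\<And>j. j \<in> J \<Longrightarrow> 0 < piv (u j)"
    and ex: "j0 \<in> J" "a j0 \<noteq> 0"
  obtains j where "j \<in> J" "a j \<noteq> 0" "piv (\<lambda>i. \<Sum>j\<in>J. a j * u j i) = piv (u j)"
    "\<And>k. k \<in> J \<Longrightarrow> a k \<noteq> 0 \<Longrightarrow> piv (u k) \<le> piv (u j)"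
proof -
  let ?J = "{j \<in> J. a j \<noteq> 0}"
  let ?s = "\<lambda>i. \<Sum>j\<in>J. a j * u j i"
  have "finite ((\<lambda>j. piv (u j)) ` ?J)" "(\<lambda>j. piv (u j)) ` ?J \<noteq> {}" using J ex by auto
  from Max_in [OF this] obtain j where j: "j \<in> ?J" "Max ((\<lambda>j. piv (u j)) ` ?J) = piv (u j)"
    by auto
  have le: "piv (u k) \<le> piv (u j)" if "k \<in> ?J" for k
    using that J(1) unfolding j(2) [symmetric] by (intro Max_ge) auto
  obtain i where i: "i < R" "u j i = 1" "rk i = piv (u j)"
    using piv_row J(3) j(1) by blast
  have "?s i = (\<Sum>k\<in>J. if k = j then 1 else 0)"
  proof (rule sum.cong)
    fix k assume k: "k \<in> J"
    show "a k * u k i = (if k = j then 1 else 0)"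
    proof (cases "k = j")
      case True
      then show ?thesis using j i by simp
    next
      case False
      have "u k i = 0" if "a k \<noteq> 0"
      proof (rule zero_above_piv)
        have "piv (u k) \<noteq> piv (u j)" using J(2) k j(1) False by (auto dest: inj_onD)
        then show "piv (u k) < rk i" using le [of k] k that i by force
      qed (fact i)
      then show ?thesis using False by (cases "a k = 0") auto
    qed
  qed simp
  then have one: "?s i = 1" using j J(1) by simp
  then have "piv (u j) \<le> piv ?s"
    using max_on_support_ge [of i R ?s rk] i by simp
  moreover have "piv ?s \<le> piv (u j)"
  proof (subst max_on_support_le_iff, intro allI impI)
    fix i' assume i': "i' < R" "?s i' \<noteq> 0"
    then obtain k where k: "k \<in> J" "a k * u k i' \<noteq> 0" by (meson sum.neutral)
    then have "a k \<noteq> 0" "u k i' \<noteq> 0" by auto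
    with max_on_support_ge [of i' R "u k" rk] i' le [of k] k show "rk i' \<le> piv (u j)" by simp
  qed
  ultimately show ?thesis using that [of j] j le by simp
qed

end

text \<open>
  \<open>U h j\<close> is the column \<open>j\<close> of the reduced relation matrix at height \<open>h\<close>, and \<open>A h j\<close> is the set of
  columns added to column \<open>j\<close> in the step to height \<open>h\<close>. Every generator \<open>i\<close> is
  also a relation at grade \<open>(m + 1, gy i)\<close>; this does not change the module on the grid and makes
  all bars finite.
\<close>

locale reduction_trace = row_ranking R rk
  for R :: nat and rk :: "nat \<Rightarrow> nat" +
  fixes m n C :: nat and gx gy X Y crk :: "nat \<Rightarrow> nat"
    and W :: "nat \<Rightarrow> nat \<Rightarrow> bit" and U :: "nat \<Rightarrow> nat \<Rightarrow> nat \<Rightarrow> bit" and A :: "nat \<Rightarrow> nat \<Rightarrow> nat set"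
  assumes rk_mono: "i < R \<Longrightarrow> i' < R \<Longrightarrow> rk i \<le> rk i' \<Longrightarrow> gx i \<le> gx i'"
    and crk_mono: "j < C \<Longrightarrow> j' < C \<Longrightarrow> crk j \<le> crk j' \<Longrightarrow> X j \<le> X j'"
    and gx_range: "i < R \<Longrightarrow> 1 \<le> gx i \<and> gx i \<le> m"
    and X_le: "j < C \<Longrightarrow> X j \<le> m + 1"
    and Y_pos: "j < C \<Longrightarrow> 1 \<le> Y j"
    and W_supp: "j < C \<Longrightarrow> W j i \<noteq> 0 \<Longrightarrow> i < R \<and> gx i \<le> X j \<and> gy i \<le> Y j"
    and W_virtual: "i < R \<Longrightarrow> \<exists>j<C. Y j = gy i \<and> X j = m + 1 \<and> W j = (\<lambda>i'. if i' = i then 1 else 0)"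
    and U_0: "j < C \<Longrightarrow> U 0 j = W j"
    and U_inactive: "h \<le> n \<Longrightarrow> j < C \<Longrightarrow> h < Y j \<Longrightarrow> U h j = W j"
    and U_Suc: "h < n \<Longrightarrow> j < C \<Longrightarrow> Y j \<le> Suc h \<Longrightarrow>
      U h j = (\<lambda>i. U (Suc h) j i + (\<Sum>k\<in>A (Suc h) j. U (Suc h) k i))"
    and A_subset: "h < n \<Longrightarrow> j < C \<Longrightarrow> Y j \<le> Suc h \<Longrightarrow>
      A (Suc h) j \<subseteq> {k. k < C \<and> Y k \<le> Suc h \<and> crk k < crk j \<and>
        0 < max_on_support R rk (U (Suc h) k) \<and>
        max_on_support R rk (U (Suc h) k) \<le> max_on_support R rk (U h j)}"
    and A_witness: "h < n \<Longrightarrow> j < C \<Longrightarrow> Y j \<le> Suc h \<Longrightarrow> A (Suc h) j \<noteq> {} \<Longrightarrow>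
      \<exists>k\<in>A (Suc h) j. max_on_support R rk (U (Suc h) k) = max_on_support R rk (U h j)"
    and U_inj: "h \<le> n \<Longrightarrow>
      inj_on (\<lambda>j. max_on_support R rk (U h j)) {j. j < C \<and> Y j \<le> h \<and> 0 < max_on_support R rk (U h j)}"
begin

abbreviation bx :: "(nat \<Rightarrow> bit) \<Rightarrow> nat" where
  "bx \<equiv> max_on_support R gx"

text \<open>\<open>rk\<close> refines the order by \<open>gx\<close>, so the pivot row of
  \<open>v\<close> has the largest \<open>gx\<close> among all rows ranked up to it. Comparing
  pivots therefore suffices to compare births.\<close>

lemma bx_mono:
  assumes "piv u \<le> piv v"
  shows "bx u \<le> bx v"
proof (subst max_on_support_le_iff, intro allI impI)
  fix i assume i: "i < R" "u i \<noteq> 0"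
  have "rk i \<le> piv v" using max_on_support_ge [of i R u rk] i assms by simp
  moreover then obtain i' where "i' < R" "v i' = 1" "rk i' = piv v"
    using rk_pos [OF i(1)] piv_row [of v] by auto
  ultimately show "gx i \<le> bx v"
    using rk_mono [of i i'] max_on_support_ge [of i' R v gx] i(1) by simp
qed

lemma A_finite: "h < n \<Longrightarrow> j < C \<Longrightarrow> Y j \<le> Suc h \<Longrightarrow> finite (A (Suc h) j)"
  by (rule finite_subset [OF A_subset]) auto

lemma U_Suc':
  assumes "h < n" "j < C" "Y j \<le> Suc h"
  shows "U (Suc h) j = (\<lambda>i. U h j i + (\<Sum>k\<in>A (Suc h) j. U (Suc h) k i))"
  using U_Suc [OF assms] by (auto simp: fun_eq_iff add.assoc)

text \<open>The columns added in a step are themselves columns of the new height, so the induction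
  on the height needs an inner one on \<open>crk\<close>, the order of reduction. Additions come
  from active columns further left, which keeps the support below the grade of the column.\<close>

lemma U_supp:
  "h \<le> n \<Longrightarrow> j < C \<Longrightarrow> U h j i \<noteq> 0 \<Longrightarrow> i < R \<and> gx i \<le> X j \<and> gy i \<le> max h (Y j)"
proof (induction h arbitrary: j i)
  case 0
  then show ?case using U_0 W_supp by auto
next
  case (Suc h)
  from Suc.prems show ?case
  proof (induction "crk j" arbitrary: j i rule: less_induct)
    case less
    show ?case
    proof (cases "Y j \<le> Suc h")
      case False
      then show ?thesis using U_inactive [of "Suc h" j] less.prems W_supp by (auto simp: max_def)
    next
      case True
      have "U h j i + (\<Sum>k\<in>A (Suc h) j. U (Suc h) k i) \<noteq> 0"
        using less.prems U_Suc' [of h j] True by (simp add: fun_eq_iff)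
      then show ?thesis
      proof (cases rule: bit_add_nonzero_cases)
        case 1
        then show ?thesis using Suc.IH [of j i] less.prems by auto
      next
        case 2
        then obtain k where k: "k \<in> A (Suc h) j" "U (Suc h) k i \<noteq> 0" by (meson sum.neutral)
        then have k': "k < C" "Y k \<le> Suc h" "crk k < crk j"
          using A_subset [of h j] less.prems True by auto
        then have "X k \<le> X j" using crk_mono less.prems by simp
        with less.hyps [OF k'(3), of i] k k' less.prems show ?thesis by auto
      qed
    qed
  qed
qed

section \<open>Spans of the relations available at a grade\<close>

definition cols :: "nat \<Rightarrow> nat \<Rightarrow> nat set" where
  "cols h x = {j. j < C \<and> Y j \<le> h \<and> X j \<le> x}"

lemma finite_cols [simp]: "finite (cols h x)"
  by (simp add: cols_def)

lemma cols_mono: "h \<le> h' \<Longrightarrow> x \<le> x' \<Longrightarrow> cols h x \<subseteq> cols h' x'"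
  by (auto simp: cols_def)

lemma bit_span_mono: "S \<subseteq> T \<Longrightarrow> bit_span S \<subseteq> bit_span T"
  by (rule bit_span_subset) (auto intro: bit_span_base)

text \<open>\<open>U_Suc\<close> writes an old column as a sum of new ones whose \<open>X\<close> is
  not larger, so the spans can only grow with the height. A column that becomes active at this very
  height still has its input value.\<close>

lemma W_in_span_U:
  "h \<le> n \<Longrightarrow> j \<in> cols h x \<Longrightarrow> W j \<in> bit_span (U h ` cols h x)"
proof (induction h arbitrary: j)
  case 0
  then show ?case using Y_pos [of j] by (auto simp: cols_def)
next
  case (Suc h)
  have U: "U h j \<in> bit_span (U (Suc h) ` cols (Suc h) x)" if "j \<in> cols (Suc h) x" for j
  proof -
    have j: "j < C" "Y j \<le> Suc h" "X j \<le> x" using that by (auto simp: cols_def)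
    have "k \<in> cols (Suc h) x" if "k \<in> A (Suc h) j" for k
      using that A_subset [of h j] j Suc.prems crk_mono [of k j] by (fastforce simp: cols_def)
    then have "(\<lambda>i. U (Suc h) j i + (\<Sum>k\<in>A (Suc h) j. U (Suc h) k i))
        \<in> bit_span (U (Suc h) ` cols (Suc h) x)"
      using that Suc.prems j
      by (intro bit_span.add bit_span_sum A_finite) (auto intro: bit_span_base)
    then show ?thesis using U_Suc [of h j] j Suc.prems by simp
  qed
  show ?case
  proof (cases "Y j \<le> h")
    case True
    have "U h ` cols h x \<subseteq> bit_span (U (Suc h) ` cols (Suc h) x)"
      using U cols_mono [of h "Suc h" x x] by auto
    moreover have "W j \<in> bit_span (U h ` cols h x)"
      using Suc.IH [of j] True Suc.prems by (simp add: cols_def)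
    ultimately show ?thesis using bit_span_subset by blast
  next
    case False
    then have "U h j = W j" using Suc.prems U_inactive [of h j] by (auto simp: cols_def)
    then show ?thesis using U [OF Suc.prems(2)] by simp
  qed
qed

text \<open>Solved for the new column, the recursion has further new columns on its right-hand side,
  hence the inner induction on \<open>crk\<close>.\<close>

lemma U_in_span_W:
  "h \<le> n \<Longrightarrow> j \<in> cols h x \<Longrightarrow> U h j \<in> bit_span (W ` cols h x)"
proof (induction h arbitrary: j)
  case 0
  then show ?case using Y_pos [of j] by (auto simp: cols_def)
next
  case (Suc h)
  from Suc.prems show ?case
  proof (induction "crk j" arbitrary: j rule: less_induct)
    case less
    then have j: "j < C" "Y j \<le> Suc h" "X j \<le> x" by (auto simp: cols_def)
    have "U (Suc h) k \<in> bit_span (W ` cols (Suc h) x)" if "k \<in> A (Suc h) j" for k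
    proof (rule less.hyps)
      show "crk k < crk j" "Suc h \<le> n" using that A_subset [of h j] j Suc.prems by auto
      then show "k \<in> cols (Suc h) x"
        using that A_subset [of h j] j Suc.prems crk_mono [of k j] by (fastforce simp: cols_def)
    qed
    then have *: "(\<lambda>i. \<Sum>k\<in>A (Suc h) j. U (Suc h) k i) \<in> bit_span (W ` cols (Suc h) x)"
      using j Suc.prems by (intro bit_span_sum A_finite) auto
    have "U h j \<in> bit_span (W ` cols (Suc h) x)"
    proof (cases "Y j \<le> h")
      case True
      then have "U h j \<in> bit_span (W ` cols h x)"
        using Suc.IH [of j] j Suc.prems by (auto simp: cols_def)
      then show ?thesis
        using bit_span_mono [OF image_mono [OF cols_mono [of h "Suc h" x x]]] by auto
    next
      case False
      then have "U h j = W j" using Suc.prems U_inactive [of h j] j by auto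
      then show ?thesis using less.prems by (auto intro: bit_span_base)
    qed
    from bit_span_plus [OF this *] show ?case using U_Suc' [of h j] j Suc.prems by simp
  qed
qed

text \<open>Additions from left to right preserve the span of every prefix of the column order. On
  the grid, the prefix up to \<open>x\<close> spans the relations of the module at grade
  \<open>(x, h)\<close>, so every \<open>x\<close> is used.\<close>

lemma span_U_eq_span_W: "h \<le> n \<Longrightarrow> bit_span (U h ` cols h x) = bit_span (W ` cols h x)"
  using U_in_span_W W_in_span_U by (intro equalityI bit_span_subset) auto

section \<open>The nonzero active columns as a basis\<close>

definition nz :: "nat \<Rightarrow> nat set" where
  "nz h = {j. j < C \<and> Y j \<le> h \<and> 0 < piv (U h j)}"

lemma finite_nz [simp]: "finite (nz h)"
  by (simp add: nz_def)

lemma nz_inj: "h \<le> n \<Longrightarrow> inj_on (\<lambda>j. piv (U h j)) (nz h)"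
  using U_inj by (simp add: nz_def)

lemma U_eq_0: "h \<le> n \<Longrightarrow> j < C \<Longrightarrow> piv (U h j) = 0 \<Longrightarrow> U h j = (\<lambda>_. 0)"
  using U_supp [of h j] piv_eq_0_iff [of "U h j"] by (intro ext) blast

lemma span_U_lincomb:
  assumes "h \<le> n" "v \<in> bit_span (U h ` cols h x)"
  obtains a where "v = (\<lambda>i. \<Sum>j\<in>nz h. a j * U h j i)" "\<And>j. a j \<noteq> 0 \<Longrightarrow> j \<in> nz h \<and> X j \<le> x"
proof -
  obtain a where a: "v = (\<lambda>i. \<Sum>j\<in>cols h x. a j * U h j i)"
    using bit_span_lincomb [OF assms(2)] by auto
  let ?b = "\<lambda>j. if j \<in> nz h \<inter> cols h x then a j else 0"
  have "v i = (\<Sum>j\<in>nz h. ?b j * U h j i)" for i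
  proof -
    have "v i = (\<Sum>j\<in>cols h x. a j * U h j i)" by (simp add: a)
    also have "\<dots> = (\<Sum>j\<in>nz h \<inter> cols h x. a j * U h j i)"
    proof (rule sum.mono_neutral_right)
      have "U h j i = 0" if "j \<in> cols h x - nz h \<inter> cols h x" for j
        using that U_eq_0 [OF assms(1), of j] by (auto simp: nz_def cols_def)
      then show "\<forall>j\<in>cols h x - nz h \<inter> cols h x. a j * U h j i = 0" by fastforce
    qed auto
    also have "\<dots> = (\<Sum>j\<in>nz h \<inter> cols h x. ?b j * U h j i)" by (rule sum.cong) auto
    also have "\<dots> = (\<Sum>j\<in>nz h. ?b j * U h j i)"
      by (rule sum.mono_neutral_left) auto
    finally show ?thesis .
  qed
  then show ?thesis by (intro that [of ?b]) (auto simp: cols_def split: if_splits)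
qed

text \<open>The unit vector of row \<open>i\<close> is one of the added relations and hence a
  combination of reduced columns. Its pivot is then the pivot of one of them. So no active row stays
  unpaired, which would mean an infinite bar.\<close>

lemma piv_surj:
  assumes "h \<le> n" "i < R" "gy i \<le> h"
  obtains j where "j \<in> nz h" "piv (U h j) = rk i"
proof -
  obtain j0 where j0: "j0 < C" "Y j0 = gy i" "X j0 = m + 1" "W j0 = (\<lambda>i'. if i' = i then 1 else 0)"
    using W_virtual assms by metis
  have "W j0 \<in> bit_span (U h ` cols h (m + 1))"
    using W_in_span_U [of h j0] assms j0 by (simp add: cols_def)
  then obtain a where a: "W j0 = (\<lambda>i. \<Sum>j\<in>nz h. a j * U h j i)"
    using span_U_lincomb [OF assms(1)] by metis
  have pW: "piv (W j0) = rk i"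
    unfolding max_on_support_def j0(4) using assms(2)
    by (simp add: Collect_conv_if cong: conj_cong)
  have "\<exists>j\<in>nz h. a j \<noteq> 0"
  proof (rule ccontr)
    assume "\<not> ?thesis"
    then have "W j0 i = 0" unfolding a by simp
    with j0 show False by simp
  qed
  then obtain j1 where "j1 \<in> nz h" "a j1 \<noteq> 0" by blast
  from piv_lincomb [where u = "U h" and a = a, OF finite_nz nz_inj [OF assms(1)] _ this]
  obtain j where "j \<in> nz h" "piv (\<lambda>i. \<Sum>j\<in>nz h. a j * U h j i) = piv (U h j)"
    by (auto simp: nz_def)
  then show ?thesis using that [of j] pW a by simp
qed

text \<open>Gaussian elimination from the top: the leading row of \<open>v\<close> is the pivot of
  some column, and adding that column lowers the pivot. The bound on the pivots matters later: by
  \<open>bx_mono\<close> no column used is born after \<open>v\<close>.\<close>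

lemma active_lincomb:
  assumes "h \<le> n" "\<And>i. v i \<noteq> 0 \<Longrightarrow> i < R \<and> gy i \<le> h"
  obtains a where "v = (\<lambda>i. \<Sum>j\<in>nz h. a j * U h j i)"
    "\<And>j. a j \<noteq> 0 \<Longrightarrow> j \<in> nz h \<and> piv (U h j) \<le> piv v"
proof -
  have "\<exists>a. v = (\<lambda>i. \<Sum>j\<in>nz h. a j * U h j i) \<and> (\<forall>j. a j \<noteq> 0 \<longrightarrow> j \<in> nz h \<and> piv (U h j) \<le> piv v)"
    using assms(2)
  proof (induction "piv v" arbitrary: v rule: less_induct)
    case less
    show ?case
    proof (cases "piv v = 0")
      case True
      then have "v = (\<lambda>_. 0)" using less.prems piv_eq_0_iff [of v] by (metis ext)
      then show ?thesis by (intro exI [of _ "\<lambda>_. 0"]) simp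
    next
      case False
      then obtain r where r: "r < R" "v r = 1" "rk r = piv v" using piv_row by blast
      with less.prems [of r] obtain j where j: "j \<in> nz h" "piv (U h j) = piv v"
        using piv_surj [OF assms(1)] by force
      let ?w = "\<lambda>i. v i + U h j i"
      have lt: "piv ?w < piv v" using piv_add_less [of v "U h j"] j False by simp
      moreover have "i < R \<and> gy i \<le> h" if "?w i \<noteq> 0" for i
      proof -
        from that show ?thesis
          using less.prems [of i] U_supp [OF assms(1), of j i] j(1)
          by (cases rule: bit_add_nonzero_cases) (auto simp: nz_def)
      qed
      ultimately obtain a where a: "?w = (\<lambda>i. \<Sum>j\<in>nz h. a j * U h j i)"
        "\<And>j. a j \<noteq> 0 \<Longrightarrow> j \<in> nz h \<and> piv (U h j) \<le> piv ?w"
        using less.hyps [of ?w] by blast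
      \<comment> \<open>The remainder uses only columns of pivot smaller than that of
        \<open>v\<close>, so \<open>j\<close> is still free and its coefficient can be set to
        1.\<close>
      have "a j = 0" using a(2) [of j] j lt by force
      have "v i = (\<Sum>k\<in>nz h. (a(j := 1)) k * U h k i)" for i
      proof -
        have "v i = (v i + U h j i) + U h j i" by (simp add: add.assoc)
        also have "v i + U h j i = (\<Sum>k\<in>nz h. a k * U h k i)" using a(1) by metis
        also have "\<dots> + U h j i = (\<Sum>k\<in>nz h. a k * U h k i + (if k = j then U h j i else 0))"
          using j by (simp add: sum.distrib)
        also have "\<dots> = (\<Sum>k\<in>nz h. (a(j := 1)) k * U h k i)"
          by (rule sum.cong) (auto simp: \<open>a j = 0\<close>)
        finally show ?thesis .
      qed
      moreover have "k \<in> nz h \<and> piv (U h k) \<le> piv v" if "(a(j := 1)) k \<noteq> 0" for k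
        using that a(2) [of k] j lt by (cases "k = j") auto
      ultimately show ?thesis by (intro exI [of _ "a(j := 1)"]) auto
    qed
  qed
  with that show ?thesis by blast
qed

lemma lincomb_unique:
  assumes "h \<le> n" "\<And>i. (\<Sum>j\<in>nz h. a j * U h j i) = 0" "j \<in> nz h"
  shows "a j = 0"
proof (rule ccontr)
  assume "a j \<noteq> 0"
  from piv_lincomb [where u = "U h" and a = a, OF finite_nz nz_inj [OF assms(1)] _ assms(3) this]
  obtain k where "k \<in> nz h" "piv (\<lambda>i. \<Sum>j\<in>nz h. a j * U h j i) = piv (U h k)"
    by (auto simp: nz_def)
  then show False using assms(2) piv_eq_0_iff [of "\<lambda>_. 0"] by (simp add: nz_def)
qed

text \<open>By \<open>U_supp\<close> the birth of a column never exceeds \<open>X j\<close>. A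
  nonzero column with equality pairs a generator with a relation of the same first coordinate; its
  interval would be empty, so it gets no bar.\<close>

definition alive :: "nat \<Rightarrow> nat \<Rightarrow> bool" where
  "alive h j \<longleftrightarrow> j \<in> nz h \<and> bx (U h j) < X j"

lemma piv_U_Suc_le:
  assumes "h < n" "j < C" "Y j \<le> Suc h"
  shows "piv (U (Suc h) j) \<le> piv (U h j)"
proof (subst max_on_support_le_iff, intro allI impI)
  fix i assume i: "i < R" "U (Suc h) j i \<noteq> 0"
  then have "U h j i + (\<Sum>k\<in>A (Suc h) j. U (Suc h) k i) \<noteq> 0"
    using U_Suc' [OF assms] by metis
  then show "rk i \<le> piv (U h j)"
  proof (cases rule: bit_add_nonzero_cases)
    case 1
    with i show ?thesis by (simp add: max_on_support_ge)
  next
    case 2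
    then obtain k where "k \<in> A (Suc h) j" "U (Suc h) k i \<noteq> 0" by (meson sum.neutral)
    with A_subset [OF assms] max_on_support_ge [of i R "U (Suc h) k" rk] i show ?thesis by fastforce
  qed
qed

text \<open>If anything were added to column \<open>j\<close>, some added column would have the
  pivot that \<open>j\<close> had before (\<open>A_witness\<close>). It lies further left, so by
  induction it is unchanged, and two columns would have shared a pivot already at height
  \<open>h\<close>.\<close>

lemma no_event_step:
  assumes h: "h < n" and Y: "\<And>j. j < C \<Longrightarrow> Y j \<noteq> Suc h" and j: "j < C" "Y j \<le> Suc h"
  shows "A (Suc h) j = {} \<and> U (Suc h) j = U h j"
  using j
proof (induction "crk j" arbitrary: j rule: less_induct)
  case less
  have "A (Suc h) j = {}"
  proof (rule ccontr)
    assume "A (Suc h) j \<noteq> {}"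
    from A_witness [OF h less.prems this] obtain k where
      k: "k \<in> A (Suc h) j" "piv (U (Suc h) k) = piv (U h j)" by auto
    then have k': "k < C" "Y k \<le> Suc h" "crk k < crk j" "0 < piv (U (Suc h) k)"
      using A_subset [OF h less.prems] by auto
    then have "U (Suc h) k = U h k" using less.hyps by blast
    with k k' have "piv (U h k) = piv (U h j)" "0 < piv (U h k)" by auto
    moreover have "Y j \<le> h" "Y k \<le> h" using Y less.prems k' by (auto simp: le_Suc_eq)
    ultimately have "k = j"
      using nz_inj [of h] h less.prems k' by (auto simp: nz_def dest!: inj_onD)
    with k' show False by simp
  qed
  with U_Suc' [OF h less.prems] show ?case by simp
qed

end

section \<open>Compression\<close>

text \<open>\<open>D\<close> is the set of vertices to remove, \<open>\<pi>\<close> gives the only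
  in-neighbour of such a vertex, and \<open>rt\<close> the first vertex outside \<open>D\<close>
  reached by following \<open>\<pi>\<close>. Removal starts at the largest height: then the
  inherited edges lead only to vertices outside \<open>D\<close>, and the conditions on the rest of
  \<open>D\<close> survive.\<close>

lemma removal_steps_chain:
  fixes G :: "'a labeled_graph" and rt \<pi> :: "'a \<Rightarrow> 'a" and ht :: "'a \<Rightarrow> nat"
  assumes "finite D" "D \<subseteq> pverts (graph G)"
    and "parcs (graph G) \<subseteq> pverts (graph G) \<times> pverts (graph G)"
    and "\<And>v w. (v, w) \<in> parcs (graph G) \<Longrightarrow> ht v < ht w"
    and "\<And>w. w \<in> D \<Longrightarrow> (parcs (graph G))\<inverse> `` {w} = {\<pi> w} \<and> parcs (graph G) `` {\<pi> w} = {w} \<and>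
      birth G (\<pi> w) = birth G w \<and> death G (\<pi> w) = death G w \<and> parcs (graph G) `` {w} \<noteq> {}"
    and "\<And>v. v \<in> pverts (graph G) - D \<Longrightarrow> rt v = v" "\<And>w. w \<in> D \<Longrightarrow> rt w = rt (\<pi> w)"
  shows "removal_step\<^sup>*\<^sup>* G (G\<lparr>graph := \<lparr>pverts = pverts (graph G) - D,
           parcs = {(rt v, x) | v x. (v, x) \<in> parcs (graph G) \<and> x \<notin> D}\<rparr>\<rparr>)"
  using assms
proof (induction "card D" arbitrary: D G)
  case 0
  then have "D = {}" by simp
  with 0 have "{(rt v, x) | v x. (v, x) \<in> parcs (graph G) \<and> x \<notin> D} = parcs (graph G)"
    by (auto simp: subset_iff) metis
  then have "G\<lparr>graph := \<lparr>pverts = pverts (graph G) - D,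
      parcs = {(rt v, x) | v x. (v, x) \<in> parcs (graph G) \<and> x \<notin> D}\<rparr>\<rparr> = G"
    using \<open>D = {}\<close> by (intro labeled_graph.equality pair_pre_digraph.equality) simp_all
  then show ?case by simp
next
  case (Suc k)
  let ?V = "pverts (graph G)" and ?E = "parcs (graph G)"
  have "D \<noteq> {}" using Suc.hyps(2) by auto
  then have "Max (ht ` D) \<in> ht ` D" using Suc.prems(1) by (intro Max_in) auto
  then obtain w where "w \<in> D" "ht w = Max (ht ` D)" by auto
  then have w: "w \<in> D" "\<And>w'. w' \<in> D \<Longrightarrow> ht w' \<le> ht w"
    using Suc.prems(1) by auto
  note D = Suc.prems(5)
  define v where "v = \<pi> w"
  have in_w: "(x, w) \<in> ?E \<longleftrightarrow> x = v" for x using D [OF w(1)] by (auto simp: v_def)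
  have out_v: "(v, x) \<in> ?E \<longleftrightarrow> x = w" for x using D [OF w(1)] by (auto simp: v_def)
  have lab: "birth G v = birth G w" "death G v = death G w" "?E `` {w} \<noteq> {}"
    using D [OF w(1)] by (auto simp: v_def)
  have vw: "v \<noteq> w" "v \<in> ?V" "w \<in> ?V" using Suc.prems(3,4) in_w by blast+
  \<comment> \<open>Out-neighbours of \<open>w\<close> are higher than \<open>w\<close>, hence
    higher than everything in \<open>D\<close>.\<close>
  have v_out_D: "x \<notin> D" if "(w, x) \<in> ?E" for x
    using Suc.prems(4) [OF that] w(2) [of x] by auto
  have sup: "superfluous G v w"
    unfolding superfluous_def using vw lab in_w out_v by auto
  define G' where "G' = remove_vertex G v w"
  define E' where "E' = {e \<in> ?E. fst e \<noteq> w \<and> snd e \<noteq> w} \<union> {v} \<times> (?E `` {w})"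
  have G': "pverts (graph G') = ?V - {w}" "parcs (graph G') = E'"
    "birth G' = birth G" "death G' = death G" "height G' = height G"
    by (simp_all add: G'_def remove_vertex_def E'_def)
  have step: "removal_step G G'" using sup by (auto simp: removal_step_def G'_def)
  have E'_iff: "(a, b) \<in> E' \<longleftrightarrow> a \<noteq> w \<and> b \<noteq> w \<and> (a, b) \<in> ?E \<or> a = v \<and> (w, b) \<in> ?E" for a b
    by (auto simp: E'_def)
  have IH: "removal_step\<^sup>*\<^sup>* G' (G'\<lparr>graph := \<lparr>pverts = pverts (graph G') - (D - {w}),
           parcs = {(rt v, x) | v x. (v, x) \<in> parcs (graph G') \<and> x \<notin> D - {w}}\<rparr>\<rparr>)"
  proof (rule Suc.hyps(1))
    show "k = card (D - {w})" using Suc.hyps(2) w(1) Suc.prems(1) by simp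
    show "finite (D - {w})" using Suc.prems(1) by simp
    show "D - {w} \<subseteq> pverts (graph G')" using Suc.prems(2) by (auto simp: G')
    show "parcs (graph G') \<subseteq> pverts (graph G') \<times> pverts (graph G')"
      using Suc.prems(3,4) vw by (fastforce simp: G' E'_iff)
    show "ht a < ht b" if "(a, b) \<in> parcs (graph G')" for a b
    proof -
      have "ht v < ht w" using Suc.prems(4) in_w by blast
      then show ?thesis using that Suc.prems(4) by (fastforce simp: G' E'_iff)
    qed
    show "rt a = a" if "a \<in> pverts (graph G') - (D - {w})" for a
      using that Suc.prems(6) by (auto simp: G')
    show "rt a = rt (\<pi> a)" if "a \<in> D - {w}" for a
      using that Suc.prems(7) by auto
    fix a assume a: "a \<in> D - {w}"
    then have a': "?E\<inverse> `` {a} = {\<pi> a}" "?E `` {\<pi> a} = {a}" "?E `` {a} \<noteq> {}"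
      "birth G (\<pi> a) = birth G a" "death G (\<pi> a) = death G a" using D by auto
    have "\<pi> a \<noteq> w" using a' a v_out_D by auto
    have "\<pi> a \<noteq> v" using a' a out_v by auto
    have "E'\<inverse> `` {a} = {\<pi> a}"
      using a' a v_out_D \<open>\<pi> a \<noteq> w\<close> by (auto simp: E'_iff)
    moreover have "E' `` {\<pi> a} = {a}"
      using a' a \<open>\<pi> a \<noteq> w\<close> \<open>\<pi> a \<noteq> v\<close> by (auto simp: E'_iff)
    moreover have "E' `` {a} \<noteq> {}"
    \<comment> \<open>If \<open>a\<close> is the vertex that loses its edge to \<open>w\<close>, it
      inherits the edges out of \<open>w\<close>.\<close>
    proof (cases "a = v")
      case True
      then show ?thesis using lab(3) by (auto simp: E'_iff)
    next
      case False
      then have "(a, w) \<notin> ?E" using in_w by simp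
      obtain b where "(a, b) \<in> ?E" using a'(3) by auto
      with \<open>(a, w) \<notin> ?E\<close> have "(a, b) \<in> E'" using a by (cases "b = w") (auto simp: E'_iff)
      then show ?thesis by auto
    qed
    ultimately show "(parcs (graph G'))\<inverse> `` {a} = {\<pi> a} \<and> parcs (graph G') `` {\<pi> a} = {a} \<and>
      birth G' (\<pi> a) = birth G' a \<and> death G' (\<pi> a) = death G' a \<and> parcs (graph G') `` {a} \<noteq> {}"
      using a' by (simp add: G')
  qed
  have rt_w: "rt w = rt v" using Suc.prems(7) w(1) by (simp add: v_def)
  have "{(rt a, x) | a x. (a, x) \<in> E' \<and> x \<notin> D - {w}} = {(rt a, x) | a x. (a, x) \<in> ?E \<and> x \<notin> D}"
    (is "?L = ?R")
  proof
    show "?L \<subseteq> ?R"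
    proof (clarify)
      fix a x assume "(a, x) \<in> E'" "x \<notin> D - {w}"
      moreover from this have "x \<noteq> w" using Suc.prems(4) [of w w] by (auto simp: E'_iff)
      ultimately show "\<exists>v x'. (rt a, x) = (rt v, x') \<and> (v, x') \<in> ?E \<and> x' \<notin> D"
        using rt_w by (auto simp: E'_iff intro: exI [of _ w])
    qed
    show "?R \<subseteq> ?L"
    proof (clarify)
      fix a x assume ax: "(a, x) \<in> ?E" "x \<notin> D"
      then have "x \<noteq> w" using w(1) by auto
      show "\<exists>v x'. (rt a, x) = (rt v, x') \<and> (v, x') \<in> E' \<and> x' \<notin> D - {w}"
      proof (cases "a = w")
        case True
        then show ?thesis using ax rt_w by (intro exI [of _ v] exI [of _ x]) (auto simp: E'_iff)
      next
        case False
        then show ?thesis using ax \<open>x \<noteq> w\<close>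
          by (intro exI [of _ a] exI [of _ x]) (auto simp: E'_iff)
      qed
    qed
  qed
  then have arcs: "{(rt a, x) | a x. (a, x) \<in> parcs (graph G') \<and> x \<notin> D - {w}} = ?R"
    by (simp add: G')
  have verts: "pverts (graph G') - (D - {w}) = ?V - D" using w(1) by (auto simp: G')
  have upd: "G'\<lparr>graph := g\<rparr> = G\<lparr>graph := g\<rparr>" for g
    by (simp add: G'_def remove_vertex_def)
  have "removal_step\<^sup>*\<^sup>* G' (G\<lparr>graph := \<lparr>pverts = ?V - D,
           parcs = {(rt v, x) | v x. (v, x) \<in> ?E \<and> x \<notin> D}\<rparr>\<rparr>)"
    using IH unfolding arcs verts upd .
  with step show ?case by (rule converse_rtranclp_into_rtranclp)
qed

section \<open>Barcode bases from a reduction trace\<close>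

text \<open>Every scalar is 0 or 1, so homogeneity follows from additivity and only sums have to be
  checked.\<close>

lemma linear_map_bitI:
  fixes V :: "(bit, 'v) module" and W :: "(bit, 'w) module"
  assumes V: "vectorspace class_ring V" and W: "vectorspace class_ring W"
    and f: "f \<in> carrier V \<rightarrow> carrier W"
    and add: "\<And>x y. x \<in> carrier V \<Longrightarrow> y \<in> carrier V \<Longrightarrow> f (x \<oplus>\<^bsub>V\<^esub> y) = f x \<oplus>\<^bsub>W\<^esub> f y"
  shows "linear_map class_ring V W f"
proof -
  interpret V: vectorspace class_ring V by (fact V)
  interpret W: vectorspace class_ring W by (fact W)
  have "f \<zero>\<^bsub>V\<^esub> = f \<zero>\<^bsub>V\<^esub> \<oplus>\<^bsub>W\<^esub> f \<zero>\<^bsub>V\<^esub>"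
    using add [of "\<zero>\<^bsub>V\<^esub>" "\<zero>\<^bsub>V\<^esub>"] by simp
  then have zero: "f \<zero>\<^bsub>V\<^esub> = \<zero>\<^bsub>W\<^esub>"
    using f by (simp add: Pi_iff W.M.add.l_cancel_one)
  have "f (r \<odot>\<^bsub>V\<^esub> x) = r \<odot>\<^bsub>W\<^esub> f x" if x: "x \<in> carrier V" for r x
  proof -
    have "f x \<in> carrier W" using f x by auto
    with x zero V.smult_l_null [OF x] V.smult_one [OF x] W.smult_l_null [of "f x"] W.smult_one [of "f x"]
    show ?thesis by (cases r) simp_all
  qed
  then have "f \<in> module_hom class_ring V W"
    using f add by (simp add: module_hom_def)
  then show ?thesis
    by (intro linear_map.intro mod_hom.intro mod_hom_axioms.intro V W V.module_axioms W.module_axioms)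
qed

lemma direct_sum_bit_carrier:
  "carrier (vsp (direct_sum_pm (map interval_pm B)) x) =
     (\<Pi>\<^sub>E k\<in>{..<length B}. if fst (B ! k) \<le> x \<and> x < snd (B ! k) then UNIV else {0})"
  unfolding direct_sum_pm_def by (auto simp: interval_pm_def bit_space_def intro!: PiE_cong)

lemma interval_sum_carrier_iff:
  "v \<in> carrier (vsp (direct_sum_pm (map interval_pm B)) x) \<longleftrightarrow> v \<in> extensional {..<length B} \<and>
     (\<forall>k<length B. \<not> (fst (B ! k) \<le> x \<and> x < snd (B ! k)) \<longrightarrow> v k = 0)"
  unfolding direct_sum_bit_carrier by (auto simp: PiE_iff split: if_splits)

lemma direct_sum_interval_add:
  "v \<oplus>\<^bsub>vsp (direct_sum_pm (map interval_pm B)) x\<^esub> w = (\<lambda>k\<in>{..<length B}. v k + w k)"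
  by (auto simp: direct_sum_pm_def interval_pm_def bit_space_def)

lemma vectorspace_interval_sum:
  "vectorspace class_ring (vsp (direct_sum_pm (map interval_pm B)) x)"
proof -
  let ?D = "vsp (direct_sum_pm (map interval_pm B)) x"
  have zero: "\<zero>\<^bsub>?D\<^esub> = (\<lambda>k\<in>{..<length B}. 0)"
    and smult: "a \<odot>\<^bsub>?D\<^esub> v = (\<lambda>k\<in>{..<length B}. a * v k)" for a v
    by (auto simp: direct_sum_pm_def interval_pm_def bit_space_def)
  note simps = interval_sum_carrier_iff direct_sum_interval_add zero smult
  have "abelian_group ?D"
  proof (rule abelian_groupI)
    fix v assume v: "v \<in> carrier ?D"
    then have "v \<oplus>\<^bsub>?D\<^esub> v = \<zero>\<^bsub>?D\<^esub>" by (auto simp: simps)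
    with v show "\<exists>w\<in>carrier ?D. w \<oplus>\<^bsub>?D\<^esub> v = \<zero>\<^bsub>?D\<^esub>" by blast
  next
    fix v assume "v \<in> carrier ?D"
    then show "\<zero>\<^bsub>?D\<^esub> \<oplus>\<^bsub>?D\<^esub> v = v"
      by (auto simp: simps fun_eq_iff extensional_def)
  qed (auto simp: simps add.assoc add.commute split: if_splits)
  moreover have cring: "cring (class_ring :: bit ring)"
    using class_field [where 'a = bit] by (simp add: field_def domain_def)
  ultimately have "module class_ring ?D"
    by (intro Module.moduleI)
       (auto simp: simps fun_eq_iff extensional_def algebra_simps cring
             split: if_splits)
  then show ?thesis
    by (intro vectorspace.intro class_field)
qed

section \<open>The columns of a presentation, and the kept heights\<close>

definition gen_x :: "presentation \<Rightarrow> nat \<Rightarrow> nat" where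
  "gen_x P i = fst (gens P ! i)"

definition gen_y :: "presentation \<Rightarrow> nat \<Rightarrow> nat" where
  "gen_y P i = snd (gens P ! i)"

text \<open>Column \<open>length (rels P) + i\<close> is the added relation that kills generator
  \<open>i\<close> at first coordinate \<open>m + 1\<close>. With these columns included, the number
  of columns is the size of the presentation.\<close>

definition n_cols :: "presentation \<Rightarrow> nat" where
  "n_cols P = length (rels P) + length (gens P)"

definition col_x :: "nat \<Rightarrow> presentation \<Rightarrow> nat \<Rightarrow> nat" where
  "col_x m P j = (if j < length (rels P) then fst (rels P ! j) else m + 1)"

definition col_y :: "presentation \<Rightarrow> nat \<Rightarrow> nat" where
  "col_y P j = (if j < length (rels P) then snd (rels P ! j) else snd (gens P ! (j - length (rels P))))"

definition col_vec :: "presentation \<Rightarrow> nat \<Rightarrow> nat \<Rightarrow> bit" where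
  "col_vec P j i = (if j < length (rels P) then if i < length (gens P) then pmat P $$ (i, j) else 0
     else if i = j - length (rels P) then 1 else 0)"

text \<open>
  The heights that survive the compression: those with a generator or relation at the height itself or
  at the next one, and \<open>n\<close>. The default value \<open>0\<close> of \<open>last_kept\<close> is not a height.
\<close>

definition kept_heights :: "nat \<Rightarrow> presentation \<Rightarrow> nat set" where
  "kept_heights n P =
     {h. 1 \<le> h \<and> h \<le> n \<and> (h = n \<or> (\<exists>j<n_cols P. col_y P j = h \<or> col_y P j = Suc h))}"

definition last_kept :: "nat \<Rightarrow> presentation \<Rightarrow> nat \<Rightarrow> nat" where
  "last_kept n P h = Max (insert 0 {h' \<in> kept_heights n P. h' \<le> h})"

lemma last_kept_self: "h \<in> kept_heights n P \<Longrightarrow> last_kept n P h = h"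
  unfolding last_kept_def by (intro Max_eqI) auto

lemma last_kept_Suc: "Suc h \<notin> kept_heights n P \<Longrightarrow> last_kept n P (Suc h) = last_kept n P h"
  unfolding last_kept_def by (rule arg_cong [where f = "\<lambda>S. Max (insert 0 S)"]) (auto simp: le_Suc_eq)

lemma last_kept_le: "last_kept n P h \<le> h"
  by (auto simp: last_kept_def)

locale presented_trace =
  reduction_trace "length (gens P)" rk m n "n_cols P" "gen_x P" "gen_y P" "col_x m P" "col_y P" crk
    "col_vec P" U A
  for P :: presentation and rk :: "nat \<Rightarrow> nat" and m n :: nat and crk :: "nat \<Rightarrow> nat"
    and U :: "nat \<Rightarrow> nat \<Rightarrow> nat \<Rightarrow> bit" and A :: "nat \<Rightarrow> nat \<Rightarrow> nat set" +
  fixes M :: "(nat \<times> nat, 'v) pmod"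
  assumes pm: "persistence_module (grid m n) M" and pres: "presents m n P M"
begin

abbreviation "R \<equiv> length (gens P)"

section \<open>Free modules and cokernel in terms of vectors\<close>

definition F :: "(nat \<times> nat, nat \<Rightarrow> bit) pmod" where
  "F = direct_sum_pm (map free_pm (rels P))"

definition G :: "(nat \<times> nat, nat \<Rightarrow> bit) pmod" where
  "G = direct_sum_pm (map free_pm (gens P))"

definition Q :: "(nat \<times> nat, (nat \<Rightarrow> bit) set) pmod" where
  "Q = coker_pm F G (presentation_map P)"

text \<open>Fixing one isomorphism by choice allows the barcode basis to be defined
  outright.\<close>

definition \<psi> :: "nat \<times> nat \<Rightarrow> 'v \<Rightarrow> (nat \<Rightarrow> bit) set" where
  "\<psi> = (SOME \<psi>. pm_iso (grid m n) M Q \<psi>)"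

lemma \<psi>: "pm_iso (grid m n) M Q \<psi>"
proof -
  have "\<exists>\<psi>. pm_iso (grid m n) M Q \<psi>"
    using pres unfolding presents_def Q_def F_def G_def by (auto simp: Let_def)
  then show ?thesis unfolding \<psi>_def by (rule someI_ex)
qed

lemma \<psi>_linear: "z \<in> grid m n \<Longrightarrow> linear_map class_ring (vsp M z) (vsp Q z) (\<psi> z)"
  and \<psi>_natural: "z \<in> grid m n \<Longrightarrow> z' \<in> grid m n \<Longrightarrow> z \<le> z' \<Longrightarrow> v \<in> carrier (vsp M z) \<Longrightarrow>
    \<psi> z' (tmap M z z' v) = tmap Q z z' (\<psi> z v)"
  and \<psi>_bij: "z \<in> grid m n \<Longrightarrow> bij_betw (\<psi> z) (carrier (vsp M z)) (carrier (vsp Q z))"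
  using \<psi> by (auto simp: pm_iso_def pm_morphism_def)

lemma rels_grid: "j < length (rels P) \<Longrightarrow> rels P ! j \<in> grid m n"
  and gens_grid: "i < R \<Longrightarrow> gens P ! i \<in> grid m n"
  using pres by (auto simp: presents_def)

text \<open>Reduced columns are functions that vanish outside the rows, whereas elements of a direct
  sum are undefined there. \<open>emb\<close> translates between the two.\<close>

abbreviation emb :: "(nat \<Rightarrow> bit) \<Rightarrow> nat \<Rightarrow> bit" where
  "emb u \<equiv> restrict u {..<R}"

definition rows :: "nat \<Rightarrow> nat \<Rightarrow> nat set" where
  "rows x h = {i. i < R \<and> gen_x P i \<le> x \<and> gen_y P i \<le> h}"

definition vecs :: "nat \<Rightarrow> nat \<Rightarrow> (nat \<Rightarrow> bit) set" where
  "vecs x h = {u. \<forall>i. u i \<noteq> 0 \<longrightarrow> i \<in> rows x h}"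

lemma vecsI: "(\<And>i. u i \<noteq> 0 \<Longrightarrow> i \<in> rows x h) \<Longrightarrow> u \<in> vecs x h"
  by (simp add: vecs_def)

lemma vecs_0 [simp]: "(\<lambda>_. 0) \<in> vecs x h"
  by (simp add: vecs_def)

lemma vecs_add: "u \<in> vecs x h \<Longrightarrow> v \<in> vecs x h \<Longrightarrow> (\<lambda>i. u i + v i) \<in> vecs x h"
  unfolding vecs_def by (auto elim!: bit_add_nonzero_cases simp del: bit_not_zero_iff)

lemma vecs_sum: "finite J \<Longrightarrow> (\<And>j. j \<in> J \<Longrightarrow> u j \<in> vecs x h) \<Longrightarrow> (\<lambda>i. \<Sum>j\<in>J. u j i) \<in> vecs x h"
  by (induction J rule: finite_induct) (auto intro: vecs_add)

lemma vecs_scale: "u \<in> vecs x h \<Longrightarrow> (\<lambda>i. a * u i) \<in> vecs x h"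
  by (cases a) auto

lemma vecs_mono: "x \<le> x' \<Longrightarrow> h \<le> h' \<Longrightarrow> u \<in> vecs x h \<Longrightarrow> u \<in> vecs x' h'"
  by (fastforce simp: vecs_def rows_def)

lemma emb_inj: "u \<in> vecs x h \<Longrightarrow> v \<in> vecs x h \<Longrightarrow> emb u = emb v \<Longrightarrow> u = v"
proof
  fix i assume *: "u \<in> vecs x h" "v \<in> vecs x h" "emb u = emb v"
  show "u i = v i"
  proof (cases "i < R")
    case True
    with fun_cong [OF *(3), of i] show ?thesis by simp
  next
    case False
    then have "u i = 0" "v i = 0" using * by (auto simp: vecs_def rows_def simp del: bit_not_zero_iff)
    then show ?thesis by simp
  qed
qed

lemma carrier_G: "carrier (vsp G (x, h)) = emb ` vecs x h"
proof -
  have "carrier (vsp G (x, h)) = (\<Pi>\<^sub>E i\<in>{..<R}. if i \<in> rows x h then UNIV else {0})"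
    unfolding G_def direct_sum_pm_def
    by (auto simp: free_pm_def bit_space_def rows_def gen_x_def gen_y_def less_eq_prod_def
        intro!: PiE_cong)
  also have "\<dots> = emb ` vecs x h"
  proof
    show "(\<Pi>\<^sub>E i\<in>{..<R}. if i \<in> rows x h then UNIV else {0}) \<subseteq> emb ` vecs x h"
    proof
      fix v :: "nat \<Rightarrow> bit" assume v: "v \<in> (\<Pi>\<^sub>E i\<in>{..<R}. if i \<in> rows x h then UNIV else {0})"
      let ?u = "\<lambda>i. if i < R then v i else 0"
      have "?u i = 0" if "i \<notin> rows x h" for i
        using PiE_mem [OF v, of i] that by (cases "i < R") auto
      then have "?u \<in> vecs x h" unfolding vecs_def by blast
      moreover have "v = emb ?u" using v by (auto simp: PiE_iff extensional_def fun_eq_iff)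
      ultimately show "v \<in> emb ` vecs x h" by blast
    qed
    show "emb ` vecs x h \<subseteq> (\<Pi>\<^sub>E i\<in>{..<R}. if i \<in> rows x h then UNIV else {0})"
    proof clarify
      fix u assume "u \<in> vecs x h"
      then have "u i = 0" if "i \<notin> rows x h" for i using that unfolding vecs_def by blast
      then show "emb u \<in> (\<Pi>\<^sub>E i\<in>{..<R}. if i \<in> rows x h then UNIV else {0})"
        by (intro PiE_I) auto
    qed
  qed
  finally show ?thesis .
qed

lemma add_G: "emb u \<oplus>\<^bsub>vsp G z\<^esub> emb v = emb (\<lambda>i. u i + v i)"
  by (auto simp: G_def direct_sum_pm_def free_pm_def bit_space_def)

lemma tmap_G: "tmap G z z' v = emb v"
  by (auto simp: G_def direct_sum_pm_def free_pm_def)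

definition rel_span :: "nat \<Rightarrow> nat \<Rightarrow> (nat \<Rightarrow> bit) set" where
  "rel_span x h = bit_span (col_vec P ` cols h x)"

lemma rel_span_vecs: "rel_span x h \<subseteq> vecs x h"
proof
  fix v assume "v \<in> rel_span x h"
  then show "v \<in> vecs x h" unfolding rel_span_def
  proof induction
    case (add s v)
    then obtain j where j: "j \<in> cols h x" "s = col_vec P j" by auto
    have "s \<in> vecs x h"
      unfolding j using j(1) W_supp [of j] by (intro vecsI) (fastforce simp: rows_def cols_def)
    with add.IH show ?case by (rule vecs_add [rotated])
  qed simp
qed

lemma rel_span_mono: "x \<le> x' \<Longrightarrow> h \<le> h' \<Longrightarrow> rel_span x h \<subseteq> rel_span x' h'"
  unfolding rel_span_def by (intro bit_span_mono image_mono cols_mono)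

text \<open>The bound \<open>x \<le> m\<close> excludes the added relations, whose first coordinate
  is \<open>m + 1\<close>. This is the point where they are seen not to change the module on the
  grid.\<close>

lemma image_presentation_map:
  assumes x: "x \<le> m"
  shows "presentation_map P (x, h) ` carrier (vsp F (x, h)) = emb ` rel_span x h"
proof -
  have cols_iff: "j \<in> cols h x \<longleftrightarrow> fst (rels P ! j) \<le> x \<and> snd (rels P ! j) \<le> h"
    if "j < length (rels P)" for j
    using that unfolding cols_def by (auto simp: col_x_def col_y_def n_cols_def)
  have carrier_F: "carrier (vsp F (x, h)) =
      (\<Pi>\<^sub>E j\<in>{..<length (rels P)}. if j \<in> cols h x then UNIV else {0})"
    unfolding F_def direct_sum_pm_def
    by (auto simp: free_pm_def bit_space_def cols_iff less_eq_prod_def intro!: PiE_cong)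
  have cols: "j < length (rels P)" if "j \<in> cols h x" for j
    using that x by (auto simp: cols_def col_x_def split: if_splits)
  have map: "presentation_map P (x, h) v = emb (\<lambda>i. \<Sum>j\<in>cols h x. v j * col_vec P j i)"
    if "\<And>j. j < length (rels P) \<Longrightarrow> j \<notin> cols h x \<Longrightarrow> v j = 0" for v
  proof
    fix i
    have "(\<Sum>j<length (rels P). pmat P $$ (i, j) * v j) = (\<Sum>j\<in>cols h x. v j * col_vec P j i)"
      if "i < R"
    proof -
      have "(\<Sum>j<length (rels P). pmat P $$ (i, j) * v j)
          = (\<Sum>j<length (rels P). v j * col_vec P j i)"
        by (rule sum.cong) (auto simp: col_vec_def that mult.commute)
      also have "\<dots> = (\<Sum>j\<in>cols h x. v j * col_vec P j i)"
        using cols \<open>\<And>j. j < length (rels P) \<Longrightarrow> j \<notin> cols h x \<Longrightarrow> v j = 0\<close>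
        by (intro sum.mono_neutral_right) auto
      finally show ?thesis .
    qed
    then show "presentation_map P (x, h) v i = emb (\<lambda>i. \<Sum>j\<in>cols h x. v j * col_vec P j i) i"
      by (simp add: presentation_map_def)
  qed
  show ?thesis
  proof
    show "presentation_map P (x, h) ` carrier (vsp F (x, h)) \<subseteq> emb ` rel_span x h"
    proof clarify
      fix v assume v: "v \<in> carrier (vsp F (x, h))"
      have "v j = 0" if "j < length (rels P)" "j \<notin> cols h x" for j
        using PiE_mem [OF v [unfolded carrier_F], of j] that by simp
      then have "presentation_map P (x, h) v = emb (\<lambda>i. \<Sum>j\<in>cols h x. v j * col_vec P j i)"
        by (rule map)
      moreover have "(\<lambda>i. \<Sum>j\<in>cols h x. v j * col_vec P j i) \<in> rel_span x h"
        unfolding rel_span_def by (intro bit_span_sum bit_span_scale) (auto intro: bit_span_base)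
      ultimately show "presentation_map P (x, h) v \<in> emb ` rel_span x h" by simp
    qed
    show "emb ` rel_span x h \<subseteq> presentation_map P (x, h) ` carrier (vsp F (x, h))"
    proof clarify
      fix u assume "u \<in> rel_span x h"
      then obtain a where a: "u = (\<lambda>i. \<Sum>j\<in>cols h x. a j * col_vec P j i)"
        unfolding rel_span_def by (rule bit_span_lincomb) simp
      let ?v = "\<lambda>j\<in>{..<length (rels P)}. if j \<in> cols h x then a j else 0"
      have "presentation_map P (x, h) ?v = emb (\<lambda>i. \<Sum>j\<in>cols h x. ?v j * col_vec P j i)"
        by (rule map) simp
      also have "(\<lambda>i. \<Sum>j\<in>cols h x. ?v j * col_vec P j i) = u"
        unfolding a using cols by (intro ext sum.cong) auto
      finally have "emb u = presentation_map P (x, h) ?v" by (rule sym)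
      moreover have "?v \<in> carrier (vsp F (x, h))"
        unfolding carrier_F by auto
      ultimately show "emb u \<in> presentation_map P (x, h) ` carrier (vsp F (x, h))" by blast
    qed
  qed
qed

definition cls :: "nat \<Rightarrow> nat \<Rightarrow> (nat \<Rightarrow> bit) \<Rightarrow> (nat \<Rightarrow> bit) set" where
  "cls x h u = (\<lambda>s. emb (\<lambda>i. s i + u i)) ` rel_span x h"

lemma cls_emb [simp]: "cls x h (emb u) = cls x h u"
  unfolding cls_def by (intro image_cong restrict_ext) auto

lemma coset_eq_cls: "(emb ` rel_span x h) +>\<^bsub>vsp G z\<^esub> emb u = cls x h u"
  by (auto simp: a_r_coset_def' cls_def add_G)

lemma cls_eq_iff:
  assumes "u \<in> vecs x h" "v \<in> vecs x h"
  shows "cls x h u = cls x h v \<longleftrightarrow> (\<lambda>i. u i + v i) \<in> rel_span x h"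
proof
  assume *: "cls x h u = cls x h v"
  have "emb u \<in> cls x h u"
    unfolding cls_def using bit_span.zero [of "col_vec P ` cols h x"]
    by (intro image_eqI [of _ _ "\<lambda>_. 0"]) (auto simp: rel_span_def)
  then obtain s where s: "s \<in> rel_span x h" "emb u = emb (\<lambda>i. s i + v i)"
    unfolding * by (auto simp: cls_def)
  have "(\<lambda>i. s i + v i) \<in> vecs x h"
    using s(1) rel_span_vecs assms(2) by (intro vecs_add) auto
  then have "u = (\<lambda>i. s i + v i)" using s(2) by (rule emb_inj [OF assms(1)])
  then show "(\<lambda>i. u i + v i) \<in> rel_span x h" using s(1) by (simp add: add.assoc)
next
  assume *: "(\<lambda>i. u i + v i) \<in> rel_span x h"
  have sub: "cls x h u \<subseteq> cls x h v" if "(\<lambda>i. u i + v i) \<in> rel_span x h" for u v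
  proof
    fix w assume "w \<in> cls x h u"
    then obtain s where s: "s \<in> rel_span x h" "w = emb (\<lambda>i. s i + u i)" by (auto simp: cls_def)
    have "(\<lambda>i. s i + (u i + v i)) \<in> rel_span x h"
      using s(1) that unfolding rel_span_def by (rule bit_span_plus)
    moreover have "w = emb (\<lambda>i. (s i + (u i + v i)) + v i)" by (simp add: s add.assoc)
    ultimately show "w \<in> cls x h v" unfolding cls_def by (intro image_eqI)
  qed
  have "(\<lambda>i. v i + u i) \<in> rel_span x h" using * by (simp add: add.commute)
  with sub * show "cls x h u = cls x h v" by blast
qed

lemma vsp_Q: "x \<le> m \<Longrightarrow> vsp Q (x, h) = quotient_space (vsp G (x, h)) (emb ` rel_span x h)"
  by (simp add: Q_def coker_pm_def image_presentation_map)

lemma carrier_Q: "x \<le> m \<Longrightarrow> carrier (vsp Q (x, h)) = cls x h ` vecs x h"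
  by (auto simp: vsp_Q quotient_space_def A_RCOSETS_def' carrier_G coset_eq_cls)

lemma add_Q:
  assumes "x \<le> m"
  shows "cls x h u \<oplus>\<^bsub>vsp Q (x, h)\<^esub> cls x h v = cls x h (\<lambda>i. u i + v i)"
proof -
  have "cls x h u \<oplus>\<^bsub>vsp Q (x, h)\<^esub> cls x h v = cls x h u <+>\<^bsub>vsp G (x, h)\<^esub> cls x h v"
    by (simp add: vsp_Q assms quotient_space_def)
  also have "\<dots> = cls x h (\<lambda>i. u i + v i)"
  proof
    show "cls x h u <+>\<^bsub>vsp G (x, h)\<^esub> cls x h v \<subseteq> cls x h (\<lambda>i. u i + v i)"
    proof
      fix w assume "w \<in> cls x h u <+>\<^bsub>vsp G (x, h)\<^esub> cls x h v"
      then obtain s t where st: "s \<in> rel_span x h" "t \<in> rel_span x h"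
        "w = emb (\<lambda>i. (s i + u i) + (t i + v i))"
        by (auto simp: set_add_def' cls_def add_G)
      then have "w = emb (\<lambda>i. (s i + t i) + (u i + v i))" by (simp add: ac_simps)
      moreover have "(\<lambda>i. s i + t i) \<in> rel_span x h"
        using st unfolding rel_span_def by (intro bit_span_plus)
      ultimately show "w \<in> cls x h (\<lambda>i. u i + v i)"
        unfolding cls_def by (rule image_eqI)
    qed
    show "cls x h (\<lambda>i. u i + v i) \<subseteq> cls x h u <+>\<^bsub>vsp G (x, h)\<^esub> cls x h v"
    proof
      fix w assume "w \<in> cls x h (\<lambda>i. u i + v i)"
      then obtain s where s: "s \<in> rel_span x h" "w = emb (\<lambda>i. s i + (u i + v i))"
        by (auto simp: cls_def)
      have "w = emb (\<lambda>i. s i + u i) \<oplus>\<^bsub>vsp G (x, h)\<^esub> emb (\<lambda>i. 0 + v i)"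
        unfolding add_G by (simp add: s(2) ac_simps)
      moreover have "emb (\<lambda>i. s i + u i) \<in> cls x h u" using s by (auto simp: cls_def)
      moreover have "emb (\<lambda>i. 0 + v i) \<in> cls x h v"
        unfolding cls_def using bit_span.zero [of "col_vec P ` cols h x"]
        by (intro image_eqI [of _ _ "\<lambda>_. 0"]) (auto simp: rel_span_def)
      ultimately show "w \<in> cls x h u <+>\<^bsub>vsp G (x, h)\<^esub> cls x h v" by (auto simp: set_add_def')
    qed
  qed
  finally show ?thesis .
qed

text \<open>A structure map keeps the representative: relations at the smaller grade remain
  relations, so all cosets in the union coincide.\<close>

lemma tmap_Q:
  assumes "x \<le> x'" "x' \<le> m" "h \<le> h'" "u \<in> vecs x h"
  shows "tmap Q (x, h) (x', h') (cls x h u) = cls x' h' u"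
proof -
  have "tmap Q (x, h) (x', h') (cls x h u) = (\<Union>s\<in>rel_span x h. cls x' h' (\<lambda>i. s i + u i))"
    using assms
    by (auto simp: Q_def coker_pm_def image_presentation_map tmap_G cls_def [of x h u]
        coset_eq_cls)
  also have "\<dots> = cls x' h' u"
  proof -
    have "cls x' h' (\<lambda>i. s i + u i) = cls x' h' u" if s: "s \<in> rel_span x h" for s
    proof (subst cls_eq_iff)
      show "u \<in> vecs x' h'" using vecs_mono assms by blast
      then show "(\<lambda>i. s i + u i) \<in> vecs x' h'"
        using rel_span_vecs s vecs_mono [of x x' h h'] assms by (intro vecs_add) auto
      show "(\<lambda>i. s i + u i + u i) \<in> rel_span x' h'"
        using s rel_span_mono [OF assms(1,3)] by (auto simp: add.assoc)
    qed
    moreover have "rel_span x h \<noteq> {}"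
      using bit_span.zero [of "col_vec P ` cols h x"] by (auto simp: rel_span_def)
    ultimately show ?thesis by auto
  qed
  finally show ?thesis .
qed


section \<open>The reduced columns as a barcode basis of each slice\<close>

lemma finite_alive [simp]: "finite {j. alive h j}"
  by (rule finite_subset [of _ "nz h"]) (auto simp: alive_def)

text \<open>Bars are indexed by positions in a list, columns by their number. Sorting makes the list
  depend on the set of alive columns alone, so heights with the same alive columns have the same
  list.\<close>

definition al :: "nat \<Rightarrow> nat list" where
  "al h = sorted_list_of_set {j. alive h j}"

definition bars :: "nat \<Rightarrow> (nat \<times> nat) list" where
  "bars h = map (\<lambda>j. (bx (U h j), col_x m P j)) (al h)"

lemma set_al [simp]: "set (al h) = {j. alive h j}"
  and distinct_al [simp]: "distinct (al h)"
  and length_bars [simp]: "length (bars h) = length (al h)"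
  by (simp_all add: al_def bars_def)

lemma bars_nth [simp]: "k < length (al h) \<Longrightarrow> bars h ! k = (bx (U h (al h ! k)), col_x m P (al h ! k))"
  by (simp add: bars_def)

lemma alive_nth [simp]: "k < length (al h) \<Longrightarrow> alive h (al h ! k)"
  using nth_mem [of k "al h"] by simp

lemma bij_al: "bij_betw ((!) (al h)) {..<length (al h)} {j. alive h j}"
  using bij_betw_nth [of "al h" "{..<length (al h)}" "{j. alive h j}"] by simp

lemma sum_al: "(\<Sum>k<length (al h). g (al h ! k)) = (\<Sum>j | alive h j. g j)"
  by (rule sum.reindex_bij_betw [OF bij_al])

definition comb :: "nat \<Rightarrow> (nat \<Rightarrow> bit) \<Rightarrow> nat \<Rightarrow> bit" where
  "comb h a = (\<lambda>i. \<Sum>k<length (al h). a k * U h (al h ! k) i)"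

text \<open>Uniqueness of coefficients is known over \<open>nz h\<close>. This passes from positions
  to columns, with coefficient 0 at the columns that are not alive.\<close>

lemma comb_nz:
  obtains b where "comb h a = (\<lambda>i. \<Sum>j\<in>nz h. b j * U h j i)"
    "\<And>k. k < length (al h) \<Longrightarrow> b (al h ! k) = a k"
proof -
  let ?b = "\<lambda>j. if alive h j then a (inv_into {..<length (al h)} ((!) (al h)) j) else 0"
  have b: "?b (al h ! k) = a k" if "k < length (al h)" for k
    using that bij_betw_inv_into_left [OF bij_al, of k h] by simp
  have "comb h a i = (\<Sum>j\<in>nz h. ?b j * U h j i)" for i
  proof -
    have "comb h a i = (\<Sum>k<length (al h). ?b (al h ! k) * U h (al h ! k) i)"
      unfolding comb_def by (rule sum.cong [OF refl]) (simp only: b lessThan_iff)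
    also have "\<dots> = (\<Sum>j | alive h j. ?b j * U h j i)" by (rule sum_al)
    also have "\<dots> = (\<Sum>j\<in>nz h. ?b j * U h j i)"
      by (rule sum.mono_neutral_left) (auto simp: alive_def)
    finally show ?thesis .
  qed
  with b show ?thesis by (intro that [of ?b]) auto
qed

text \<open>The map out of the direct sum is explicit: form the combination of columns and take its
  class. The barcode basis is its inverse, so bijectivity is proved in this direction.\<close>

definition \<nu> :: "nat \<Rightarrow> nat \<Rightarrow> (nat \<Rightarrow> bit) \<Rightarrow> (nat \<Rightarrow> bit) set" where
  "\<nu> h x a = cls x h (comb h a)"

abbreviation D :: "nat \<Rightarrow> (nat, nat \<Rightarrow> bit) pmod" where
  "D h \<equiv> direct_sum_pm (map interval_pm (bars h))"

lemma carrier_D: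
  "a \<in> carrier (vsp (D h) x) \<longleftrightarrow> a \<in> extensional {..<length (al h)} \<and>
     (\<forall>k<length (al h). \<not> (bx (U h (al h ! k)) \<le> x \<and> x < col_x m P (al h ! k)) \<longrightarrow> a k = 0)"
  unfolding interval_sum_carrier_iff by auto

lemma rel_span_eq_U: "h \<le> n \<Longrightarrow> rel_span x h = bit_span (U h ` cols h x)"
  by (simp add: rel_span_def span_U_eq_span_W)

lemma U_in_rel_span: "h \<le> n \<Longrightarrow> j \<in> cols h x \<Longrightarrow> U h j \<in> rel_span x h"
  by (simp add: rel_span_eq_U bit_span_base)

lemma U_vecs: "h \<le> n \<Longrightarrow> j \<in> nz h \<Longrightarrow> bx (U h j) \<le> x \<Longrightarrow> U h j \<in> vecs x h"
proof (rule vecsI)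
  fix i assume *: "h \<le> n" "j \<in> nz h" "bx (U h j) \<le> x" "U h j i \<noteq> 0"
  then have "i < R" "gen_y P i \<le> h" using U_supp [of h j i] by (auto simp: nz_def)
  moreover from this have "gen_x P i \<le> x"
    using max_on_support_ge [of i R "U h j" "gen_x P"] * by simp
  ultimately show "i \<in> rows x h" by (simp add: rows_def)
qed

lemma comb_vecs: "h \<le> n \<Longrightarrow> a \<in> carrier (vsp (D h) x) \<Longrightarrow> comb h a \<in> vecs x h"
  unfolding comb_def
proof (rule vecs_sum)
  fix k assume *: "h \<le> n" "a \<in> carrier (vsp (D h) x)" "k \<in> {..<length (al h)}"
  show "(\<lambda>i. a k * U h (al h ! k) i) \<in> vecs x h"
  proof (cases "a k = 0")
    case False
    then have "bx (U h (al h ! k)) \<le> x" using * unfolding carrier_D by blast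
    then show ?thesis
      using * alive_nth [of k h] by (intro vecs_scale U_vecs) (auto simp: alive_def)
  qed simp
qed simp

lemma \<nu>_carrier: "h \<le> n \<Longrightarrow> x \<le> m \<Longrightarrow> a \<in> carrier (vsp (D h) x) \<Longrightarrow> \<nu> h x a \<in> carrier (vsp Q (x, h))"
  using comb_vecs by (auto simp: carrier_Q \<nu>_def)

text \<open>Two combinations in the same class differ by a relation, which involves only columns
  with death at most \<open>x\<close>. Comparing coefficients over \<open>nz h\<close>, these
  columns do not affect the bars alive at \<open>x\<close>; at all other bars both arguments vanish
  by definition of the carrier.\<close>

lemma \<nu>_inj: "h \<le> n \<Longrightarrow> inj_on (\<nu> h x) (carrier (vsp (D h) x))"
proof (rule inj_onI)
  fix a a' assume h: "h \<le> n" and a: "a \<in> carrier (vsp (D h) x)" and a': "a' \<in> carrier (vsp (D h) x)"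
    and eq: "\<nu> h x a = \<nu> h x a'"
  obtain b where b: "comb h a = (\<lambda>i. \<Sum>j\<in>nz h. b j * U h j i)"
    "\<And>k. k < length (al h) \<Longrightarrow> b (al h ! k) = a k" using comb_nz by metis
  obtain b' where b': "comb h a' = (\<lambda>i. \<Sum>j\<in>nz h. b' j * U h j i)"
    "\<And>k. k < length (al h) \<Longrightarrow> b' (al h ! k) = a' k" using comb_nz by metis
  have "(\<lambda>i. comb h a i + comb h a' i) \<in> bit_span (U h ` cols h x)"
    using eq comb_vecs [OF h a] comb_vecs [OF h a']
    by (simp add: \<nu>_def cls_eq_iff rel_span_eq_U h)
  then obtain c where c: "(\<lambda>i. comb h a i + comb h a' i) = (\<lambda>i. \<Sum>j\<in>nz h. c j * U h j i)"
    "\<And>j. c j \<noteq> 0 \<Longrightarrow> j \<in> nz h \<and> col_x m P j \<le> x"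
    by (rule span_U_lincomb [OF h]) blast
  have "(\<Sum>j\<in>nz h. (b j + b' j + c j) * U h j i) = 0" for i
  proof -
    have "(\<Sum>j\<in>nz h. (b j + b' j + c j) * U h j i)
        = (\<Sum>j\<in>nz h. b j * U h j i) + (\<Sum>j\<in>nz h. b' j * U h j i) + (\<Sum>j\<in>nz h. c j * U h j i)"
      by (simp add: distrib_right sum.distrib)
    also have "\<dots> = (comb h a i + comb h a' i) + (comb h a i + comb h a' i)"
      using fun_cong [OF b(1), of i] fun_cong [OF b'(1), of i] fun_cong [OF c(1), of i] by simp
    finally show ?thesis by simp
  qed
  from lincomb_unique [OF h this] have 0: "b j + b' j + c j = 0" if "j \<in> nz h" for j
    using that by blast
  have "a k = a' k" if k: "k < length (al h)" for k
  proof (cases "bx (U h (al h ! k)) \<le> x \<and> x < col_x m P (al h ! k)")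
    case True
    then have "c (al h ! k) = 0" using c(2) [of "al h ! k"] by (meson linorder_not_less)
    moreover have "al h ! k \<in> nz h" using alive_nth [OF k] by (simp add: alive_def)
    ultimately show ?thesis using 0 [of "al h ! k"] b(2) [OF k] b'(2) [OF k]
      by (simp add: bit_add_eq_0_iff)
  next
    case False
    then show ?thesis using a a' k unfolding carrier_D by auto
  qed
  then show "a = a'" using a a' unfolding carrier_D by (auto intro: extensionalityI)
qed

text \<open>Expand \<open>v\<close> in the reduced columns. By the bound on pivots every column used
  is born by \<open>x\<close>. Those that are not bars alive at \<open>x\<close> are relations there
  and may be dropped from the expansion.\<close>

lemma \<nu>_surj:
  assumes h: "h \<le> n" and v: "v \<in> vecs x h"
  shows "\<exists>a\<in>carrier (vsp (D h) x). \<nu> h x a = cls x h v"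
proof -
  have vs: "i < R \<and> gen_y P i \<le> h" if "v i \<noteq> 0" for i
    using v that unfolding vecs_def rows_def by blast
  obtain c where c: "v = (\<lambda>i. \<Sum>j\<in>nz h. c j * U h j i)"
    "\<And>j. c j \<noteq> 0 \<Longrightarrow> j \<in> nz h \<and> piv (U h j) \<le> piv v"
  proof (rule active_lincomb [OF h vs])
    fix c assume "v = (\<lambda>i. \<Sum>j\<in>nz h. c j * U h j i)"
      "\<And>j. c j \<noteq> 0 \<Longrightarrow> j \<in> nz h \<and> piv (U h j) \<le> piv v"
    then show thesis by (rule that)
  qed
  have "bx v \<le> x" using v unfolding max_on_support_le_iff vecs_def rows_def by auto
  then have cx: "bx (U h j) \<le> x" if "c j \<noteq> 0" for j
    using bx_mono [of "U h j" v] c(2) [OF that] by linarith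
  then have cx': "c j = 0" if "\<not> bx (U h j) \<le> x" for j using that by blast
  let ?b = "\<lambda>j. if alive h j \<and> x < col_x m P j then c j else 0"
  let ?a = "\<lambda>k\<in>{..<length (al h)}. ?b (al h ! k)"
  have a: "?a \<in> carrier (vsp (D h) x)" unfolding carrier_D using cx' by auto
  have "comb h ?a i + v i = (\<Sum>j\<in>nz h. (?b j + c j) * U h j i)" for i
  proof -
    have "comb h ?a i = (\<Sum>k<length (al h). ?b (al h ! k) * U h (al h ! k) i)"
      unfolding comb_def by (rule sum.cong) auto
    also have "\<dots> = (\<Sum>j | alive h j. ?b j * U h j i)" by (rule sum_al)
    also have "\<dots> = (\<Sum>j\<in>nz h. ?b j * U h j i)"
      by (rule sum.mono_neutral_left) (auto simp: alive_def)
    moreover have "v i = (\<Sum>j\<in>nz h. c j * U h j i)" using c(1) by metis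
    ultimately show ?thesis by (simp add: distrib_right sum.distrib)
  qed
  moreover have "(\<lambda>i. \<Sum>j\<in>nz h. (?b j + c j) * U h j i) \<in> rel_span x h"
    unfolding rel_span_eq_U [OF h]
  proof (rule bit_span_sum [OF finite_nz])
    fix j assume j: "j \<in> nz h"
    show "(\<lambda>i. (?b j + c j) * U h j i) \<in> bit_span (U h ` cols h x)"
    proof (cases "?b j + c j = 0")
      case True
      then show ?thesis by (simp add: bit_span.zero)
    next
      case False
      then have "c j \<noteq> 0" "\<not> (alive h j \<and> x < col_x m P j)" by (auto split: if_splits)
      moreover from this have "bx (U h j) \<le> x" using cx by blast
      \<comment> \<open>If \<open>j\<close> is not alive, its death is at most its birth, which is
        at most \<open>x\<close>; if it is alive, the excluded inequality says the same.\<close>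
      ultimately have "col_x m P j \<le> x" using j by (auto simp: alive_def)
      then show ?thesis using j
        by (intro bit_span_scale bit_span_base) (auto simp: nz_def cols_def)
    qed
  qed
  ultimately have "(\<lambda>i. comb h ?a i + v i) \<in> rel_span x h" by simp
  then have "\<nu> h x ?a = cls x h v"
    unfolding \<nu>_def by (subst cls_eq_iff [OF comb_vecs [OF h a] v])
  with a show ?thesis by blast
qed

lemma \<nu>_bij:
  assumes "h \<le> n" "x \<le> m"
  shows "bij_betw (\<nu> h x) (carrier (vsp (D h) x)) (carrier (vsp Q (x, h)))"
  unfolding bij_betw_def using \<nu>_inj [OF assms(1)] \<nu>_carrier [OF assms] \<nu>_surj [OF assms(1)]
  by (auto simp: carrier_Q [OF assms(2)]) (metis imageI)

lemma \<nu>_add: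
  assumes "x \<le> m"
  shows "\<nu> h x (a \<oplus>\<^bsub>vsp (D h) x\<^esub> a') = \<nu> h x a \<oplus>\<^bsub>vsp Q (x, h)\<^esub> \<nu> h x a'"
proof -
  have "comb h (a \<oplus>\<^bsub>vsp (D h) x\<^esub> a') = (\<lambda>i. comb h a i + comb h a' i)"
    by (simp add: comb_def direct_sum_interval_add distrib_right sum.distrib)
  then show ?thesis unfolding \<nu>_def by (simp add: add_Q assms)
qed

lemma tmap_D: "tmap (D h) x x' a = (\<lambda>k\<in>{..<length (al h)}.
    if x \<in> {fst (bars h ! k)..<snd (bars h ! k)} \<and> x' \<in> {fst (bars h ! k)..<snd (bars h ! k)}
    then a k else 0)"
  by (auto simp: direct_sum_pm_def interval_pm_def)

lemma tmap_D_carrier: "tmap (D h) x x' a \<in> carrier (vsp (D h) x')"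
  unfolding carrier_D by (auto simp: tmap_D)

text \<open>Before passing to classes, the two combinations differ only in bars that end after
  \<open>x\<close> and no later than \<open>x'\<close>, and the columns of such bars are relations
  at \<open>x'\<close>.\<close>

lemma \<nu>_natural:
  assumes h: "h \<le> n" and x: "x \<le> x'" "x' \<le> m" and a: "a \<in> carrier (vsp (D h) x)"
  shows "\<nu> h x' (tmap (D h) x x' a) = tmap Q (x, h) (x', h) (\<nu> h x a)"
proof -
  let ?a = "tmap (D h) x x' a"
  have "(\<lambda>i. comb h ?a i + comb h a i)
      = (\<lambda>i. \<Sum>k<length (al h). (?a k + a k) * U h (al h ! k) i)"
    by (simp add: comb_def distrib_right sum.distrib)
  also have "\<dots> \<in> rel_span x' h"
    unfolding rel_span_eq_U [OF h]
  proof (rule bit_span_sum)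
    fix k assume k: "k \<in> {..<length (al h)}"
    show "(\<lambda>i. (?a k + a k) * U h (al h ! k) i) \<in> bit_span (U h ` cols h x')"
    proof (cases "?a k + a k = 0")
      case True
      then show ?thesis by (simp add: bit_span.zero)
    next
      case False
      have "a k \<noteq> 0 \<longrightarrow> bx (U h (al h ! k)) \<le> x \<and> x < col_x m P (al h ! k)"
        using a k unfolding carrier_D by blast
      then have "col_x m P (al h ! k) \<le> x'"
        using False k x by (fastforce simp: tmap_D split: if_splits)
      then show ?thesis using k alive_nth [of k h]
        by (intro bit_span_scale bit_span_base) (auto simp: alive_def nz_def cols_def)
    qed
  qed simp
  finally have "cls x' h (comb h ?a) = cls x' h (comb h a)"
    using comb_vecs [OF h tmap_D_carrier, of x x' a] vecs_mono [OF x(1) order_refl comb_vecs [OF h a]]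
    by (subst cls_eq_iff)
  then show ?thesis unfolding \<nu>_def using tmap_Q [OF x order_refl comb_vecs [OF h a]] by simp
qed

definition \<mu> :: "nat \<Rightarrow> nat \<Rightarrow> 'v \<Rightarrow> nat \<Rightarrow> bit" where
  "\<mu> h x v = inv_into (carrier (vsp (D h) x)) (\<nu> h x) (\<psi> (x, h) v)"

text \<open>A value of \<open>\<mu>\<close> is not computed from the inverse; it is guessed and
  checked through the explicit map \<open>\<nu>\<close>. Additivity, naturality and the matrices
  between heights are all obtained in this way.\<close>

lemma \<mu>_eqI:
  assumes "h \<le> n" "a \<in> carrier (vsp (D h) x)" "\<nu> h x a = \<psi> (x, h) v"
  shows "\<mu> h x v = a"
  unfolding \<mu>_def assms(3) [symmetric] by (rule inv_into_f_f [OF \<nu>_inj [OF assms(1)] assms(2)])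

lemma \<psi>_carrier: "z \<in> grid m n \<Longrightarrow> v \<in> carrier (vsp M z) \<Longrightarrow> \<psi> z v \<in> carrier (vsp Q z)"
  using \<psi>_bij bij_betwE by blast

lemma
  assumes "h \<in> {1..n}" "x \<in> {1..m}"
  shows \<mu>_bij: "bij_betw (\<mu> h x) (carrier (vsp M (x, h))) (carrier (vsp (D h) x))"
    and \<nu>_\<mu>: "v \<in> carrier (vsp M (x, h)) \<Longrightarrow> \<nu> h x (\<mu> h x v) = \<psi> (x, h) v"
proof -
  have z: "(x, h) \<in> grid m n" and *: "h \<le> n" "x \<le> m" using assms by (auto simp: grid_def)
  have "bij_betw (inv_into (carrier (vsp (D h) x)) (\<nu> h x) \<circ> \<psi> (x, h))
      (carrier (vsp M (x, h))) (carrier (vsp (D h) x))"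
    by (rule bij_betw_trans [OF \<psi>_bij [OF z] bij_betw_inv_into [OF \<nu>_bij [OF *]]])
  then show "bij_betw (\<mu> h x) (carrier (vsp M (x, h))) (carrier (vsp (D h) x))"
    by (simp add: \<mu>_def [abs_def] comp_def)
  show "\<nu> h x (\<mu> h x v) = \<psi> (x, h) v" if "v \<in> carrier (vsp M (x, h))"
    unfolding \<mu>_def by (rule bij_betw_inv_into_right [OF \<nu>_bij [OF *] \<psi>_carrier [OF z that]])
qed

lemma \<mu>_carrier:
  "h \<in> {1..n} \<Longrightarrow> x \<in> {1..m} \<Longrightarrow> v \<in> carrier (vsp M (x, h)) \<Longrightarrow> \<mu> h x v \<in> carrier (vsp (D h) x)"
  using \<mu>_bij by (auto simp: bij_betw_def)

lemma bars_range:
  assumes "(b, d) \<in> set (bars h)" "h \<le> n"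
  shows "1 \<le> b \<and> b < d \<and> d \<le> m + 1"
proof -
  obtain j where j: "alive h j" "b = bx (U h j)" "d = col_x m P j"
    using assms by (auto simp: bars_def)
  then have "j < n_cols P" "0 < piv (U h j)" by (auto simp: alive_def nz_def)
  then obtain i where i: "i < R" "U h j i = 1" using piv_row by blast
  then have "1 \<le> bx (U h j)"
    using max_on_support_ge [of i R "U h j" "gen_x P"] gx_range [of i] by simp
  with j show ?thesis using X_le \<open>j < n_cols P\<close> by (simp add: alive_def)
qed

lemma barcode_basis: "barcode_basis m n M bars \<mu>"
  unfolding barcode_basis_def
proof (intro ballI conjI)
  fix h assume h: "h \<in> {1..n}"
  show "case bd of (b, d) \<Rightarrow> 1 \<le> b \<and> b < d \<and> d \<le> m + 1" if "bd \<in> set (bars h)" for bd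
    using bars_range [of "fst bd" "snd bd" h] that h by (auto simp: case_prod_beta)
  have grid: "(x, h) \<in> grid m n" if "x \<in> {1..m}" for x using that h by (auto simp: grid_def)
  show "pm_iso {1..m} (slice M h) (D h) (\<mu> h)"
    unfolding pm_iso_def pm_morphism_def
  proof (intro conjI ballI impI)
    fix x assume x: "x \<in> {1..m}"
    show "bij_betw (\<mu> h x) (carrier (vsp (slice M h) x)) (carrier (vsp (D h) x))"
      using \<mu>_bij [OF h x] by (simp add: slice_def)
    have M: "vectorspace class_ring (vsp M (x, h))"
      using persistence_module.vectorspace_vsp [OF pm grid [OF x]] .
    then interpret V: vectorspace class_ring "vsp M (x, h)" .
    have "linear_map class_ring (vsp M (x, h)) (vsp (D h) x) (\<mu> h x)"
    proof (rule linear_map_bitI [OF M vectorspace_interval_sum])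
      show "\<mu> h x \<in> carrier (vsp M (x, h)) \<rightarrow> carrier (vsp (D h) x)" using \<mu>_carrier [OF h x] by auto
      fix v w assume vw: "v \<in> carrier (vsp M (x, h))" "w \<in> carrier (vsp M (x, h))"
      interpret D: vectorspace class_ring "vsp (D h) x" by (rule vectorspace_interval_sum)
      interpret \<psi>: linear_map class_ring "vsp M (x, h)" "vsp Q (x, h)" "\<psi> (x, h)"
        by (rule \<psi>_linear [OF grid [OF x]])
      show "\<mu> h x (v \<oplus>\<^bsub>vsp M (x, h)\<^esub> w) = \<mu> h x v \<oplus>\<^bsub>vsp (D h) x\<^esub> \<mu> h x w"
      proof (rule \<mu>_eqI)
        show "h \<le> n" using h by simp
        show "\<mu> h x v \<oplus>\<^bsub>vsp (D h) x\<^esub> \<mu> h x w \<in> carrier (vsp (D h) x)"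
          using vw \<mu>_carrier [OF h x] by auto
        show "\<nu> h x (\<mu> h x v \<oplus>\<^bsub>vsp (D h) x\<^esub> \<mu> h x w) = \<psi> (x, h) (v \<oplus>\<^bsub>vsp M (x, h)\<^esub> w)"
          using vw \<nu>_\<mu> [OF h x] x by (simp add: \<nu>_add)
      qed
    qed
    then show "linear_map class_ring (vsp (slice M h) x) (vsp (D h) x) (\<mu> h x)"
      by (simp add: slice_def)
    fix x' v assume x': "x' \<in> {1..m}" "x \<le> x'" and v: "v \<in> carrier (vsp (slice M h) x)"
    have v': "v \<in> carrier (vsp M (x, h))" using v by (simp add: slice_def)
    have "\<mu> h x' (tmap M (x, h) (x', h) v) = tmap (D h) x x' (\<mu> h x v)"
    proof (rule \<mu>_eqI)
      show "h \<le> n" using h by simp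
      show "tmap (D h) x x' (\<mu> h x v) \<in> carrier (vsp (D h) x')" by (rule tmap_D_carrier)
      show "\<nu> h x' (tmap (D h) x x' (\<mu> h x v)) = \<psi> (x', h) (tmap M (x, h) (x', h) v)"
        using \<nu>_natural [of h x x' "\<mu> h x v"] \<mu>_carrier [OF h x v'] h x' \<nu>_\<mu> [OF h x v']
          \<psi>_natural [OF grid [OF x] grid [OF x'(1)] _ v'] by (simp add: less_eq_prod_def)
    qed
    then show "\<mu> h x' (tmap (slice M h) x x' v) = tmap (D h) x x' (\<mu> h x v)"
      by (simp add: slice_def)
  qed
qed


section \<open>Matrices of the maps between consecutive heights\<close>

lemma sum_columns_rel_span:
  assumes h: "h < n" and j: "j \<in> nz h" and x: "bx (U h j) \<le> x"
    and S: "S = {j' \<in> insert j (A (Suc h) j). alive (Suc h) j' \<and> bx (U (Suc h) j') \<le> x \<and> x < col_x m P j'}"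
  shows "(\<lambda>i. (\<Sum>j'\<in>S. U (Suc h) j' i) + U h j i) \<in> rel_span x (Suc h)"
proof -
  let ?A = "insert j (A (Suc h) j)"
  have j': "j < n_cols P" "col_y P j \<le> Suc h" using j by (auto simp: nz_def)
  note A = A_subset [OF h j'] A_finite [OF h j']
  have "j \<notin> A (Suc h) j" using A by auto
  have "(\<Sum>j'\<in>S. U (Suc h) j' i) + U h j i = (\<Sum>j'\<in>?A - S. U (Suc h) j' i)" for i
  proof -
    have "U h j i = (\<Sum>j'\<in>?A. U (Suc h) j' i)"
      using U_Suc [OF h j'] A(2) \<open>j \<notin> A (Suc h) j\<close> by (simp add: fun_eq_iff)
    also have "\<dots> = (\<Sum>j'\<in>?A - S. U (Suc h) j' i) + (\<Sum>j'\<in>S. U (Suc h) j' i)"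
      by (rule sum.subset_diff) (use S A(2) in auto)
    finally show ?thesis by (simp add: ac_simps)
  qed
  moreover have "(\<lambda>i. \<Sum>j'\<in>?A - S. U (Suc h) j' i) \<in> rel_span x (Suc h)"
    unfolding rel_span_def
  proof (rule bit_span_sum)
    fix k assume k: "k \<in> ?A - S"
    then have k': "k < n_cols P" "col_y P k \<le> Suc h" "piv (U (Suc h) k) \<le> piv (U h j)"
      using A(1) j' piv_U_Suc_le [OF h j'] by auto
    \<comment> \<open>A column left out of \<open>S\<close> is zero or a relation: comparing pivots
      with the old column, it is born by \<open>x\<close>, and as it is not a bar alive at
      \<open>x\<close>, its death is at most \<open>x\<close>.\<close>
    have "U (Suc h) k \<in> rel_span x (Suc h)"
    proof (cases "k \<in> nz (Suc h)")
      case False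
      then have "U (Suc h) k = (\<lambda>_. 0)" using k' h by (intro U_eq_0) (auto simp: nz_def)
      then show ?thesis by (simp add: rel_span_def bit_span.zero)
    next
      case True
      have "bx (U (Suc h) k) \<le> x" using bx_mono [OF k'(3)] x by simp
      then have "\<not> x < col_x m P k" using k True unfolding S by (auto simp: alive_def)
      then show ?thesis using k' h by (intro U_in_rel_span) (auto simp: cols_def)
    qed
    then show "U (Suc h) k \<in> bit_span (col_vec P ` cols (Suc h) x)" by (simp add: rel_span_def)
  qed (use A in auto)
  ultimately show ?thesis by simp
qed

text \<open>The unit vector of bar \<open>k\<close> corresponds to the old column of that bar. The
  vertical map keeps this representative, and up to relations it is the sum of those new candidate
  columns that are alive at \<open>x\<close>. The scalar \<open>a\<close> must be 0 outside the
  source interval, which is the first alternative of the hypothesis on \<open>a\<close>.\<close>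

lemma component_eta:
  assumes h: "1 \<le> h" "Suc h \<le> n" and x: "x \<in> {1..m}" and k: "k < length (al h)"
    and l: "l < length (al (Suc h))"
    and a: "a = 0 \<or> bx (U h (al h ! k)) \<le> x \<and> x < col_x m P (al h ! k)"
  shows "component (bars h) (eta M \<mu> h) l k x a =
    (if al (Suc h) ! l \<in> insert (al h ! k) (A (Suc h) (al h ! k)) \<and>
        bx (U (Suc h) (al (Suc h) ! l)) \<le> x \<and> x < col_x m P (al (Suc h) ! l) then a else 0)"
proof -
  define j where "j = al h ! k"
  have j: "j \<in> nz h" using alive_nth [OF k] by (simp add: j_def alive_def)
  define e where "e = (\<lambda>k'\<in>{..<length (bars h)}. if k' = k then a else 0)"
  have h': "h \<in> {1..n}" "Suc h \<in> {1..n}" "h \<le> n" "h < n" using h by auto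
  have grid: "(x, h) \<in> grid m n" "(x, Suc h) \<in> grid m n" using h' x by (auto simp: grid_def)
  have le: "(x, h) \<le> (x, Suc h)" by (simp add: less_eq_prod_def)
  have e: "e \<in> carrier (vsp (D h) x)" unfolding carrier_D e_def using a by auto
  define v where "v = inv_into (carrier (vsp M (x, h))) (\<mu> h x) e"
  have v: "v \<in> carrier (vsp M (x, h))" "\<mu> h x v = e"
    using \<mu>_bij [OF h'(1) x] e unfolding v_def bij_betw_def
    by (auto intro: inv_into_into f_inv_into_f)
  have comb_e: "comb h e = (\<lambda>i. a * U h j i)"
  proof
    fix i
    have "comb h e i = (\<Sum>k'<length (al h). if k' = k then a * U h j i else 0)"
      unfolding comb_def e_def by (rule sum.cong) (auto simp: j_def)
    then show "comb h e i = a * U h j i" using k by simp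
  qed
  have "\<psi> (x, h) v = \<nu> h x e" using \<nu>_\<mu> [OF h'(1) x v(1)] v(2) by simp
  then have "\<psi> (x, Suc h) (tmap M (x, h) (x, Suc h) v) = tmap Q (x, h) (x, Suc h) (\<nu> h x e)"
    using \<psi>_natural [OF grid le v(1)] by simp
  also have "\<dots> = cls x (Suc h) (comb h e)"
    unfolding \<nu>_def using x by (intro tmap_Q comb_vecs [OF h'(3) e]) auto
  finally have img: "\<psi> (x, Suc h) (tmap M (x, h) (x, Suc h) v) = cls x (Suc h) (comb h e)" .
  let ?P = "\<lambda>j'. j' \<in> insert j (A (Suc h) j) \<and> bx (U (Suc h) j') \<le> x \<and> x < col_x m P j'"
  let ?w = "\<lambda>l\<in>{..<length (al (Suc h))}. if ?P (al (Suc h) ! l) then a else 0"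
  have w: "?w \<in> carrier (vsp (D (Suc h)) x)" unfolding carrier_D by auto
  have "\<nu> (Suc h) x ?w = cls x (Suc h) (comb h e)"
    unfolding \<nu>_def
  proof (subst cls_eq_iff [OF comb_vecs])
    show "Suc h \<le> n" using h by simp
    show "?w \<in> carrier (vsp (D (Suc h)) x)" by (rule w)
    show "comb h e \<in> vecs x (Suc h)"
      using comb_vecs [OF h'(3) e] by (rule vecs_mono [rotated 2]) auto
    let ?S = "{j' \<in> insert j (A (Suc h) j). alive (Suc h) j' \<and> bx (U (Suc h) j') \<le> x \<and> x < col_x m P j'}"
    have comb_w: "comb (Suc h) ?w i = a * (\<Sum>j'\<in>?S. U (Suc h) j' i)" for i
    proof -
      have "comb (Suc h) ?w i = (\<Sum>l<length (al (Suc h)).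
          (if ?P (al (Suc h) ! l) then a * U (Suc h) (al (Suc h) ! l) i else 0))"
        unfolding comb_def by (rule sum.cong) auto
      also have "\<dots> = (\<Sum>j' | alive (Suc h) j'. if ?P j' then a * U (Suc h) j' i else 0)"
        by (rule sum_al)
      also have "\<dots> = (\<Sum>j'\<in>?S. a * U (Suc h) j' i)"
        by (rule sum.mono_neutral_cong_right) auto
      finally show ?thesis by (simp add: sum_distrib_left)
    qed
    have cw: "comb (Suc h) ?w = (\<lambda>i. a * (\<Sum>j'\<in>?S. U (Suc h) j' i))"
      by (rule ext) (rule comb_w)
    show "(\<lambda>i. comb (Suc h) ?w i + comb h e i) \<in> rel_span x (Suc h)"
    proof (cases "a = 0")
      case True
      then show ?thesis unfolding cw comb_e by (simp add: rel_span_def bit_span.zero)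
    next
      case False
      then have "a = 1" "bx (U h j) \<le> x" using a by (auto simp: j_def)
      then show ?thesis
        using sum_columns_rel_span [OF h'(4) j _ refl, of x] unfolding cw comb_e by simp
    qed
  qed
  then have "\<mu> (Suc h) x (tmap M (x, h) (x, Suc h) v) = ?w"
    using h w img by (intro \<mu>_eqI) auto
  then have "eta M \<mu> h x e = ?w" by (simp add: eta_def v_def)
  then show ?thesis using l by (simp add: component_def e_def j_def)
qed

text \<open>The birth of the source bar is the grade to test. All candidates for targets are born by
  then, because their pivots are not larger; the component is therefore nonzero exactly for the
  candidates that have not died there.\<close>

lemma matrix_entry_iff:
  assumes h: "1 \<le> h" "Suc h \<le> n" and k: "k < length (al h)" and l: "l < length (al (Suc h))"
  shows "matrix_entry m (bars h) (eta M \<mu> h) l k = 1 \<longleftrightarrow>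
    al (Suc h) ! l \<in> insert (al h ! k) (A (Suc h) (al h ! k)) \<and>
    bx (U h (al h ! k)) < col_x m P (al (Suc h) ! l)"
proof -
  define j where "j = al h ! k"
  define j' where "j' = al (Suc h) ! l"
  have j: "alive h j" "j \<in> nz h" using alive_nth [OF k] by (auto simp: j_def alive_def)
  then have jc: "j < n_cols P" "col_y P j \<le> Suc h" by (auto simp: nz_def)
  have "h < n" using h by simp
  have carrier: "carrier (vsp (interval_pm (bars h ! k)) x)
      = (if bx (U h j) \<le> x \<and> x < col_x m P j then UNIV else {0})" for x
    using k by (simp add: interval_pm_def bit_space_def j_def)
  have comp: "component (bars h) (eta M \<mu> h) l k x a \<noteq> 0 \<longleftrightarrow> a \<noteq> 0 \<and> j' \<in> insert j (A (Suc h) j) \<and>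
        bx (U (Suc h) j') \<le> x \<and> x < col_x m P j'"
    if "x \<in> {1..m}" "a \<in> carrier (vsp (interval_pm (bars h ! k)) x)" for x a
    using component_eta [OF h that(1) k l, of a] that(2) unfolding carrier j_def [symmetric] j'_def [symmetric]
    by (auto split: if_splits)
  have "matrix_entry m (bars h) (eta M \<mu> h) l k = 1 \<longleftrightarrow> (\<exists>x\<in>{1..m}.
      \<exists>a\<in>carrier (vsp (interval_pm (bars h ! k)) x). component (bars h) (eta M \<mu> h) l k x a \<noteq> 0)"
    unfolding matrix_entry_def by simp
  also have "\<dots> \<longleftrightarrow> (\<exists>x\<in>{1..m}. \<exists>a\<in>carrier (vsp (interval_pm (bars h ! k)) x). a \<noteq> 0 \<and>
      j' \<in> insert j (A (Suc h) j) \<and> bx (U (Suc h) j') \<le> x \<and> x < col_x m P j')"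
    using comp by (intro bex_cong refl) blast
  also have "\<dots> \<longleftrightarrow> (\<exists>x\<in>{1..m}. bx (U h j) \<le> x \<and> x < col_x m P j \<and>
      j' \<in> insert j (A (Suc h) j) \<and> bx (U (Suc h) j') \<le> x \<and> x < col_x m P j')"
    unfolding carrier by (intro bex_cong refl) (auto split: if_splits intro: exI [of _ 1])
  also have "\<dots> \<longleftrightarrow> j' \<in> insert j (A (Suc h) j) \<and> bx (U h j) < col_x m P j'"
  proof
    assume *: "j' \<in> insert j (A (Suc h) j) \<and> bx (U h j) < col_x m P j'"
    have "(bx (U h j), col_x m P j) \<in> set (bars h)" using j by (auto simp: bars_def)
    from bars_range [OF this] h have "1 \<le> bx (U h j)" "bx (U h j) \<le> m" "bx (U h j) < col_x m P j"
      by auto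
    moreover have "piv (U (Suc h) j') \<le> piv (U h j)"
      using * A_subset [OF \<open>h < n\<close> jc] piv_U_Suc_le [OF \<open>h < n\<close> jc] by auto
    ultimately show "\<exists>x\<in>{1..m}. bx (U h j) \<le> x \<and> x < col_x m P j \<and>
      j' \<in> insert j (A (Suc h) j) \<and> bx (U (Suc h) j') \<le> x \<and> x < col_x m P j'"
      using * bx_mono by (intro bexI [of _ "bx (U h j)"]) auto
  qed auto
  finally show ?thesis by (simp add: j_def j'_def)
qed

definition edge :: "nat \<Rightarrow> nat \<Rightarrow> nat \<Rightarrow> bool" where
  "edge h j j' \<longleftrightarrow> alive h j \<and> alive (Suc h) j' \<and> j' \<in> insert j (A (Suc h) j) \<and>
     bx (U h j) < col_x m P j'"

lemma graphcode_eq: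
  "graphcode m n M bars \<mu> = \<lparr>
     graph = \<lparr>pverts = {(h, k). h \<in> {1..n} \<and> k < length (al h)},
       parcs = {((h, k), (Suc h, l)) | h k l. 1 \<le> h \<and> Suc h \<le> n \<and> k < length (al h) \<and>
         l < length (al (Suc h)) \<and> edge h (al h ! k) (al (Suc h) ! l)}\<rparr>,
     birth = \<lambda>(h, k). fst (bars h ! k), death = \<lambda>(h, k). snd (bars h ! k), height = fst\<rparr>"
proof -
  have "{((i, k), (i', l)) | i k i' l. i \<in> {1..n} \<and> i' = i + 1 \<and> i' \<le> n \<and> k < length (bars i) \<and>
        l < length (bars i') \<and> matrix_entry m (bars i) (eta M \<mu> i) l k = 1}
    = {((h, k), (Suc h, l)) | h k l. 1 \<le> h \<and> Suc h \<le> n \<and> k < length (al h) \<and>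
         l < length (al (Suc h)) \<and> edge h (al h ! k) (al (Suc h) ! l)}"
    by (auto simp: edge_def matrix_entry_iff)
  then show ?thesis by (simp add: graphcode_def)
qed

section \<open>The compressed graphcode and its removal steps\<close>

abbreviation "kept \<equiv> kept_heights n P"
abbreviation "prev_kept \<equiv> last_kept n P"

lemma no_event:
  assumes h: "h < n" and Y: "\<And>j. j < n_cols P \<Longrightarrow> col_y P j \<noteq> Suc h"
  shows "alive (Suc h) = alive h" "al (Suc h) = al h" "bars (Suc h) = bars h"
    "edge h j j' \<longleftrightarrow> alive h j \<and> j' = j"
proof -
  have U: "U (Suc h) j = U h j \<and> A (Suc h) j = {}" if "j < n_cols P" "col_y P j \<le> Suc h" for j
    using no_event_step [OF h Y that] by simp
  have le: "col_y P j \<le> Suc h \<longleftrightarrow> col_y P j \<le> h" if "j < n_cols P" for j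
    using Y [OF that] by auto
  show alive: "alive (Suc h) = alive h"
  proof
    fix j show "alive (Suc h) j = alive h j"
      using U [of j] le [of j] by (auto simp: alive_def nz_def)
  qed
  then show al: "al (Suc h) = al h" by (simp add: al_def)
  have "map (\<lambda>j. (bx (U (Suc h) j), col_x m P j)) (al h) = map (\<lambda>j. (bx (U h j), col_x m P j)) (al h)"
    using U by (auto simp: alive_def nz_def)
  then show "bars (Suc h) = bars h" by (simp add: bars_def al)
  show "edge h j j' \<longleftrightarrow> alive h j \<and> j' = j"
    using U [of j] by (auto simp: edge_def alive) (auto simp: alive_def nz_def)
qed

lemma not_alive_0: "\<not> alive 0 j"
  using Y_pos by (force simp: alive_def nz_def)

text \<open>Only edges into kept heights remain. Their tails move down to the last kept height and
  keep the position \<open>k\<close>, which makes sense because the list of alive columns does not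
  change in between.\<close>

definition compressed :: "(nat \<times> nat) labeled_graph" where
  "compressed = \<lparr>
     graph = \<lparr>pverts = {(h, k). h \<in> kept \<and> k < length (al h)},
       parcs = {((prev_kept h, k), (Suc h, l)) | h k l. 1 \<le> h \<and> Suc h \<in> kept \<and> k < length (al h) \<and>
         l < length (al (Suc h)) \<and> edge h (al h ! k) (al (Suc h) ! l)}\<rparr>,
     birth = \<lambda>(h, k). fst (bars h ! k), death = \<lambda>(h, k). snd (bars h ! k), height = fst\<rparr>"

lemma removal_steps_compressed: "removal_step\<^sup>*\<^sup>* (graphcode m n M bars \<mu>) compressed"
proof -
  let ?G = "graphcode m n M bars \<mu>"
  let ?V = "{(h, k). h \<in> {1..n} \<and> k < length (al h)}"
  define E where "E = {((h, k), (Suc h, l)) | h k l. 1 \<le> h \<and> Suc h \<le> n \<and> k < length (al h) \<and>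
         l < length (al (Suc h)) \<and> edge h (al h ! k) (al (Suc h) ! l)}"
  let ?D = "{(h, k). h \<in> {1..n} \<and> k < length (al h) \<and> h \<notin> kept}"
  let ?\<pi> = "\<lambda>(h, k). (h - 1, k)" and ?rt = "\<lambda>(h, k). (prev_kept h, k)"
  have G: "pverts (graph ?G) = ?V" "parcs (graph ?G) = E" "birth ?G = (\<lambda>(h, k). fst (bars h ! k))"
    "death ?G = (\<lambda>(h, k). snd (bars h ! k))" "height ?G = fst"
    by (simp_all add: graphcode_eq E_def)
  have "?V = Sigma {1..n} (\<lambda>h. {..<length (al h)})" by auto
  then have finV: "finite ?V" by simp
  have event: "col_y P j \<noteq> h" "col_y P j \<noteq> Suc h" if "1 \<le> h" "h \<le> n" "h \<notin> kept" "j < n_cols P" for h j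
    using that by (auto simp: kept_heights_def)
  have "removal_step\<^sup>*\<^sup>* ?G (?G\<lparr>graph := \<lparr>pverts = pverts (graph ?G) - ?D,
           parcs = {(?rt v, x) | v x. (v, x) \<in> parcs (graph ?G) \<and> x \<notin> ?D}\<rparr>\<rparr>)"
  proof (rule removal_steps_chain [where ht = fst and \<pi> = ?\<pi>])
    show "finite ?D" using finV by (rule rev_finite_subset) auto
    show "?D \<subseteq> pverts (graph ?G)" by (auto simp: G)
    show "parcs (graph ?G) \<subseteq> pverts (graph ?G) \<times> pverts (graph ?G)" by (auto simp: G E_def)
    show "fst v < fst w" if "(v, w) \<in> parcs (graph ?G)" for v w using that by (auto simp: G E_def)
    show "?rt v = v" if "v \<in> pverts (graph ?G) - ?D" for v
      using that by (auto simp: G last_kept_self)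
    fix w assume "w \<in> ?D"
    then obtain h k where w: "w = (h, k)" "1 \<le> h" "h \<le> n" "k < length (al h)" "h \<notin> kept" by auto
    then obtain g where g: "h = Suc g" by (cases h) auto
    have Yg: "\<And>j. j < n_cols P \<Longrightarrow> col_y P j \<noteq> Suc g" using event(1) [OF w(2,3,5)] g by simp
    have gn: "g < n" using w g by simp
    note ev = no_event [OF gn Yg]
    show "?rt w = ?rt (?\<pi> w)" using w g last_kept_Suc by simp
    \<comment> \<open>With no grade equal to 1, the alive columns of height 1 would be those of
      height 0, of which there are none.\<close>
    have g1: "1 \<le> g"
    proof (rule ccontr)
      assume "\<not> 1 \<le> g"
      then have "g = 0" by simp
      with ev(2) w g alive_nth [of k 0] not_alive_0 show False by simp
    qed
    have "h \<noteq> n" using w by (auto simp: kept_heights_def)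
    then have hn: "h < n" using w by simp
    have Yh: "\<And>j. j < n_cols P \<Longrightarrow> col_y P j \<noteq> Suc h" using event(2) [OF w(2,3,5)] .
    note ev' = no_event [OF hn Yh]
    have kg: "k < length (al g)" using w g ev(2) by simp
    have e: "((g', k'), (h, l)) \<in> E \<longleftrightarrow> g' = g \<and> k' = l \<and> l < length (al g)" for g' k' l
      unfolding E_def using g1 w g ev by (auto simp: nth_eq_iff_index_eq)
    have "E\<inverse> `` {w} = {(g, k)}"
    proof (rule Set.set_eqI)
      fix v :: "nat \<times> nat" obtain g' k' where "v = (g', k')" by fastforce
      then show "v \<in> E\<inverse> `` {w} \<longleftrightarrow> v \<in> {(g, k)}" using e [of g' k' k] kg w by auto
    qed
    then have in_w: "E\<inverse> `` {w} = {?\<pi> w}" using w g by simp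
    have "E `` {(g, k)} = {w}"
    proof (rule Set.set_eqI)
      fix v :: "nat \<times> nat" obtain h' l where v: "v = (h', l)" by fastforce
      have "h' = h" if "((g, k), (h', l)) \<in> E" using that g by (auto simp: E_def)
      then show "v \<in> E `` {(g, k)} \<longleftrightarrow> v \<in> {w}" using e [of g k l] kg w v by auto
    qed
    then have out_w: "E `` {?\<pi> w} = {w}" using w g by simp
    have "((h, k), (Suc h, k)) \<in> E" using w hn ev' by (simp add: E_def)
    then have "E `` {w} \<noteq> {}" using w by blast
    then show "(parcs (graph ?G))\<inverse> `` {w} = {?\<pi> w} \<and> parcs (graph ?G) `` {?\<pi> w} = {w} \<and>
        birth ?G (?\<pi> w) = birth ?G w \<and> death ?G (?\<pi> w) = death ?G w \<and> parcs (graph ?G) `` {w} \<noteq> {}"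
      using in_w out_w unfolding G using w g ev(3) by simp
  qed
  moreover have "?G\<lparr>graph := \<lparr>pverts = pverts (graph ?G) - ?D,
           parcs = {(?rt v, x) | v x. (v, x) \<in> parcs (graph ?G) \<and> x \<notin> ?D}\<rparr>\<rparr> = compressed"
  proof -
    have "?V - ?D = {(h, k). h \<in> kept \<and> k < length (al h)}" by (auto simp: kept_heights_def)
    moreover have "{(?rt v, x) | v x. (v, x) \<in> E \<and> x \<notin> ?D} =
       {((prev_kept h, k), (Suc h, l)) | h k l. 1 \<le> h \<and> Suc h \<in> kept \<and> k < length (al h) \<and>
         l < length (al (Suc h)) \<and> edge h (al h ! k) (al (Suc h) ! l)}"
      unfolding E_def by (fastforce simp: kept_heights_def)
    ultimately show ?thesis unfolding G compressed_def
      by (intro labeled_graph.equality) (simp_all add: graphcode_eq)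
  qed
  ultimately show ?thesis by simp
qed


lemma prev_kept_same:
  "h \<le> n \<Longrightarrow> al (prev_kept h) = al h \<and> bars (prev_kept h) = bars h \<and> (al h \<noteq> [] \<longrightarrow> prev_kept h \<in> kept)"
proof (induction h)
  case 0
  have "al 0 = []" using set_al [of 0] not_alive_0 by (metis (no_types, lifting) empty_Collect_eq set_empty)
  moreover have "prev_kept 0 = 0" by (auto simp: last_kept_def kept_heights_def intro!: Max_eqI)
  ultimately show ?case by simp
next
  case (Suc h)
  show ?case
  proof (cases "Suc h \<in> kept")
    case True
    then show ?thesis by (simp add: last_kept_self)
  next
    case False
    then have "\<And>j. j < n_cols P \<Longrightarrow> col_y P j \<noteq> Suc h" using Suc.prems by (auto simp: kept_heights_def)
    with no_event [of h] Suc False show ?thesis by (simp add: last_kept_Suc)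
  qed
qed

text \<open>This gives all out-neighbours of a vertex the same height, since an edge with tail at
  \<open>prev_kept h\<close> ends at \<open>Suc h\<close>. For \<open>h < h'\<close>, the kept
  height \<open>Suc h\<close> lies above \<open>prev_kept h\<close> and is at most
  \<open>prev_kept h'\<close>.\<close>

lemma prev_kept_inj:
  assumes "prev_kept h = prev_kept h'" "Suc h \<in> kept" "Suc h' \<in> kept"
  shows "h = h'"
proof -
  note le = last_kept_le [of n P]
  have ge: "Suc h \<le> prev_kept h'" if "h < h'" "Suc h \<in> kept" for h h'
    unfolding last_kept_def using that by (intro Max_ge) auto
  show ?thesis
    using le [of h] le [of h'] ge [of h h'] ge [of h' h] assms by (cases h h' rule: linorder_cases) auto
qed

lemma finite_compressed: "finite (pverts (graph compressed))"
proof -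
  have "pverts (graph compressed) \<subseteq> Sigma {1..n} (\<lambda>h. {..<length (al h)})"
    by (auto simp: compressed_def kept_heights_def)
  then show ?thesis by (rule finite_subset) simp
qed

lemma compressed_arcs: "parcs (graph compressed) \<subseteq> pverts (graph compressed) \<times> pverts (graph compressed)"
proof -
  have "prev_kept h \<in> kept \<and> k < length (al (prev_kept h))" if "Suc h \<in> kept" "k < length (al h)" for h k
  proof -
    have "h \<le> n" using that by (simp add: kept_heights_def)
    with prev_kept_same [of h] that(2) show ?thesis by auto
  qed
  then show ?thesis by (auto simp: compressed_def)
qed

text \<open>Along an edge the pivot does not increase, which bounds the births. The head is the same
  column or one further left, which bounds the deaths. By \<open>prev_kept_same\<close> the labels
  of a tail can be read at the height just below the head.\<close>

lemma generalized_graphcode_compressed: "generalized_graphcode m n compressed"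
  unfolding generalized_graphcode_def
proof (intro conjI)
  show "pair_fin_digraph (graph compressed)"
    using compressed_arcs finite_compressed finite_subset [OF compressed_arcs]
    by unfold_locales (auto simp: subset_iff)
  show "\<forall>v\<in>pverts (graph compressed). birth compressed v \<in> {1..m} \<and> death compressed v \<in> {1..m + 1} \<and>
        height compressed v \<in> {1..n} \<and> birth compressed v < death compressed v"
  proof
    fix v assume "v \<in> pverts (graph compressed)"
    then obtain h k where v: "v = (h, k)" "h \<in> kept" "k < length (al h)" by (auto simp: compressed_def)
    then have "bars h ! k \<in> set (bars h)" by (metis length_bars nth_mem)
    from bars_range [of "fst (bars h ! k)" "snd (bars h ! k)" h] this v
    show "birth compressed v \<in> {1..m} \<and> death compressed v \<in> {1..m + 1} \<and>
        height compressed v \<in> {1..n} \<and> birth compressed v < death compressed v"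
      by (auto simp: compressed_def kept_heights_def)
  qed
  show "\<forall>v w w'. (v, w) \<in> parcs (graph compressed) \<and> (v, w') \<in> parcs (graph compressed) \<longrightarrow>
        height compressed w = height compressed w'"
    using prev_kept_inj by (auto simp: compressed_def)
  show "\<forall>(v, w)\<in>parcs (graph compressed).
      lhd_interval (birth compressed w, death compressed w) (birth compressed v, death compressed v)"
  proof clarify
    fix g k h' l assume "((g, k), (h', l)) \<in> parcs (graph compressed)"
    then obtain h where h: "g = prev_kept h" "h' = Suc h" "Suc h \<in> kept" "k < length (al h)"
      "l < length (al (Suc h))" "edge h (al h ! k) (al (Suc h) ! l)"
      by (auto simp: compressed_def)
    define j where "j = al h ! k"
    define j' where "j' = al (Suc h) ! l"
    have hn: "h < n" using h(3) by (simp add: kept_heights_def)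
    have e: "alive h j" "alive (Suc h) j'" "j' \<in> insert j (A (Suc h) j)" "bx (U h j) < col_x m P j'"
      using h(6) by (auto simp: edge_def j_def j'_def)
    then have j: "j < n_cols P" "col_y P j \<le> Suc h" "j' < n_cols P" by (auto simp: alive_def nz_def)
    have "piv (U (Suc h) j') \<le> piv (U h j)"
      using e A_subset [OF hn j(1,2)] piv_U_Suc_le [OF hn j(1,2)] by auto
    then have "bx (U (Suc h) j') \<le> bx (U h j)" by (rule bx_mono)
    moreover have "col_x m P j' \<le> col_x m P j"
      using e A_subset [OF hn j(1,2)] crk_mono [of j' j] j by auto
    moreover have "bars g = bars h" "al g = al h" using prev_kept_same [of h] hn h(1) by auto
    ultimately show "lhd_interval (birth compressed (h', l), death compressed (h', l))
        (birth compressed (g, k), death compressed (g, k))"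
      using e h by (simp add: compressed_def lhd_interval_def j_def j'_def)
  qed
qed

lemma compression_compressed: "compression m n (graphcode m n M bars \<mu>) compressed"
  by (simp add: compression_def removal_steps_compressed generalized_graphcode_compressed)

text \<open>The program names a vertex by height and column, the graphcode by height and position.
  The passage between the two is the isomorphism that \<open>outputs\<close> asks for.\<close>

lemma outputs_compressed:
  fixes vid :: "nat \<times> nat \<Rightarrow> nat"
  assumes bij: "bij_betw vid {(h, j). h \<in> kept \<and> alive h j} {..<s ''verts'' 0}"
    and lab: "\<And>h j. h \<in> kept \<Longrightarrow> alive h j \<Longrightarrow> s ''birth'' (vid (h, j)) = bx (U h j) \<and>
      s ''death'' (vid (h, j)) = col_x m P j \<and> s ''height'' (vid (h, j)) = h"
    and arcs: "(\<lambda>e. (s ''source'' e, s ''target'' e)) ` {..<s ''arcs'' 0} =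
      {(vid (prev_kept h, j), vid (Suc h, j')) | h j j'. 1 \<le> h \<and> Suc h \<in> kept \<and> edge h j j'}"
    and inj: "inj_on (\<lambda>e. (s ''source'' e, s ''target'' e)) {..<s ''arcs'' 0}"
  shows "outputs s compressed"
proof -
  let ?f = "\<lambda>(h, k). vid (h, al h ! k)"
  have "bij_betw (\<lambda>(h, k). (h, al h ! k)) (pverts (graph compressed)) {(h, j). h \<in> kept \<and> alive h j}"
    unfolding bij_betw_def
  proof
    show "inj_on (\<lambda>(h, k). (h, al h ! k)) (pverts (graph compressed))"
      by (auto simp: inj_on_def compressed_def nth_eq_iff_index_eq)
    show "(\<lambda>(h, k). (h, al h ! k)) ` pverts (graph compressed) = {(h, j). h \<in> kept \<and> alive h j}"
    proof
      show "{(h, j). h \<in> kept \<and> alive h j} \<subseteq> (\<lambda>(h, k). (h, al h ! k)) ` pverts (graph compressed)"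
      proof clarify
        fix h j assume *: "h \<in> kept" "alive h j"
        then obtain k where "k < length (al h)" "al h ! k = j"
          using set_al [of h] by (metis in_set_conv_nth mem_Collect_eq)
        with * show "(h, j) \<in> (\<lambda>(h, k). (h, al h ! k)) ` pverts (graph compressed)"
          by (intro image_eqI [of _ _ "(h, k)"]) (auto simp: compressed_def)
      qed
    qed (auto simp: compressed_def)
  qed
  from bij_betw_trans [OF this bij]
  have f: "bij_betw ?f (pverts (graph compressed)) {..<s ''verts'' 0}"
    by (simp add: comp_def case_prod_unfold)
  have "map_prod ?f ?f ` parcs (graph compressed)
      = {(vid (prev_kept h, j), vid (Suc h, j')) | h j j'. 1 \<le> h \<and> Suc h \<in> kept \<and> edge h j j'}"
    (is "?L = ?R")
  proof
    have al: "al (prev_kept h) = al h" if "Suc h \<in> kept" for h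
      using that prev_kept_same [of h] by (auto simp: kept_heights_def)
    show "?L \<subseteq> ?R"
      by (fastforce simp: compressed_def al)
    show "?R \<subseteq> ?L"
    proof clarify
      fix h j j' assume *: "1 \<le> h" "Suc h \<in> kept" "edge h j j'"
      then have "j \<in> set (al h)" "j' \<in> set (al (Suc h))" by (auto simp: edge_def)
      then obtain k l where "k < length (al h)" "al h ! k = j" "l < length (al (Suc h))" "al (Suc h) ! l = j'"
        by (metis in_set_conv_nth)
      with * al show "(vid (prev_kept h, j), vid (Suc h, j')) \<in> ?L"
        by (intro image_eqI [of _ _ "((prev_kept h, k), (Suc h, l))"]) (auto simp: compressed_def)
    qed
  qed
  with arcs have "parcs (graph (output_graph s)) = map_prod ?f ?f ` parcs (graph compressed)"
    by (simp add: output_graph_def)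
  moreover have "birth (output_graph s) (?f v) = birth compressed v \<and>
      death (output_graph s) (?f v) = death compressed v \<and>
      height (output_graph s) (?f v) = height compressed v" if "v \<in> pverts (graph compressed)" for v
    using that lab by (auto simp: compressed_def output_graph_def)
  ultimately have "labeled_graph_iso compressed (output_graph s)"
    unfolding labeled_graph_iso_def using f
    by (intro exI [of _ ?f]) (simp add: output_graph_def)
  with inj show ?thesis by (simp add: outputs_def)
qed

text \<open>The arc list has no repetitions, so the two counters in the final store give the size of
  the graph. Its bound can thus be maintained as an invariant of the run.\<close>

lemma graph_size_output:
  assumes "outputs s compressed"
  shows "graph_size compressed = s ''verts'' 0 + s ''arcs'' 0"
proof -
  obtain f where f: "bij_betw f (pverts (graph compressed)) {..<s ''verts'' 0}"
    "(\<lambda>e. (s ''source'' e, s ''target'' e)) ` {..<s ''arcs'' 0} = map_prod f f ` parcs (graph compressed)"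
    and inj: "inj_on (\<lambda>e. (s ''source'' e, s ''target'' e)) {..<s ''arcs'' 0}"
    using assms by (auto simp: outputs_def labeled_graph_iso_def output_graph_def)
  have "inj_on (map_prod f f) (parcs (graph compressed))"
    using compressed_arcs bij_betw_imp_inj_on [OF f(1)]
    by (blast intro: inj_on_subset map_prod_inj_on)
  then have "card (parcs (graph compressed)) = card ((\<lambda>e. (s ''source'' e, s ''target'' e)) ` {..<s ''arcs'' 0})"
    unfolding f(2) by (simp add: card_image)
  also have "\<dots> = s ''arcs'' 0" using inj by (simp add: card_image)
  finally show ?thesis using bij_betw_same_card [OF f(1)] by (simp add: graph_size_def)
qed

end

section \<open>Amortized total correctness for the machine\<close>

primrec loop_free :: "com \<Rightarrow> bool" where
  "loop_free Skip \<longleftrightarrow> True"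
| "loop_free (Put a e1 e2) \<longleftrightarrow> True"
| "loop_free (Seq c1 c2) \<longleftrightarrow> loop_free c1 \<and> loop_free c2"
| "loop_free (Cond b c1 c2) \<longleftrightarrow> loop_free c1 \<and> loop_free c2"
| "loop_free (Loop b c) \<longleftrightarrow> False"

primrec exec :: "com \<Rightarrow> store \<Rightarrow> store" where
  "exec Skip s = s"
| "exec (Put a e1 e2) s = s(a := (s a)(aval e1 s := aval e2 s))"
| "exec (Seq c1 c2) s = exec c2 (exec c1 s)"
| "exec (Cond b c1 c2) s = (if bval b s then exec c1 s else exec c2 s)"
| "exec (Loop b c) s = s"

primrec max_cost :: "com \<Rightarrow> nat" where
  "max_cost Skip = 1"
| "max_cost (Put a e1 e2) = 1 + acost e1 + acost e2"
| "max_cost (Seq c1 c2) = max_cost c1 + max_cost c2"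
| "max_cost (Cond b c1 c2) = 1 + bcost b + max (max_cost c1) (max_cost c2)"
| "max_cost (Loop b c) = 0"

text \<open>The final store of such a program is computed by simplification with
  \<open>exec\<close>, and its cost bound is the same for all stores. Invariants are then a matter
  of loops only.\<close>

lemma run_loop_free: "loop_free c \<Longrightarrow> \<exists>t\<le>max_cost c. run c s t (exec c s)"
proof (induction c arbitrary: s)
  case Skip
  then show ?case using run_Skip by auto
next
  case (Put a e1 e2)
  show ?case unfolding exec.simps max_cost.simps using run_Put [of a e1 e2 s] by blast
next
  case (Seq c1 c2)
  obtain t1 where "t1 \<le> max_cost c1" "run c1 s t1 (exec c1 s)" using Seq by auto
  moreover obtain t2 where "t2 \<le> max_cost c2" "run c2 (exec c1 s) t2 (exec c2 (exec c1 s))"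
    using Seq by auto
  ultimately show ?case using run_Seq by (intro exI [of _ "t1 + t2"]) auto
next
  case (Cond b c1 c2)
  show ?case
  proof (cases "bval b s")
    case True
    obtain t where "t \<le> max_cost c1" "run c1 s t (exec c1 s)" using Cond by auto
    then show ?thesis using True run_Cond_True by (intro exI [of _ "1 + bcost b + t"]) auto
  next
    case False
    obtain t where "t \<le> max_cost c2" "run c2 s t (exec c2 s)" using Cond by auto
    then show ?thesis using False run_Cond_False by (intro exI [of _ "1 + bcost b + t"]) auto
  qed
qed simp

text \<open>A total correctness triple with amortized time: the run may exceed \<open>T\<close> by
  as much as it lowers the potential \<open>\<Phi>\<close>. Potential 0 gives the plain
  triple.\<close>

definition runs :: "(store \<Rightarrow> nat) \<Rightarrow> com \<Rightarrow> store \<Rightarrow> nat \<Rightarrow> (store \<Rightarrow> bool) \<Rightarrow> bool" where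
  "runs \<Phi> c s T Q \<longleftrightarrow> (\<exists>t s'. run c s t s' \<and> t + \<Phi> s' \<le> T + \<Phi> s \<and> Q s')"

lemma runs_mono:
  "runs \<Phi> c s T Q \<Longrightarrow> T \<le> T' \<Longrightarrow> (\<And>s'. Q s' \<Longrightarrow> Q' s') \<Longrightarrow> runs \<Phi> c s T' Q'"
  unfolding runs_def by (meson add_right_mono order_trans)

lemma runs_potential:
  "runs (\<lambda>_. 0) c s T Q \<Longrightarrow> (\<And>s'. Q s' \<Longrightarrow> \<Phi> s' \<le> \<Phi> s) \<Longrightarrow> runs \<Phi> c s T Q"
  unfolding runs_def by (metis add.right_neutral add_mono)

lemma runs_Seq:
  "runs \<Phi> c1 s T1 R \<Longrightarrow> (\<And>s1. R s1 \<Longrightarrow> runs \<Phi> c2 s1 T2 Q) \<Longrightarrow> runs \<Phi> (Seq c1 c2) s (T1 + T2) Q"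
proof -
  assume "runs \<Phi> c1 s T1 R" and 2: "\<And>s1. R s1 \<Longrightarrow> runs \<Phi> c2 s1 T2 Q"
  then obtain t1 s1 where 1: "run c1 s t1 s1" "t1 + \<Phi> s1 \<le> T1 + \<Phi> s" "R s1"
    by (auto simp: runs_def)
  from 2 [OF this(3)] obtain t2 s2 where "run c2 s1 t2 s2" "t2 + \<Phi> s2 \<le> T2 + \<Phi> s1" "Q s2"
    by (auto simp: runs_def)
  with 1 show ?thesis unfolding runs_def
    by (intro exI [of _ "t1 + t2"] exI [of _ s2]) (auto intro: run_Seq)
qed

lemma runs_Cond:
  assumes "bval b s \<Longrightarrow> runs \<Phi> c1 s T Q" "\<not> bval b s \<Longrightarrow> runs \<Phi> c2 s T Q"
  shows "runs \<Phi> (Cond b c1 c2) s (1 + bcost b + T) Q"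
proof (cases "bval b s")
  case True
  from assms(1) [OF this] obtain t s' where "run c1 s t s'" "t + \<Phi> s' \<le> T + \<Phi> s" "Q s'"
    by (auto simp: runs_def)
  with run_Cond_True [OF True this(1)] show ?thesis unfolding runs_def
    by (intro exI [of _ "1 + bcost b + t"] exI [of _ s']) auto
next
  case False
  from assms(2) [OF this] obtain t s' where "run c2 s t s'" "t + \<Phi> s' \<le> T + \<Phi> s" "Q s'"
    by (auto simp: runs_def)
  with run_Cond_False [OF False this(1)] show ?thesis unfolding runs_def
    by (intro exI [of _ "1 + bcost b + t"] exI [of _ s']) auto
qed

lemma runs_exec:
  assumes "loop_free c" "max_cost c \<le> T" "\<Phi> (exec c s) \<le> \<Phi> s" "Q (exec c s)"
  shows "runs \<Phi> c s T Q"
  using run_loop_free [OF assms(1), of s] assms(2-4) unfolding runs_def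
  by (meson add_mono order_trans)

text \<open>The potential pays for every iteration and also shows termination.\<close>

lemma runs_Loop_potential:
  assumes "I s"
    and body: "\<And>s. I s \<Longrightarrow> bval b s \<Longrightarrow>
      \<exists>t s'. run c s t s' \<and> 1 + bcost b + t + \<Phi> s' \<le> \<Phi> s \<and> I s'"
  shows "runs \<Phi> (Loop b c) s (1 + bcost b) (\<lambda>s'. I s' \<and> \<not> bval b s')"
  using assms(1)
proof (induction "\<Phi> s" arbitrary: s rule: less_induct)
  case less
  show ?case
  proof (cases "bval b s")
    case True
    from body [OF less.prems this] obtain t s' where
      1: "run c s t s'" "1 + bcost b + t + \<Phi> s' \<le> \<Phi> s" "I s'" by blast
    then have "\<Phi> s' < \<Phi> s" by simp
    from less.hyps [OF this 1(3)] obtain t2 s2 where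
      2: "run (Loop b c) s' t2 s2" "t2 + \<Phi> s2 \<le> 1 + bcost b + \<Phi> s'" "I s2" "\<not> bval b s2"
      by (auto simp: runs_def)
    from run_Loop_True [OF True 1(1) 2(1)] 1(2) 2(2-4) show ?thesis unfolding runs_def
      by (intro exI [of _ "1 + bcost b + t + t2"] exI [of _ s2]) auto
  next
    case False
    with run_Loop_False [OF this, of c] less.prems show ?thesis unfolding runs_def
      by (intro exI [of _ "1 + bcost b"] exI [of _ s]) auto
  qed
qed

text \<open>The measure bounds the number of iterations, each charged with \<open>T\<close>. Work of
  a body beyond \<open>T\<close> is paid by the potential, whose total drop is shared by all
  iterations.\<close>

lemma runs_Loop_measure:
  fixes \<mu> :: "store \<Rightarrow> nat"
  assumes "I s"
    and body: "\<And>s. I s \<Longrightarrow> bval b s \<Longrightarrow> runs \<Phi> c s T (\<lambda>s'. I s' \<and> \<mu> s' < \<mu> s)"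
  shows "runs \<Phi> (Loop b c) s ((\<mu> s + 1) * (1 + bcost b + T)) (\<lambda>s'. I s' \<and> \<not> bval b s')"
  using assms(1)
proof (induction "\<mu> s" arbitrary: s rule: less_induct)
  case less
  let ?K = "1 + bcost b + T"
  show ?case
  proof (cases "bval b s")
    case True
    from body [OF less.prems this] obtain t s' where
      1: "run c s t s'" "t + \<Phi> s' \<le> T + \<Phi> s" "I s'" "\<mu> s' < \<mu> s" by (auto simp: runs_def)
    from less.hyps [OF this(4,3)] obtain t2 s2 where
      2: "run (Loop b c) s' t2 s2" "t2 + \<Phi> s2 \<le> (\<mu> s' + 1) * ?K + \<Phi> s'" "I s2" "\<not> bval b s2"
      by (auto simp: runs_def)
    have "(\<mu> s' + 1) * ?K \<le> \<mu> s * ?K" using 1(4) by (intro mult_right_mono) auto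
    moreover have "(\<mu> s + 1) * ?K = \<mu> s * ?K + (1 + bcost b + T)" by (simp add: algebra_simps)
    ultimately have "1 + bcost b + t + t2 + \<Phi> s2 \<le> (\<mu> s + 1) * ?K + \<Phi> s" using 1(2) 2(2) by linarith
    with run_Loop_True [OF True 1(1) 2(1)] 2(3,4) show ?thesis unfolding runs_def by blast
  next
    case False
    with run_Loop_False [OF this, of c] less.prems show ?thesis unfolding runs_def
      by (intro exI [of _ "1 + bcost b"] exI [of _ s]) auto
  qed
qed

abbreviation var :: "string \<Rightarrow> aexp" where
  "var a \<equiv> Get a (Const 0)"

abbreviation assign :: "string \<Rightarrow> aexp \<Rightarrow> com" where
  "assign a e \<equiv> Put a (Const 0) e"

definition for_loop :: "string \<Rightarrow> aexp \<Rightarrow> com \<Rightarrow> com" where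
  "for_loop v e c = Seq (assign v (Const 0))
     (Loop (Less (var v) e) (Seq c (assign v (Plus (var v) (Const 1)))))"

text \<open>The bound \<open>e\<close> is evaluated anew in every test, hence the requirement that
  the invariant fixes its value. A test costs \<open>acost e + 4\<close> and an increment 6; the
  constant 12 and the extra iteration absorb the initial assignment and the last test.\<close>

lemma runs_for_loop:
  assumes init: "I 0 (s(v := (s v)(0 := 0)))"
    and bound: "\<And>i s. I i s \<Longrightarrow> aval e s = N"
    and pot: "\<And>s i. \<Phi> (s(v := (s v)(0 := i))) = \<Phi> s"
    and body: "\<And>i s. i < N \<Longrightarrow> s v 0 = i \<Longrightarrow> I i s \<Longrightarrow>
      runs \<Phi> c s T (\<lambda>s'. s' v 0 = i \<and> I (Suc i) (s'(v := (s' v)(0 := Suc i))))"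
    and post: "\<And>s'. s' v 0 = N \<Longrightarrow> I N s' \<Longrightarrow> Q s'"
  shows "runs \<Phi> (for_loop v e c) s ((N + 1) * (T + acost e + 12)) Q"
proof -
  let ?b = "Less (var v) e"
  let ?c = "Seq c (assign v (Plus (var v) (Const 1)))"
  have "runs \<Phi> (Loop ?b ?c) s ((N - s v 0) * (T + acost e + 10) + (acost e + 4)) Q"
    if "s v 0 \<le> N" "I (s v 0) s" for s
    using that
  proof (induction "N - s v 0" arbitrary: s)
    case 0
    then have "s v 0 = N" by simp
    then have "\<not> bval ?b s" "Q s" using 0 bound [of N s] post [of s] by auto
    from run_Loop_False [OF this(1), of ?c] this(2) show ?case
      unfolding runs_def by (intro exI [of _ "1 + bcost ?b"] exI [of _ s]) auto
  next
    case (Suc k)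
    then have lt: "s v 0 < N" by simp
    then have b: "bval ?b s" using Suc.prems bound [of "s v 0" s] by simp
    from body [OF lt refl Suc.prems(2)] obtain t s1 where
      1: "run c s t s1" "t + \<Phi> s1 \<le> T + \<Phi> s" "s1 v 0 = s v 0"
      "I (Suc (s v 0)) (s1(v := (s1 v)(0 := Suc (s v 0))))"
      by (auto simp: runs_def)
    let ?s2 = "s1(v := (s1 v)(0 := Suc (s v 0)))"
    have "run (assign v (Plus (var v) (Const 1))) s1 6 ?s2"
      using run_Put [of v "Const 0" "Plus (var v) (Const 1)" s1] 1(3) by (simp add: numeral_eq_Suc)
    with 1(1) have c: "run ?c s (t + 6) ?s2" by (rule run_Seq)
    have "runs \<Phi> (Loop ?b ?c) ?s2 ((N - ?s2 v 0) * (T + acost e + 10) + (acost e + 4)) Q"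
      using Suc.hyps(2) lt 1(4) by (intro Suc.hyps(1)) auto
    moreover have "N - ?s2 v 0 = k" using Suc.hyps(2) by simp
    ultimately obtain t2 s3 where
      2: "run (Loop ?b ?c) ?s2 t2 s3" "t2 + \<Phi> s3 \<le> k * (T + acost e + 10) + (acost e + 4) + \<Phi> ?s2" "Q s3"
      unfolding runs_def by metis
    have "1 + bcost ?b + (t + 6) + t2 + \<Phi> s3 \<le> (N - s v 0) * (T + acost e + 10) + (acost e + 4) + \<Phi> s"
      using 1(2) 2(2) Suc.hyps(2) [symmetric] pot [of s1 "Suc (s v 0)"] by (simp add: numeral_eq_Suc)
    with run_Loop_True [OF b c 2(1)] 2(3) show ?case unfolding runs_def by blast
  qed
  from this [of "s(v := (s v)(0 := 0))"] init have
    "runs \<Phi> (Loop ?b ?c) (s(v := (s v)(0 := 0))) (N * (T + acost e + 10) + (acost e + 4)) Q" by simp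
  then obtain t s' where t: "run (Loop ?b ?c) (s(v := (s v)(0 := 0))) t s'"
    "t + \<Phi> s' \<le> N * (T + acost e + 10) + (acost e + 4) + \<Phi> s" "Q s'"
    by (auto simp: runs_def pot)
  have "run (assign v (Const 0)) s 3 (s(v := (s v)(0 := 0)))"
    using run_Put [of v "Const 0" "Const 0" s] by (simp add: numeral_eq_Suc)
  from run_Seq [OF this t(1)] have "run (for_loop v e c) s (3 + t) s'" by (simp add: for_loop_def)
  moreover have "3 + t + \<Phi> s' \<le> (N + 1) * (T + acost e + 12) + \<Phi> s"
    using t(2) by (simp add: algebra_simps)
  ultimately show ?thesis using t(3) unfolding runs_def by blast
qed

section \<open>Column operations\<close>

definition frame :: "string set \<Rightarrow> store \<Rightarrow> store \<Rightarrow> bool" where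
  "frame X s s' \<longleftrightarrow> (\<forall>a. a \<notin> X \<longrightarrow> s' a = s a)"

lemma frame_refl [simp]: "frame X s s"
  by (simp add: frame_def)

lemma frame_upd [simp]: "a \<in> X \<Longrightarrow> frame X s (s'(a := f)) \<longleftrightarrow> frame X s s'"
  by (auto simp: frame_def)

lemma frameD: "frame X s s' \<Longrightarrow> a \<notin> X \<Longrightarrow> s' a = s a"
  by (simp add: frame_def)

lemma frame_trans: "frame X s s' \<Longrightarrow> frame Y s' s'' \<Longrightarrow> X \<union> Y \<subseteq> Z \<Longrightarrow> frame Z s s''"
  unfolding frame_def by (metis Un_iff subset_iff)

definition column :: "nat \<Rightarrow> store \<Rightarrow> nat \<Rightarrow> nat \<Rightarrow> bit" where
  "column R s j i = (if i < R \<and> s ''w'' (j * R + i) = 1 then 1 else 0)"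

lemma max_on_support_0: "max_on_support 0 f u = 0"
  by (simp add: max_on_support_def)

lemma max_on_support_Suc:
  "max_on_support (Suc i) f u = (if u i \<noteq> 0 then max (f i) (max_on_support i f u) else max_on_support i f u)"
proof -
  have "{i'. i' < Suc i \<and> u i' \<noteq> 0} = (if u i \<noteq> 0 then insert i {i'. i' < i \<and> u i' \<noteq> 0} else {i'. i' < i \<and> u i' \<noteq> 0})"
    by (auto simp: less_Suc_eq)
  then show ?thesis
    unfolding max_on_support_def by (auto simp: insert_commute [of 0])
qed

definition pivot_prog :: com where
  "pivot_prog = Seq (assign ''p'' (Const 0)) (Seq (assign ''x'' (Const 0))
     (for_loop ''i'' (var ''gens'')
       (Cond (Equal (Get ''w'' (Plus (Get ''off'' (var ''j'')) (var ''i''))) (Const 1))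
         (Seq (Cond (Less (var ''p'') (Get ''rk'' (var ''i''))) (assign ''p'' (Get ''rk'' (var ''i''))) Skip)
           (Cond (Less (var ''x'') (Get ''genx'' (var ''i''))) (assign ''x'' (Get ''genx'' (var ''i''))) Skip))
         Skip)))"

lemma runs_pivot:
  assumes R: "s ''gens'' 0 = R" and off: "s ''off'' (s ''j'' 0) = s ''j'' 0 * R"
    and rk: "\<And>i. i < R \<Longrightarrow> s ''rk'' i = rk i" and gx: "\<And>i. i < R \<Longrightarrow> s ''genx'' i = gx i"
  shows "runs (\<lambda>_. 0) pivot_prog s (60 * (R + 1)) (\<lambda>s'. frame {''i'', ''p'', ''x''} s s' \<and>
    s' ''p'' 0 = max_on_support R rk (column R s (s ''j'' 0)) \<and>
    s' ''x'' 0 = max_on_support R gx (column R s (s ''j'' 0)))" (is "runs _ _ _ _ ?Q")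
proof -
  let ?u = "column R s (s ''j'' 0)"
  define I where "I i s' \<longleftrightarrow> frame {''i'', ''p'', ''x''} s s' \<and>
    s' ''p'' 0 = max_on_support i rk ?u \<and> s' ''x'' 0 = max_on_support i gx ?u" for i s'
  let ?b = "Cond (Equal (Get ''w'' (Plus (Get ''off'' (var ''j'')) (var ''i''))) (Const 1))
         (Seq (Cond (Less (var ''p'') (Get ''rk'' (var ''i''))) (assign ''p'' (Get ''rk'' (var ''i''))) Skip)
           (Cond (Less (var ''x'') (Get ''genx'' (var ''i''))) (assign ''x'' (Get ''genx'' (var ''i''))) Skip))
         Skip"
  have loop: "runs (\<lambda>_. 0) (for_loop ''i'' (var ''gens'') ?b) s1 ((R + 1) * (40 + acost (var ''gens'') + 12)) ?Q"
    if s1: "frame {''i'', ''p'', ''x''} s s1" "s1 ''p'' 0 = 0" "s1 ''x'' 0 = 0" for s1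
  proof (rule runs_for_loop [where I = I])
    show "I 0 (s1(''i'' := (s1 ''i'')(0 := 0)))" using s1 by (simp add: I_def max_on_support_0)
    show "aval (var ''gens'') s' = R" if "I i s'" for i s'
      using frameD [of "{''i'', ''p'', ''x''}" s s' "''gens''"] that R by (simp add: I_def)
    show "?Q s'" if "I R s'" for s' using that by (simp add: I_def)
    fix i s' assume i: "i < R" "s' ''i'' 0 = i" and I: "I i s'"
    have fr: "a \<notin> {''i'', ''p'', ''x''} \<Longrightarrow> s' a = s a" for a
      using frameD I unfolding I_def by blast
    have bit: "bval (Equal (Get ''w'' (Plus (Get ''off'' (var ''j'')) (var ''i''))) (Const 1)) s' \<longleftrightarrow> ?u i \<noteq> 0"
      using i by (simp add: fr off column_def)
    show "runs (\<lambda>_. 0) ?b s' 40 (\<lambda>s'. s' ''i'' 0 = i \<and> I (Suc i) (s'(''i'' := (s' ''i'')(0 := Suc i))))"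
    proof (rule runs_exec)
      show "exec ?b s' ''i'' 0 = i \<and> I (Suc i) ((exec ?b s')(''i'' := (exec ?b s' ''i'')(0 := Suc i)))"
        unfolding exec.simps bit using i I rk [of i] gx [of i]
        by (auto simp: I_def fr max_on_support_Suc max_def)
    qed auto
  qed auto
  have "runs (\<lambda>_. 0) pivot_prog s (3 + (3 + (R + 1) * (40 + acost (var ''gens'') + 12))) ?Q"
    unfolding pivot_prog_def
  proof (rule runs_Seq [where R = "\<lambda>s1. s1 = s(''p'' := (s ''p'')(0 := 0))"])
    show "runs (\<lambda>_. 0) (Seq (assign ''x'' (Const 0)) (for_loop ''i'' (var ''gens'') ?b)) s1
        (3 + (R + 1) * (40 + acost (var ''gens'') + 12)) ?Q"
      if "s1 = s(''p'' := (s ''p'')(0 := 0))" for s1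
    proof (rule runs_Seq [where R = "\<lambda>s2. s2 = s1(''x'' := (s1 ''x'')(0 := 0))"])
      show "runs (\<lambda>_. 0) (for_loop ''i'' (var ''gens'') ?b) s2
        ((R + 1) * (40 + acost (var ''gens'') + 12)) ?Q"
        if "s2 = s1(''x'' := (s1 ''x'')(0 := 0))" for s2
        using that \<open>s1 = _\<close> by (intro loop) auto
    qed (rule runs_exec; simp)
  qed (rule runs_exec; simp)
  then show ?thesis by (rule runs_mono) auto
qed

text \<open>Subtraction from 1 flips an entry, provided that it is 0 or 1. This is why the bound on
  the entries of \<open>w\<close> is carried through the invariants.\<close>

definition add_prog :: com where
  "add_prog = for_loop ''i'' (var ''gens'')
     (Cond (Equal (Get ''w'' (Plus (Get ''off'' (var ''k'')) (var ''i''))) (Const 1))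
       (Put ''w'' (Plus (Get ''off'' (var ''j'')) (var ''i''))
         (Minus (Const 1) (Get ''w'' (Plus (Get ''off'' (var ''j'')) (var ''i'')))))
       Skip)"

lemma block_index_eq_iff:
  "i < (R :: nat) \<Longrightarrow> i' < R \<Longrightarrow> j * R + i = j' * R + i' \<longleftrightarrow> j = j' \<and> i = i'"
proof
  assume *: "i < R" "i' < R" "j * R + i = j' * R + i'"
  have "(j * R + i) div R = j" "(j' * R + i') div R = j'" using *(1,2) by auto
  with * show "j = j' \<and> i = i'" by simp
qed simp

lemma runs_add:
  assumes R: "s ''gens'' 0 = R" and jk: "s ''j'' 0 = j" "s ''k'' 0 = k" "j \<noteq> k"
    and off: "s ''off'' j = j * R" "s ''off'' k = k * R"
    and bin: "\<And>a. s ''w'' a \<le> 1"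
  shows "runs (\<lambda>_. 0) add_prog s (60 * (R + 1)) (\<lambda>s'. frame {''i'', ''w''} s s' \<and>
    (\<forall>a. s' ''w'' a \<le> 1) \<and> column R s' j = (\<lambda>i. column R s j i + column R s k i) \<and>
    (\<forall>j'. j' \<noteq> j \<longrightarrow> column R s' j' = column R s j'))" (is "runs _ _ _ _ ?Q")
proof -
  \<comment> \<open>The matrix after the first \<open>i\<close> rows of column \<open>j\<close> have
    been treated. All entries on the right are those of the initial store; this is sound for column
    \<open>k\<close> because \<open>j \<noteq> k\<close>.\<close>
  define wi where "wi i j' i' = (if j' = j \<and> i' < i \<and> s ''w'' (k * R + i') = 1
    then 1 - s ''w'' (j * R + i') else s ''w'' (j' * R + i'))" for i j' i'
  define I where "I i s' \<longleftrightarrow> frame {''i'', ''w''} s s' \<and> (\<forall>a. s' ''w'' a \<le> 1) \<and>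
    (\<forall>j' i'. i' < R \<longrightarrow> s' ''w'' (j' * R + i') = wi i j' i')" for i s'
  let ?b = "Cond (Equal (Get ''w'' (Plus (Get ''off'' (var ''k'')) (var ''i''))) (Const 1))
       (Put ''w'' (Plus (Get ''off'' (var ''j'')) (var ''i''))
         (Minus (Const 1) (Get ''w'' (Plus (Get ''off'' (var ''j'')) (var ''i'')))))
       Skip"
  have "runs (\<lambda>_. 0) add_prog s ((R + 1) * (32 + acost (var ''gens'') + 12)) ?Q"
    unfolding add_prog_def
  proof (rule runs_for_loop [where I = I])
    show "I 0 (s(''i'' := (s ''i'')(0 := 0)))" using bin by (simp add: I_def wi_def)
    show "aval (var ''gens'') s' = R" if "I i s'" for i s'
      using frameD [of "{''i'', ''w''}" s s' "''gens''"] that R by (simp add: I_def)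
    show "?Q s'" if "I R s'" for s'
    proof (intro conjI)
      show "frame {''i'', ''w''} s s'" "\<forall>a. s' ''w'' a \<le> 1" using that by (auto simp: I_def)
      have w: "s' ''w'' (j' * R + i') = wi R j' i'" if "i' < R" for j' i'
        using \<open>I R s'\<close> that by (simp add: I_def)
      have cases: "s ''w'' a = 0 \<or> s ''w'' a = 1" for a using bin [of a] by linarith
      show "column R s' j = (\<lambda>i. column R s j i + column R s k i)"
      proof
        fix i show "column R s' j i = column R s j i + column R s k i"
          using w [of i j] cases [of "j * R + i"] by (auto simp: column_def wi_def)
      qed
      show "\<forall>j'. j' \<noteq> j \<longrightarrow> column R s' j' = column R s j'"
        using w by (auto simp: column_def wi_def fun_eq_iff)
    qed
    fix i s' assume i: "i < R" "s' ''i'' 0 = i" and I: "I i s'"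
    have fr: "a \<notin> {''i'', ''w''} \<Longrightarrow> s' a = s a" for a
      using frameD I unfolding I_def by blast
    have w: "s' ''w'' (j' * R + i') = wi i j' i'" if "i' < R" for j' i'
      using I that by (simp add: I_def)
    have bit: "bval (Equal (Get ''w'' (Plus (Get ''off'' (var ''k'')) (var ''i''))) (Const 1)) s'
        \<longleftrightarrow> s ''w'' (k * R + i) = 1"
      using i jk off w [of i k] by (auto simp: fr wi_def)
    have upd: "exec (Put ''w'' (Plus (Get ''off'' (var ''j'')) (var ''i''))
         (Minus (Const 1) (Get ''w'' (Plus (Get ''off'' (var ''j'')) (var ''i''))))) s'
       = s'(''w'' := (s' ''w'')(j * R + i := 1 - s ''w'' (j * R + i)))"
      using i jk off w [of i j] by (simp add: fr wi_def)
    show "runs (\<lambda>_. 0) ?b s' 32 (\<lambda>s'. s' ''i'' 0 = i \<and> I (Suc i) (s'(''i'' := (s' ''i'')(0 := Suc i))))"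
    proof (rule runs_exec)
      have bin': "\<And>a. s' ''w'' a \<le> 1" using I by (simp add: I_def)
      show "exec ?b s' ''i'' 0 = i \<and> I (Suc i) ((exec ?b s')(''i'' := (exec ?b s' ''i'')(0 := Suc i)))"
      proof (cases "s ''w'' (k * R + i) = 1")
        case True
        have "((s' ''w'')(j * R + i := 1 - s ''w'' (j * R + i))) (j' * R + i') = wi (Suc i) j' i'"
          if "i' < R" for j' i'
          using w [OF that, of j'] True block_index_eq_iff [OF that i(1), of j' j]
          by (auto simp: wi_def less_Suc_eq)
        then show ?thesis using bit upd True i(2) I bin' by (auto simp: I_def)
      next
        case False
        have "wi i j' i' = wi (Suc i) j' i'" for j' i' using False by (auto simp: wi_def less_Suc_eq)
        then show ?thesis using bit False i(2) I by (auto simp: I_def)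
      qed
    qed auto
  qed auto
  then show ?thesis by (rule runs_mono) auto
qed

section \<open>Initialization\<close>

text \<open>The position in a stable sort. Finding all positions by counting takes quadratic time,
  well within the cubic bound, and avoids a sorting program.\<close>

definition rank :: "(nat \<Rightarrow> nat) \<Rightarrow> nat \<Rightarrow> nat \<Rightarrow> nat" where
  "rank f N i = card {k. k < N \<and> (f k < f i \<or> f k = f i \<and> k < i)}"

lemma rank_strict:
  assumes "i < N" "f i < f j \<or> f i = f j \<and> i < j"
  shows "rank f N i < rank f N j"
  unfolding rank_def
proof (rule psubset_card_mono)
  show "{k. k < N \<and> (f k < f i \<or> f k = f i \<and> k < i)} \<subset> {k. k < N \<and> (f k < f j \<or> f k = f j \<and> k < j)}"
    using assms by (intro psubsetI) auto
qed simp

lemma rank_inj: "inj_on (rank f N) {..<N}"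
proof (rule inj_onI)
  fix i j assume *: "i \<in> {..<N}" "j \<in> {..<N}" "rank f N i = rank f N j"
  show "i = j"
  proof (rule ccontr)
    assume "i \<noteq> j"
    then consider "f i < f j \<or> f i = f j \<and> i < j" | "f j < f i \<or> f j = f i \<and> j < i" by linarith
    then show False using rank_strict [of i N f j] rank_strict [of j N f i] * by cases auto
  qed
qed

lemma rank_mono: "i < N \<Longrightarrow> j < N \<Longrightarrow> rank f N i \<le> rank f N j \<Longrightarrow> f i \<le> f j"
  using rank_strict [of j N f i] by (meson linorder_not_less)

lemma rank_less: "i < N \<Longrightarrow> rank f N i < N"
proof -
  assume "i < N"
  then have "{k. k < N \<and> (f k < f i \<or> f k = f i \<and> k < i)} \<subset> {..<N}" by auto
  from psubset_card_mono [OF _ this] show ?thesis by (simp add: rank_def)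
qed

lemma rank_surj: "q < N \<Longrightarrow> \<exists>i<N. rank f N i = q"
proof -
  have "rank f N ` {..<N} = {..<N}"
    using rank_less by (intro endo_inj_surj rank_inj) auto
  then show "q < N \<Longrightarrow> ?thesis" by (metis imageE lessThan_iff)
qed

text \<open>The test is the disjunction from \<open>rank\<close>, in De Morgan form because
  conditions offer only negation and conjunction.\<close>

definition count_prog :: "string \<Rightarrow> string \<Rightarrow> com" where
  "count_prog a N = for_loop ''k'' (var N)
     (Cond (Neg (Conj (Neg (Less (Get a (var ''k'')) (Get a (var ''i''))))
         (Neg (Conj (Equal (Get a (var ''k'')) (Get a (var ''i''))) (Less (var ''k'') (var ''i''))))))
       (assign ''t'' (Plus (var ''t'') (Const 1))) Skip)"

lemma runs_count:
  assumes a: "a \<notin> {''k'', ''t''}" and Nv: "Nv \<notin> {''k'', ''t''}" and N: "s Nv 0 = N"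
  shows "runs (\<lambda>_. 0) (count_prog a Nv) s (60 * (N + 1)) (\<lambda>s'. frame {''k'', ''t''} s s' \<and>
    s' ''t'' 0 = s ''t'' 0 + rank (s a) N (s ''i'' 0))" (is "runs _ _ _ _ ?Q")
proof -
  let ?S = "\<lambda>n. {k. k < n \<and> (s a k < s a (s ''i'' 0) \<or> s a k = s a (s ''i'' 0) \<and> k < s ''i'' 0)}"
  define I where "I n s' \<longleftrightarrow> frame {''k'', ''t''} s s' \<and> s' ''t'' 0 = s ''t'' 0 + card (?S n)" for n s'
  let ?b = "Cond (Neg (Conj (Neg (Less (Get a (var ''k'')) (Get a (var ''i''))))
         (Neg (Conj (Equal (Get a (var ''k'')) (Get a (var ''i''))) (Less (var ''k'') (var ''i''))))))
       (assign ''t'' (Plus (var ''t'') (Const 1))) Skip"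
  have "runs (\<lambda>_. 0) (count_prog a Nv) s ((N + 1) * (40 + acost (var Nv) + 12)) ?Q"
    unfolding count_prog_def
  proof (rule runs_for_loop [where I = I])
    show "I 0 (s(''k'' := (s ''k'')(0 := 0)))" by (simp add: I_def)
    show "aval (var Nv) s' = N" if "I i s'" for i s'
      using frameD [of "{''k'', ''t''}" s s' Nv] that N Nv by (simp add: I_def)
    show "?Q s'" if "I N s'" for s' using that by (simp add: I_def rank_def)
    fix n s' assume n: "n < N" "s' ''k'' 0 = n" and I: "I n s'"
    have fr: "b \<notin> {''k'', ''t''} \<Longrightarrow> s' b = s b" for b
      using frameD I unfolding I_def by blast
    have S: "card (?S (Suc n)) = (if n \<in> ?S (Suc n) then Suc (card (?S n)) else card (?S n))"
    proof -
      have "?S (Suc n) = (if n \<in> ?S (Suc n) then insert n (?S n) else ?S n)"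
        by (auto simp: less_Suc_eq)
      then show ?thesis by (auto split: if_splits)
    qed
    show "runs (\<lambda>_. 0) ?b s' 40 (\<lambda>s'. s' ''k'' 0 = n \<and> I (Suc n) (s'(''k'' := (s' ''k'')(0 := Suc n))))"
    proof (rule runs_exec)
      show "exec ?b s' ''k'' 0 = n \<and> I (Suc n) ((exec ?b s')(''k'' := (exec ?b s' ''k'')(0 := Suc n)))"
        using n I fr [of a] fr [of "''i''"] a by (auto simp: I_def S)
    qed auto
  qed auto
  then show ?thesis by (rule runs_mono) auto
qed

text \<open>Counting starts at 1, since pivot 0 is reserved for the zero column.\<close>

definition rank_rows_prog :: com where
  "rank_rows_prog = for_loop ''i'' (var ''gens'') (Seq (assign ''t'' (Const 1))
     (Seq (count_prog ''genx'' ''gens'') (Put ''rk'' (var ''i'') (var ''t''))))"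

lemma runs_rank_rows:
  assumes R: "s ''gens'' 0 = R"
  shows "runs (\<lambda>_. 0) rank_rows_prog s (100 * (R + 1) ^ 2) (\<lambda>s'. frame {''i'', ''k'', ''t'', ''rk''} s s' \<and>
    (\<forall>i<R. s' ''rk'' i = Suc (rank (s ''genx'') R i)))" (is "runs _ _ _ _ ?Q")
proof -
  define I where "I n s' \<longleftrightarrow> frame {''i'', ''k'', ''t'', ''rk''} s s' \<and>
    (\<forall>i<n. s' ''rk'' i = Suc (rank (s ''genx'') R i))" for n s'
  have "runs (\<lambda>_. 0) rank_rows_prog s ((R + 1) * ((3 + (60 * (R + 1) + 5)) + acost (var ''gens'') + 12)) ?Q"
    unfolding rank_rows_prog_def
  proof (rule runs_for_loop [where I = I])
    show "I 0 (s(''i'' := (s ''i'')(0 := 0)))" by (simp add: I_def)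
    show "aval (var ''gens'') s' = R" if "I i s'" for i s'
      using frameD [of "{''i'', ''k'', ''t'', ''rk''}" s s' "''gens''"] that R by (simp add: I_def)
    show "?Q s'" if "I R s'" for s' using that by (simp add: I_def)
    fix n s' assume n: "n < R" "s' ''i'' 0 = n" and I: "I n s'"
    have fr: "b \<notin> {''i'', ''k'', ''t'', ''rk''} \<Longrightarrow> s' b = s b" for b
      using frameD I unfolding I_def by blast
    let ?Q' = "\<lambda>s'. s' ''i'' 0 = n \<and> I (Suc n) (s'(''i'' := (s' ''i'')(0 := Suc n)))"
    show "runs (\<lambda>_. 0) (Seq (assign ''t'' (Const 1)) (Seq (count_prog ''genx'' ''gens'')
        (Put ''rk'' (var ''i'') (var ''t'')))) s' (3 + (60 * (R + 1) + 5)) ?Q'"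
    proof (rule runs_Seq [where R = "\<lambda>s1. s1 = s'(''t'' := (s' ''t'')(0 := 1))"])
      fix s1 assume s1: "s1 = s'(''t'' := (s' ''t'')(0 := 1))"
      have "runs (\<lambda>_. 0) (count_prog ''genx'' ''gens'') s1 (60 * (R + 1)) (\<lambda>s2. frame {''k'', ''t''} s1 s2 \<and>
          s2 ''t'' 0 = s1 ''t'' 0 + rank (s1 ''genx'') R (s1 ''i'' 0))"
        by (rule runs_count) (use s1 fr R in auto)
      then show "runs (\<lambda>_. 0) (Seq (count_prog ''genx'' ''gens'') (Put ''rk'' (var ''i'') (var ''t''))) s1
          (60 * (R + 1) + 5) ?Q'"
      proof (rule runs_Seq)
        fix s2 assume s2: "frame {''k'', ''t''} s1 s2 \<and>
          s2 ''t'' 0 = s1 ''t'' 0 + rank (s1 ''genx'') R (s1 ''i'' 0)"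
        have fr2: "b \<notin> {''k'', ''t''} \<Longrightarrow> s2 b = s1 b" for b using s2 frameD by blast
        have "frame {''t''} s' s1" "frame {''k'', ''t''} s1 s2" using s1 s2 by auto
        from frame_trans [OF this] have "frame {''i'', ''k'', ''t'', ''rk''} s' s2" by auto
        then have "frame {''i'', ''k'', ''t'', ''rk''} s s2"
          using I frame_trans unfolding I_def by blast
        then show "runs (\<lambda>_. 0) (Put ''rk'' (var ''i'') (var ''t'')) s2 5 ?Q'"
          using s1 s2 n fr2 fr I by (intro runs_exec) (auto simp: I_def less_Suc_eq)
      qed
    qed (rule runs_exec; simp)
  qed auto
  then show ?thesis by (rule runs_mono) (auto simp: power2_eq_square algebra_simps)
qed

text \<open>The inverse permutation is stored here, because the reduction has to find the column in
  position \<open>q\<close>. Positions start at 0 to match the loop counter.\<close>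

definition rank_cols_prog :: com where
  "rank_cols_prog = for_loop ''i'' (var ''cn'') (Seq (assign ''t'' (Const 0))
     (Seq (count_prog ''cx'' ''cn'') (Put ''ord'' (var ''t'') (var ''i''))))"

lemma runs_rank_cols:
  assumes C: "s ''cn'' 0 = C"
  shows "runs (\<lambda>_. 0) rank_cols_prog s (100 * (C + 1) ^ 2) (\<lambda>s'. frame {''i'', ''k'', ''t'', ''ord''} s s' \<and>
    (\<forall>j<C. s' ''ord'' (rank (s ''cx'') C j) = j))" (is "runs _ _ _ _ ?Q")
proof -
  define I where "I n s' \<longleftrightarrow> n \<le> C \<and> frame {''i'', ''k'', ''t'', ''ord''} s s' \<and>
    (\<forall>j<n. s' ''ord'' (rank (s ''cx'') C j) = j)" for n s'
  have "runs (\<lambda>_. 0) rank_cols_prog s ((C + 1) * ((3 + (60 * (C + 1) + 5)) + acost (var ''cn'') + 12)) ?Q"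
    unfolding rank_cols_prog_def
  proof (rule runs_for_loop [where I = I])
    show "I 0 (s(''i'' := (s ''i'')(0 := 0)))" by (simp add: I_def)
    show "aval (var ''cn'') s' = C" if "I i s'" for i s'
      using frameD [of "{''i'', ''k'', ''t'', ''ord''}" s s' "''cn''"] that C by (simp add: I_def)
    show "?Q s'" if "I C s'" for s' using that by (simp add: I_def)
    fix n s' assume n: "n < C" "s' ''i'' 0 = n" and I: "I n s'"
    have fr: "b \<notin> {''i'', ''k'', ''t'', ''ord''} \<Longrightarrow> s' b = s b" for b
      using frameD I unfolding I_def by blast
    let ?Q' = "\<lambda>s'. s' ''i'' 0 = n \<and> I (Suc n) (s'(''i'' := (s' ''i'')(0 := Suc n)))"
    show "runs (\<lambda>_. 0) (Seq (assign ''t'' (Const 0)) (Seq (count_prog ''cx'' ''cn'')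
        (Put ''ord'' (var ''t'') (var ''i'')))) s' (3 + (60 * (C + 1) + 5)) ?Q'"
    proof (rule runs_Seq [where R = "\<lambda>s1. s1 = s'(''t'' := (s' ''t'')(0 := 0))"])
      fix s1 assume s1: "s1 = s'(''t'' := (s' ''t'')(0 := 0))"
      have "runs (\<lambda>_. 0) (count_prog ''cx'' ''cn'') s1 (60 * (C + 1)) (\<lambda>s2. frame {''k'', ''t''} s1 s2 \<and>
          s2 ''t'' 0 = s1 ''t'' 0 + rank (s1 ''cx'') C (s1 ''i'' 0))"
        by (rule runs_count) (use s1 fr C in auto)
      then show "runs (\<lambda>_. 0) (Seq (count_prog ''cx'' ''cn'') (Put ''ord'' (var ''t'') (var ''i''))) s1
          (60 * (C + 1) + 5) ?Q'"
      proof (rule runs_Seq)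
        fix s2 assume s2: "frame {''k'', ''t''} s1 s2 \<and>
          s2 ''t'' 0 = s1 ''t'' 0 + rank (s1 ''cx'') C (s1 ''i'' 0)"
        have fr2: "b \<notin> {''k'', ''t''} \<Longrightarrow> s2 b = s1 b" for b using s2 frameD by blast
        have "frame {''t''} s' s1" "frame {''k'', ''t''} s1 s2" using s1 s2 by auto
        from frame_trans [OF this] have "frame {''i'', ''k'', ''t'', ''ord''} s' s2" by auto
        then have frame: "frame {''i'', ''k'', ''t'', ''ord''} s s2"
          using I frame_trans unfolding I_def by blast
        have t: "s2 ''t'' 0 = rank (s ''cx'') C n" "s2 ''i'' 0 = n" "s2 ''ord'' = s' ''ord''"
          using s1 s2 n fr2 fr by auto
        have "((s2 ''ord'')(rank (s ''cx'') C n := n)) (rank (s ''cx'') C j) = j" if "j < Suc n" for j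
          using that t I n inj_onD [OF rank_inj, of "s ''cx''" C n j]
          by (auto simp: I_def less_Suc_eq)
        then show "runs (\<lambda>_. 0) (Put ''ord'' (var ''t'') (var ''i'')) s2 5 ?Q'"
          using t n frame by (intro runs_exec) (auto simp: I_def)
      qed
    qed (rule runs_exec; simp)
  qed auto
  then show ?thesis by (rule runs_mono) (auto simp: power2_eq_square algebra_simps)
qed

text \<open>The machine cannot multiply, so the start \<open>j * R\<close> of each column block is
  tabulated by repeated addition.\<close>

definition offsets_prog :: com where
  "offsets_prog = Seq (assign ''o'' (Const 0)) (for_loop ''j'' (var ''cn'')
     (Seq (Put ''off'' (var ''j'') (var ''o'')) (assign ''o'' (Plus (var ''o'') (var ''gens'')))))"

lemma runs_offsets:
  assumes C: "s ''cn'' 0 = C" and R: "s ''gens'' 0 = R"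
  shows "runs (\<lambda>_. 0) offsets_prog s (60 * (C + 1)) (\<lambda>s'. frame {''j'', ''o'', ''off''} s s' \<and>
    (\<forall>j<C. s' ''off'' j = j * R))" (is "runs _ _ _ _ ?Q")
proof -
  define I where "I n s' \<longleftrightarrow> frame {''j'', ''o'', ''off''} s s' \<and> s' ''o'' 0 = n * R \<and>
    (\<forall>j<n. s' ''off'' j = j * R)" for n s'
  have "runs (\<lambda>_. 0) offsets_prog s (3 + (C + 1) * (20 + acost (var ''cn'') + 12)) ?Q"
    unfolding offsets_prog_def
  proof (rule runs_Seq [where R = "\<lambda>s1. s1 = s(''o'' := (s ''o'')(0 := 0))"])
    fix s1 assume s1: "s1 = s(''o'' := (s ''o'')(0 := 0))"
    show "runs (\<lambda>_. 0) (for_loop ''j'' (var ''cn'') (Seq (Put ''off'' (var ''j'') (var ''o''))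
        (assign ''o'' (Plus (var ''o'') (var ''gens''))))) s1 ((C + 1) * (20 + acost (var ''cn'') + 12)) ?Q"
    proof (rule runs_for_loop [where I = I])
      show "I 0 (s1(''j'' := (s1 ''j'')(0 := 0)))" using s1 by (simp add: I_def)
      show "aval (var ''cn'') s' = C" if "I i s'" for i s'
        using frameD [of "{''j'', ''o'', ''off''}" s s' "''cn''"] that C by (simp add: I_def)
      show "?Q s'" if "I C s'" for s' using that by (simp add: I_def)
      fix n s' assume n: "n < C" "s' ''j'' 0 = n" and I: "I n s'"
      have "s' ''gens'' 0 = R"
        using frameD [of "{''j'', ''o'', ''off''}" s s' "''gens''"] I R by (simp add: I_def)
      then show "runs (\<lambda>_. 0) (Seq (Put ''off'' (var ''j'') (var ''o'')) (assign ''o'' (Plus (var ''o'') (var ''gens''))))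
          s' 20 (\<lambda>s'. s' ''j'' 0 = n \<and> I (Suc n) (s'(''j'' := (s' ''j'')(0 := Suc n))))"
        using n I by (intro runs_exec) (auto simp: I_def less_Suc_eq)
    qed auto
  qed (rule runs_exec; simp)
  then show ?thesis by (rule runs_mono) auto
qed

definition copy_prog :: com where
  "copy_prog = Seq (assign ''e'' (Const 0)) (for_loop ''i'' (var ''gens'') (for_loop ''j'' (var ''rels'')
     (Seq (Put ''w'' (Plus (Get ''off'' (var ''j'')) (var ''i'')) (Get ''mat'' (var ''e'')))
       (assign ''e'' (Plus (var ''e'') (Const 1))))))"

lemma runs_copy:
  assumes R: "s ''gens'' 0 = R" and c: "s ''rels'' 0 = c" and off: "\<And>j. j < c \<Longrightarrow> s ''off'' j = j * R"
    and w: "\<And>a. s ''w'' a = 0" and bin: "\<And>a. s ''mat'' a \<le> 1"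
  shows "runs (\<lambda>_. 0) copy_prog s (100 * (R + 1) * (c + 1)) (\<lambda>s'. frame {''i'', ''j'', ''e'', ''w''} s s' \<and>
    (\<forall>a. s' ''w'' a \<le> 1) \<and>
    (\<forall>j i. i < R \<longrightarrow> s' ''w'' (j * R + i) = (if j < c then s ''mat'' (i * c + j) else 0)))"
    (is "runs _ _ _ _ ?Q")
proof -
  let ?X = "{''i'', ''j'', ''e'', ''w''}"
  let ?b = "Seq (Put ''w'' (Plus (Get ''off'' (var ''j'')) (var ''i'')) (Get ''mat'' (var ''e'')))
       (assign ''e'' (Plus (var ''e'') (Const 1)))"
  define J where "J i n s' \<longleftrightarrow> frame ?X s s' \<and> s' ''e'' 0 = i * c + n \<and> (\<forall>a. s' ''w'' a \<le> 1) \<and>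
    (\<forall>j' i'. i' < R \<longrightarrow> s' ''w'' (j' * R + i') =
      (if j' < c \<and> (i' < i \<or> i' = i \<and> j' < n) then s ''mat'' (i' * c + j') else 0))" for i n s'
  have inner: "runs (\<lambda>_. 0) (for_loop ''j'' (var ''rels'') ?b) s1 ((c + 1) * (30 + acost (var ''rels'') + 12))
      (\<lambda>s'. s' ''i'' 0 = i \<and> J (Suc i) 0 (s'(''i'' := (s' ''i'')(0 := Suc i))))"
    if s1: "i < R" "s1 ''i'' 0 = i" "J i 0 s1" for i s1
  proof (rule runs_for_loop [where I = "\<lambda>n s'. s' ''i'' 0 = i \<and> J i n s'"])
    show "(s1(''j'' := (s1 ''j'')(0 := 0))) ''i'' 0 = i \<and> J i 0 (s1(''j'' := (s1 ''j'')(0 := 0)))"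
      using s1 by (simp add: J_def)
    show "aval (var ''rels'') s' = c" if "s' ''i'' 0 = i \<and> J i n s'" for n s'
      using frameD [of ?X s s' "''rels''"] that c by (simp add: J_def)
    show "s' ''i'' 0 = i \<and> J (Suc i) 0 (s'(''i'' := (s' ''i'')(0 := Suc i)))"
      if "s' ''i'' 0 = i \<and> J i c s'" for s'
    proof -
      have "(j' < c \<and> (i' < i \<or> i' = i \<and> j' < c)) = (j' < c \<and> (i' < Suc i \<or> i' = Suc i \<and> j' < 0))" for i' j'
        by auto
      then show ?thesis using that by (simp add: J_def)
    qed
    fix n s' assume n: "n < c" "s' ''j'' 0 = n" and IJ: "s' ''i'' 0 = i \<and> J i n s'"
    have fr: "b \<notin> ?X \<Longrightarrow> s' b = s b" for b
      using frameD [of ?X s s' b] IJ unfolding J_def by blast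
    have ex: "exec ?b s' = s'(''w'' := (s' ''w'')(n * R + i := s ''mat'' (i * c + n)),
        ''e'' := (s' ''e'')(0 := Suc (i * c + n)))"
      using n IJ off [OF n(1)] by (simp add: fr J_def)
    have "((s' ''w'')(n * R + i := s ''mat'' (i * c + n))) (j' * R + i') =
      (if j' < c \<and> (i' < i \<or> i' = i \<and> j' < Suc n) then s ''mat'' (i' * c + j') else 0)" if "i' < R" for i' j'
      using that IJ n s1(1) block_index_eq_iff [OF that s1(1), of j' n]
      by (auto simp: J_def less_Suc_eq)
    then show "runs (\<lambda>_. 0) ?b s' 30 (\<lambda>s'. s' ''j'' 0 = n \<and>
        ((s'(''j'' := (s' ''j'')(0 := Suc n))) ''i'' 0 = i \<and> J i (Suc n) (s'(''j'' := (s' ''j'')(0 := Suc n)))))"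
      using n IJ ex bin by (intro runs_exec) (auto simp: J_def)
  qed auto
  have outer: "runs (\<lambda>_. 0) (for_loop ''i'' (var ''gens'') (for_loop ''j'' (var ''rels'') ?b)) s1
      ((R + 1) * (((c + 1) * (30 + acost (var ''rels'') + 12)) + acost (var ''gens'') + 12)) ?Q"
    if s1: "s1 = s(''e'' := (s ''e'')(0 := 0))" for s1
  proof (rule runs_for_loop [where I = "\<lambda>i s'. J i 0 s'"])
    show "J 0 0 (s1(''i'' := (s1 ''i'')(0 := 0)))" using s1 w by (simp add: J_def)
    show "aval (var ''gens'') s' = R" if "J i 0 s'" for i s'
      using frameD [of ?X s s' "''gens''"] that R by (simp add: J_def)
    show "?Q s'" if "J R 0 s'" for s' using that by (auto simp: J_def)
  qed (use inner in auto)
  have "runs (\<lambda>_. 0) copy_prog s (3 + (R + 1) * (((c + 1) * (30 + acost (var ''rels'') + 12))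
      + acost (var ''gens'') + 12)) ?Q"
    unfolding copy_prog_def
  proof (rule runs_Seq [where R = "\<lambda>s1. s1 = s(''e'' := (s ''e'')(0 := 0))"])
    show "runs (\<lambda>_. 0) (for_loop ''i'' (var ''gens'') (for_loop ''j'' (var ''rels'') ?b)) s1
      ((R + 1) * (((c + 1) * (30 + acost (var ''rels'') + 12)) + acost (var ''gens'') + 12)) ?Q"
      if "s1 = s(''e'' := (s ''e'')(0 := 0))" for s1
      using that by (rule outer)
  qed (rule runs_exec; simp)
  then show ?thesis by (rule runs_mono) (auto simp: algebra_simps)
qed

definition grades_prog :: com where
  "grades_prog = for_loop ''j'' (var ''rels'') (Seq (Put ''cx'' (var ''j'') (Get ''relx'' (var ''j'')))
     (Put ''cy'' (var ''j'') (Get ''rely'' (var ''j''))))"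

lemma runs_grades:
  assumes c: "s ''rels'' 0 = c"
  shows "runs (\<lambda>_. 0) grades_prog s (60 * (c + 1)) (\<lambda>s'. frame {''j'', ''cx'', ''cy''} s s' \<and>
    (\<forall>j<c. s' ''cx'' j = s ''relx'' j \<and> s' ''cy'' j = s ''rely'' j))" (is "runs _ _ _ _ ?Q")
proof -
  let ?X = "{''j'', ''cx'', ''cy''}"
  define I where "I n s' \<longleftrightarrow> frame ?X s s' \<and>
    (\<forall>j<n. s' ''cx'' j = s ''relx'' j \<and> s' ''cy'' j = s ''rely'' j)" for n s'
  have "runs (\<lambda>_. 0) grades_prog s ((c + 1) * (30 + acost (var ''rels'') + 12)) ?Q"
    unfolding grades_prog_def
  proof (rule runs_for_loop [where I = I])
    show "I 0 (s(''j'' := (s ''j'')(0 := 0)))" by (simp add: I_def)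
    show "aval (var ''rels'') s' = c" if "I i s'" for i s'
      using frameD [of ?X s s' "''rels''"] that c by (simp add: I_def)
    show "?Q s'" if "I c s'" for s' using that by (simp add: I_def)
    fix n s' assume n: "n < c" "s' ''j'' 0 = n" and I: "I n s'"
    have fr: "b \<notin> ?X \<Longrightarrow> s' b = s b" for b
      using frameD [of ?X s s' b] I unfolding I_def by blast
    show "runs (\<lambda>_. 0) (Seq (Put ''cx'' (var ''j'') (Get ''relx'' (var ''j'')))
        (Put ''cy'' (var ''j'') (Get ''rely'' (var ''j'')))) s' 30
        (\<lambda>s'. s' ''j'' 0 = n \<and> I (Suc n) (s'(''j'' := (s' ''j'')(0 := Suc n))))"
      using n I fr by (intro runs_exec) (auto simp: I_def less_Suc_eq)
  qed auto
  then show ?thesis by (rule runs_mono) auto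
qed

definition virtual_prog :: com where
  "virtual_prog = for_loop ''i'' (var ''gens'')
     (Seq (Put ''cx'' (Plus (var ''rels'') (var ''i'')) (Plus (var ''m'') (Const 1)))
     (Seq (Put ''cy'' (Plus (var ''rels'') (var ''i'')) (Get ''geny'' (var ''i'')))
       (Put ''w'' (Plus (Get ''off'' (Plus (var ''rels'') (var ''i''))) (var ''i'')) (Const 1))))"

lemma runs_virtual:
  assumes R: "s ''gens'' 0 = R" and c: "s ''rels'' 0 = c"
    and off: "\<And>j. j < c + R \<Longrightarrow> s ''off'' j = j * R" and bin: "\<And>a. s ''w'' a \<le> 1"
    and w: "\<And>j i. i < R \<Longrightarrow> c \<le> j \<Longrightarrow> s ''w'' (j * R + i) = 0"
  shows "runs (\<lambda>_. 0) virtual_prog s (80 * (R + 1)) (\<lambda>s'. frame {''i'', ''cx'', ''cy'', ''w''} s s' \<and>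
    (\<forall>j<c. s' ''cx'' j = s ''cx'' j \<and> s' ''cy'' j = s ''cy'' j) \<and>
    (\<forall>i<R. s' ''cx'' (c + i) = s ''m'' 0 + 1 \<and> s' ''cy'' (c + i) = s ''geny'' i) \<and> (\<forall>a. s' ''w'' a \<le> 1) \<and>
    (\<forall>j i. i < R \<longrightarrow> j < c + R \<longrightarrow> s' ''w'' (j * R + i) =
      (if j < c then s ''w'' (j * R + i) else if i = j - c then 1 else 0)))" (is "runs _ _ _ _ ?Q")
proof -
  let ?X = "{''i'', ''cx'', ''cy'', ''w''}"
  define I where "I n s' \<longleftrightarrow> frame ?X s s' \<and>
    (\<forall>j<c. s' ''cx'' j = s ''cx'' j \<and> s' ''cy'' j = s ''cy'' j) \<and>
    (\<forall>i<n. s' ''cx'' (c + i) = s ''m'' 0 + 1 \<and> s' ''cy'' (c + i) = s ''geny'' i) \<and> (\<forall>a. s' ''w'' a \<le> 1) \<and>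
    (\<forall>j i. i < R \<longrightarrow> s' ''w'' (j * R + i) =
      (if j < c then s ''w'' (j * R + i) else if i = j - c \<and> i < n then 1 else 0))" for n s'
  let ?b = "Seq (Put ''cx'' (Plus (var ''rels'') (var ''i'')) (Plus (var ''m'') (Const 1)))
     (Seq (Put ''cy'' (Plus (var ''rels'') (var ''i'')) (Get ''geny'' (var ''i'')))
       (Put ''w'' (Plus (Get ''off'' (Plus (var ''rels'') (var ''i''))) (var ''i'')) (Const 1)))"
  have "runs (\<lambda>_. 0) virtual_prog s ((R + 1) * (50 + acost (var ''gens'') + 12)) ?Q"
    unfolding virtual_prog_def
  proof (rule runs_for_loop [where I = I])
    show "I 0 (s(''i'' := (s ''i'')(0 := 0)))" using bin w by (auto simp: I_def)
    show "aval (var ''gens'') s' = R" if "I i s'" for i s'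
      using frameD [of ?X s s' "''gens''"] that R by (simp add: I_def)
    show "?Q s'" if "I R s'" for s' using that by (auto simp: I_def)
    fix n s' assume n: "n < R" "s' ''i'' 0 = n" and I: "I n s'"
    have fr: "b \<notin> ?X \<Longrightarrow> s' b = s b" for b
      using frameD [of ?X s s' b] I unfolding I_def by blast
    have ex: "exec ?b s' = s'(''cx'' := (s' ''cx'')(c + n := s ''m'' 0 + 1),
        ''cy'' := (s' ''cy'')(c + n := s ''geny'' n), ''w'' := (s' ''w'')((c + n) * R + n := 1))"
      using n off [of "c + n"] by (simp add: fr c)
    have "((s' ''w'')((c + n) * R + n := 1)) (j * R + i) =
        (if j < c then s ''w'' (j * R + i) else if i = j - c \<and> i < Suc n then 1 else 0)" if "i < R" for i j
    proof -
      have "s' ''w'' (j * R + i) = (if j < c then s ''w'' (j * R + i) else if i = j - c \<and> i < n then 1 else 0)"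
        using I that by (simp add: I_def)
      then show ?thesis using block_index_eq_iff [OF that n(1), of j "c + n"]
        by (cases "j = c + n \<and> i = n") (auto simp: less_Suc_eq)
    qed
    then show "runs (\<lambda>_. 0) ?b s' 50
        (\<lambda>s'. s' ''i'' 0 = n \<and> I (Suc n) (s'(''i'' := (s' ''i'')(0 := Suc n))))"
      using n I ex by (intro runs_exec) (auto simp: I_def less_Suc_eq)
  qed auto
  then show ?thesis by (rule runs_mono) auto
qed

definition init_prog :: com where
  "init_prog = Seq (assign ''cn'' (Plus (var ''rels'') (var ''gens''))) (Seq offsets_prog (Seq copy_prog
     (Seq grades_prog (Seq virtual_prog (Seq rank_rows_prog rank_cols_prog)))))"

lemma block_div: "j < (k :: nat) \<Longrightarrow> (i * k + j) div k = i"
  by auto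

lemma rank_cong:
  "(\<And>k. k < N \<Longrightarrow> f k = g k) \<Longrightarrow> i < N \<Longrightarrow> rank f N i = rank g N i"
  unfolding rank_def by (rule arg_cong [where f = card]) auto

text \<open>This is what the analysis of the program uses of a presentation, without reference to
  the presented module. The condition \<open>col_vec_grid\<close> is the homogeneity of the
  matrix.\<close>

locale machine_instance =
  fixes m n :: nat and P :: presentation
  assumes gens_grid: "set (gens P) \<subseteq> grid m n" and rels_grid: "set (rels P) \<subseteq> grid m n"
    and col_vec_grid: "j < length (rels P) \<Longrightarrow> col_vec P j i \<noteq> 0 \<Longrightarrow> gens P ! i \<le> rels P ! j"
begin

abbreviation "R \<equiv> length (gens P)"
abbreviation "C \<equiv> n_cols P"
abbreviation "c \<equiv> length (rels P)"

definition rk :: "nat \<Rightarrow> nat" where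
  "rk i = Suc (rank (gen_x P) R i)"

definition crk :: "nat \<Rightarrow> nat" where
  "crk = rank (col_x m P) C"

text \<open>The tables that stay fixed once the initialization is done.\<close>

definition const :: "store \<Rightarrow> bool" where
  "const s \<longleftrightarrow> s ''n'' 0 = n \<and> s ''gens'' 0 = R \<and> s ''cn'' 0 = C \<and>
     (\<forall>i<R. s ''genx'' i = gen_x P i \<and> s ''rk'' i = rk i) \<and>
     (\<forall>j<C. s ''off'' j = j * R \<and> s ''cx'' j = col_x m P j \<and> s ''cy'' j = col_y P j \<and>
        s ''ord'' (crk j) = j)"

abbreviation s0 :: store where
  "s0 \<equiv> input_store m n P"

lemma runs_init:
  "runs (\<lambda>_. 0) init_prog s0 (1000 * (R + C + 1) ^ 2) (\<lambda>s. const s \<and> (\<forall>a. s ''w'' a \<le> 1) \<and>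
     (\<forall>j<C. column R s j = col_vec P j) \<and>
     frame {''cn'', ''o'', ''off'', ''i'', ''j'', ''e'', ''w'', ''cx'', ''cy'', ''k'', ''t'', ''rk'', ''ord''} s0 s)"
  (is "runs _ _ _ _ ?Q")
proof -
  let ?X = "{''cn'', ''o'', ''off'', ''i'', ''j'', ''e'', ''w'', ''cx'', ''cy'', ''k'', ''t'', ''rk'', ''ord''}"
  have s0: "s0 ''gens'' 0 = R" "s0 ''rels'' 0 = c" "s0 ''m'' 0 = m" "s0 ''n'' 0 = n" "\<And>a. s0 ''w'' a = 0"
    "\<And>a. s0 ''mat'' a \<le> 1" "\<And>i. i < R \<Longrightarrow> s0 ''genx'' i = gen_x P i \<and> s0 ''geny'' i = gen_y P i"
    "\<And>j. j < c \<Longrightarrow> s0 ''relx'' j = fst (rels P ! j) \<and> s0 ''rely'' j = snd (rels P ! j)"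
    "\<And>i j. i < R \<Longrightarrow> j < c \<Longrightarrow> s0 ''mat'' (i * c + j) = (if col_vec P j i = 1 then 1 else 0)"
  proof -
    show "s0 ''mat'' (i * c + j) = (if col_vec P j i = 1 then 1 else 0)" if "i < R" "j < c" for i j
    proof -
      have "i * c + j < (i + 1) * c" using that by simp
      also have "\<dots> \<le> R * c" using that by (intro mult_right_mono) auto
      moreover have "(i * c + j) div c = i" using that(2) by (rule block_div)
      ultimately show ?thesis using that by (auto simp: input_store_def col_vec_def)
    qed
  qed (auto simp: input_store_def array_of_def gen_x_def gen_y_def)
  define s1 where "s1 = s0(''cn'' := (s0 ''cn'')(0 := C))"
  have C: "C = c + R" by (simp add: n_cols_def)
  have s1: "s1 ''cn'' 0 = C" "frame {''cn''} s0 s1" by (simp_all add: s1_def)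
  note f1 = frameD [OF s1(2)]
  let ?T = "(60 * (C + 1)) + ((100 * (R + 1) * (c + 1)) + ((60 * (c + 1)) + ((80 * (R + 1)) +
    ((100 * (R + 1) ^ 2) + (100 * (C + 1) ^ 2)))))"
  have "runs (\<lambda>_. 0) init_prog s0 (20 + ?T) ?Q"
    unfolding init_prog_def
  proof (rule runs_Seq [where R = "\<lambda>s. s = s1"])
    show "runs (\<lambda>_. 0) (assign ''cn'' (Plus (var ''rels'') (var ''gens''))) s0 20 (\<lambda>s. s = s1)"
      by (rule runs_exec) (auto simp: s1_def s0(1,2) C)
    have "runs (\<lambda>_. 0) offsets_prog s1 (60 * (C + 1)) (\<lambda>s2. frame {''j'', ''o'', ''off''} s1 s2 \<and>
        (\<forall>j<C. s2 ''off'' j = j * R))"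
      by (rule runs_offsets) (auto simp: s1 f1 s0)
    then show "runs (\<lambda>_. 0) (Seq offsets_prog (Seq copy_prog (Seq grades_prog (Seq virtual_prog
        (Seq rank_rows_prog rank_cols_prog))))) s ?T ?Q" if "s = s1" for s
      unfolding that
    proof (rule runs_Seq)
      fix s2 assume s2: "frame {''j'', ''o'', ''off''} s1 s2 \<and> (\<forall>j<C. s2 ''off'' j = j * R)"
      have F2: "frame {''cn'', ''j'', ''o'', ''off''} s0 s2"
        by (rule frame_trans [OF s1(2) conjunct1 [OF s2]]) auto
      note f2 = frameD [OF F2]
      have cn2: "s2 ''cn'' 0 = C" using s2 s1 frameD [of _ s1 s2 "''cn''"] by auto
      have "runs (\<lambda>_. 0) copy_prog s2 (100 * (R + 1) * (c + 1)) (\<lambda>s3. frame {''i'', ''j'', ''e'', ''w''} s2 s3 \<and>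
          (\<forall>a. s3 ''w'' a \<le> 1) \<and>
          (\<forall>j i. i < R \<longrightarrow> s3 ''w'' (j * R + i) = (if j < c then s2 ''mat'' (i * c + j) else 0)))"
        by (rule runs_copy) (use s2 s0(6) in \<open>auto simp: f2 s0 C\<close>)
      then show "runs (\<lambda>_. 0) (Seq copy_prog (Seq grades_prog (Seq virtual_prog
        (Seq rank_rows_prog rank_cols_prog)))) s2 ((100 * (R + 1) * (c + 1)) + ((60 * (c + 1)) + ((80 * (R + 1)) +
        ((100 * (R + 1) ^ 2) + (100 * (C + 1) ^ 2))))) ?Q"
      proof (rule runs_Seq)
        fix s3 assume s3: "frame {''i'', ''j'', ''e'', ''w''} s2 s3 \<and> (\<forall>a. s3 ''w'' a \<le> 1) \<and>
          (\<forall>j i. i < R \<longrightarrow> s3 ''w'' (j * R + i) = (if j < c then s2 ''mat'' (i * c + j) else 0))"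
        have F3: "frame {''cn'', ''j'', ''o'', ''off'', ''i'', ''e'', ''w''} s0 s3"
          by (rule frame_trans [OF F2 conjunct1 [OF s3]]) auto
        note f3 = frameD [OF F3]
        have g3: "s3 ''cn'' 0 = C" "\<forall>j<C. s3 ''off'' j = j * R"
          using s3 s2 cn2 frameD [of _ s2 s3 "''cn''"] frameD [of _ s2 s3 "''off''"] by auto
        have "runs (\<lambda>_. 0) grades_prog s3 (60 * (c + 1)) (\<lambda>s4. frame {''j'', ''cx'', ''cy''} s3 s4 \<and>
            (\<forall>j<c. s4 ''cx'' j = s3 ''relx'' j \<and> s4 ''cy'' j = s3 ''rely'' j))"
          by (rule runs_grades) (auto simp: f3 s0)
        then show "runs (\<lambda>_. 0) (Seq grades_prog (Seq virtual_prog
          (Seq rank_rows_prog rank_cols_prog))) s3 ((60 * (c + 1)) + ((80 * (R + 1)) +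
          ((100 * (R + 1) ^ 2) + (100 * (C + 1) ^ 2)))) ?Q"
        proof (rule runs_Seq)
          fix s4 assume s4: "frame {''j'', ''cx'', ''cy''} s3 s4 \<and>
            (\<forall>j<c. s4 ''cx'' j = s3 ''relx'' j \<and> s4 ''cy'' j = s3 ''rely'' j)"
          have F4: "frame {''cn'', ''j'', ''o'', ''off'', ''i'', ''e'', ''w'', ''cx'', ''cy''} s0 s4"
            by (rule frame_trans [OF F3 conjunct1 [OF s4]]) auto
          note f4 = frameD [OF F4]
          have w4: "s4 ''w'' = s3 ''w''" using s4 frameD [of _ s3 s4 "''w''"] by auto
          have g4: "s4 ''cn'' 0 = C" "\<forall>j<C. s4 ''off'' j = j * R"
            using s4 g3 frameD [of _ s3 s4 "''cn''"] frameD [of _ s3 s4 "''off''"] by auto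
          have "runs (\<lambda>_. 0) virtual_prog s4 (80 * (R + 1)) (\<lambda>s5. frame {''i'', ''cx'', ''cy'', ''w''} s4 s5 \<and>
            (\<forall>j<c. s5 ''cx'' j = s4 ''cx'' j \<and> s5 ''cy'' j = s4 ''cy'' j) \<and>
            (\<forall>i<R. s5 ''cx'' (c + i) = s4 ''m'' 0 + 1 \<and> s5 ''cy'' (c + i) = s4 ''geny'' i) \<and>
            (\<forall>a. s5 ''w'' a \<le> 1) \<and> (\<forall>j i. i < R \<longrightarrow> j < c + R \<longrightarrow> s5 ''w'' (j * R + i) =
              (if j < c then s4 ''w'' (j * R + i) else if i = j - c then 1 else 0)))"
            by (rule runs_virtual) (use s3 g4 in \<open>auto simp: f4 s0 w4 C\<close>)
          then show "runs (\<lambda>_. 0) (Seq virtual_prog (Seq rank_rows_prog rank_cols_prog)) s4 ((80 * (R + 1)) +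
            ((100 * (R + 1) ^ 2) + (100 * (C + 1) ^ 2))) ?Q"
          proof (rule runs_Seq)
            fix s5 assume s5: "frame {''i'', ''cx'', ''cy'', ''w''} s4 s5 \<and>
              (\<forall>j<c. s5 ''cx'' j = s4 ''cx'' j \<and> s5 ''cy'' j = s4 ''cy'' j) \<and>
              (\<forall>i<R. s5 ''cx'' (c + i) = s4 ''m'' 0 + 1 \<and> s5 ''cy'' (c + i) = s4 ''geny'' i) \<and>
              (\<forall>a. s5 ''w'' a \<le> 1) \<and> (\<forall>j i. i < R \<longrightarrow> j < c + R \<longrightarrow> s5 ''w'' (j * R + i) =
                (if j < c then s4 ''w'' (j * R + i) else if i = j - c then 1 else 0))"
            have F5: "frame {''cn'', ''j'', ''o'', ''off'', ''i'', ''e'', ''w'', ''cx'', ''cy''} s0 s5"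
              by (rule frame_trans [OF F4 conjunct1 [OF s5]]) auto
            note f5 = frameD [OF F5]
            have g5: "s5 ''cn'' 0 = C" "\<forall>j<C. s5 ''off'' j = j * R"
              using s5 g4 frameD [of _ s4 s5 "''cn''"] frameD [of _ s4 s5 "''off''"] by auto
            have grades5: "s5 ''cx'' j = col_x m P j \<and> s5 ''cy'' j = col_y P j" if "j < C" for j
            proof (cases "j < c")
              case True
              then show ?thesis using s5 s4 by (auto simp: f3 s0 col_x_def col_y_def)
            next
              case False
              then have j: "j = c + (j - c)" "j - c < R" using that C by auto
              have "s5 ''cx'' (c + (j - c)) = m + 1 \<and> s5 ''cy'' (c + (j - c)) = gen_y P (j - c)"
                using s5 j(2) by (auto simp: f4 s0)
              then show ?thesis using False j by (auto simp: col_x_def col_y_def gen_y_def)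
            qed
            have col5: "column R s5 j = col_vec P j" if "j < C" for j
            proof
              fix i
              have "s5 ''w'' (j * R + i) = (if col_vec P j i = 1 then 1 else 0)" if "i < R"
                using s5 s3 that \<open>j < C\<close> C by (auto simp: w4 f2 s0(9)) (auto simp: col_vec_def)
              moreover have "col_vec P j i = 0" if "\<not> i < R"
                using that \<open>j < C\<close> C by (auto simp: col_vec_def)
              ultimately show "column R s5 j i = col_vec P j i" by (cases "i < R") (auto simp: column_def)
            qed
            have "runs (\<lambda>_. 0) rank_rows_prog s5 (100 * (R + 1) ^ 2) (\<lambda>s6. frame {''i'', ''k'', ''t'', ''rk''} s5 s6 \<and>
              (\<forall>i<R. s6 ''rk'' i = Suc (rank (s5 ''genx'') R i)))"
              by (rule runs_rank_rows) (auto simp: f5 s0)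
            then show "runs (\<lambda>_. 0) (Seq rank_rows_prog rank_cols_prog) s5
              ((100 * (R + 1) ^ 2) + (100 * (C + 1) ^ 2)) ?Q"
            proof (rule runs_Seq)
              fix s6 assume s6: "frame {''i'', ''k'', ''t'', ''rk''} s5 s6 \<and>
                (\<forall>i<R. s6 ''rk'' i = Suc (rank (s5 ''genx'') R i))"
              note f6 = frameD [OF conjunct1 [OF s6]]
              have F6: "frame ?X s0 s6" by (rule frame_trans [OF F5 conjunct1 [OF s6]]) auto
              have "runs (\<lambda>_. 0) rank_cols_prog s6 (100 * (C + 1) ^ 2)
                (\<lambda>s7. frame {''i'', ''k'', ''t'', ''ord''} s6 s7 \<and>
                (\<forall>j<C. s7 ''ord'' (rank (s6 ''cx'') C j) = j))"
                by (rule runs_rank_cols) (auto simp: f6 g5)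
              then show "runs (\<lambda>_. 0) rank_cols_prog s6 (100 * (C + 1) ^ 2) ?Q"
              proof (rule runs_mono)
                fix s7 assume s7: "frame {''i'', ''k'', ''t'', ''ord''} s6 s7 \<and>
                  (\<forall>j<C. s7 ''ord'' (rank (s6 ''cx'') C j) = j)"
                note f7 = frameD [OF conjunct1 [OF s7]]
                have "frame ?X s0 s7" by (rule frame_trans [OF F6 conjunct1 [OF s7]]) auto
                moreover have w7: "s7 ''w'' = s5 ''w''" by (simp add: f7 f6)
                moreover have "column R s7 = column R s5" by (simp add: column_def [abs_def] w7)
                moreover have "rank (s5 ''genx'') R i = rank (gen_x P) R i" if "i < R" for i
                  using that by (intro rank_cong) (auto simp: f5 s0)
                moreover have "rank (s5 ''cx'') C j = crk j" if "j < C" for j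
                  unfolding crk_def using that grades5 by (intro rank_cong) auto
                ultimately show "?Q s7"
                  using s7 s6 s5 g5 grades5 col5 by (auto simp: const_def f7 f6 f5 s0 rk_def)
              qed simp
            qed
          qed
        qed
      qed
    qed
  qed
  moreover have "20 + ?T \<le> 1000 * (R + C + 1) ^ 2"
  proof -
    let ?L = "R + C + 1"
    have a: "x * y \<le> ?L ^ 2" if "x \<le> ?L" "y \<le> ?L" for x y
      using mult_mono [OF that] by (simp add: power2_eq_square)
    have "C + 1 \<le> ?L ^ 2" "c + 1 \<le> ?L ^ 2" "R + 1 \<le> ?L ^ 2" "1 \<le> ?L ^ 2"
      using a [of "C + 1" 1] a [of "c + 1" 1] a [of "R + 1" 1] a [of 1 1] C by auto
    moreover have "(R + 1) * (c + 1) \<le> ?L ^ 2" "(R + 1) ^ 2 \<le> ?L ^ 2" "(C + 1) ^ 2 \<le> ?L ^ 2"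
      using a [of "R + 1" "c + 1"] C by (auto intro: power_mono)
    \<comment> \<open>Each term is bounded by the square of \<open>?L\<close>, and the coefficients
      add up to 520.\<close>
    moreover have "20 + (60 * u + (100 * v + (60 * w + (80 * x + (100 * y + 100 * z))))) \<le> 1000 * l"
      if "1 \<le> l" "u \<le> l" "v \<le> l" "w \<le> l" "x \<le> l" "y \<le> l" "z \<le> l" for l u v w x y z :: nat
      using that by linarith
    ultimately show ?thesis unfolding mult.assoc [of 100] by blast
  qed
  ultimately show ?thesis by (rule runs_mono)
qed

end

section \<open>Processing one height\<close>

text \<open>
  Entry \<open>i\<close> of column \<open>j\<close> is \<open>w ! (off ! j + i)\<close>. For the column \<open>j\<close> being reduced, \<open>p\<close> and \<open>x\<close> are its
  pivot and birth. \<open>own ! p\<close> is one plus the column with pivot \<open>p\<close>, and \<open>al ! j\<close> one plus the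
  vertex of column \<open>j\<close> (at the current height if column \<open>j\<close> has been processed, at the previous one
  otherwise); \<open>0\<close> stands for none. \<open>o\<close> saves the old entry \<open>al ! j\<close>.
\<close>

definition emit_prog :: "aexp \<Rightarrow> aexp \<Rightarrow> com" where
  "emit_prog a b = Seq (Put ''source'' (var ''arcs'') a) (Seq (Put ''target'' (var ''arcs'') b)
     (assign ''arcs'' (Plus (var ''arcs'') (Const 1))))"

text \<open>The three conditions for an edge from \<open>j\<close> to \<open>k\<close>: both ends
  have a vertex, and the birth of the old bar is less than the death of the target. Column
  \<open>j\<close> has been overwritten by now, so the old birth is read from the output.\<close>

definition reduce_edge_prog :: com where
  "reduce_edge_prog = Cond (Conj (Less (Const 0) (var ''o'')) (Conj (Less (Const 0) (Get ''al'' (var ''k'')))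
       (Less (Get ''birth'' (Minus (var ''o'') (Const 1))) (Get ''cx'' (var ''k'')))))
     (emit_prog (Minus (var ''o'') (Const 1)) (Minus (Get ''al'' (var ''k'')) (Const 1))) Skip"

definition reduce_body :: com where
  "reduce_body = Seq (assign ''k'' (Minus (Get ''own'' (var ''p'')) (Const 1)))
     (Seq add_prog (Seq reduce_edge_prog pivot_prog))"

definition reduce_prog :: com where
  "reduce_prog = Seq (assign ''o'' (Get ''al'' (var ''j''))) (Seq pivot_prog
     (Loop (Conj (Less (Const 0) (var ''p'')) (Less (Const 0) (Get ''own'' (var ''p'')))) reduce_body))"

definition vertex_prog :: com where
  "vertex_prog = Seq (Put ''birth'' (var ''verts'') (var ''x'')) (Seq (Put ''death'' (var ''verts'') (Get ''cx'' (var ''j'')))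
     (Seq (Put ''height'' (var ''verts'') (var ''h'')) (Seq (assign ''verts'' (Plus (var ''verts'') (Const 1)))
       (Put ''al'' (var ''j'') (var ''verts'')))))"

text \<open>A nonzero column claims its pivot, and a nonempty bar becomes a vertex, joined to the
  vertex that the column had before, if any. For this edge the comparison of birth and death is
  implied, because the old bar of the same column was nonempty.\<close>

definition settle_prog :: com where
  "settle_prog = Seq (Put ''al'' (var ''j'') (Const 0)) (Cond (Less (Const 0) (var ''p''))
     (Seq (Put ''own'' (var ''p'') (Plus (var ''j'') (Const 1)))
       (Cond (Less (var ''x'') (Get ''cx'' (var ''j''))) (Seq vertex_prog
         (Cond (Less (Const 0) (var ''o'')) (emit_prog (Minus (var ''o'') (Const 1)) (Minus (var ''verts'') (Const 1))) Skip))
         Skip)) Skip)"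

definition process_prog :: com where
  "process_prog = Seq (assign ''j'' (Get ''ord'' (var ''q'')))
     (Cond (Less (var ''h'') (Get ''cy'' (var ''j''))) Skip (Seq reduce_prog settle_prog))"

abbreviation arc :: "store \<Rightarrow> nat \<Rightarrow> nat \<times> nat" where
  "arc s e \<equiv> (s ''source'' e, s ''target'' e)"

text \<open>\<open>vid\<close> takes abstract vertex names to the vertex numbers in the store. The
  arc list must be free of repetitions, so every emitted edge has to be shown to be new.\<close>

definition graph_rep :: "store \<Rightarrow> (nat \<times> nat) set \<Rightarrow> (nat \<times> nat \<Rightarrow> nat \<times> nat \<times> nat) \<Rightarrow>
    ((nat \<times> nat) \<times> (nat \<times> nat)) set \<Rightarrow> (nat \<times> nat \<Rightarrow> nat) \<Rightarrow> bool" where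
  "graph_rep s V lab E vid \<longleftrightarrow> bij_betw vid V {..<s ''verts'' 0} \<and>
     (\<forall>v\<in>V. lab v = (s ''birth'' (vid v), s ''death'' (vid v), s ''height'' (vid v))) \<and> E \<subseteq> V \<times> V \<and>
     inj_on (arc s) {..<s ''arcs'' 0} \<and> arc s ` {..<s ''arcs'' 0} = map_prod vid vid ` E"

lemma graph_rep_cong:
  assumes "\<And>a. a \<in> {''verts'', ''birth'', ''death'', ''height'', ''source'', ''target'', ''arcs''} \<Longrightarrow> s' a = s a"
    and "\<And>v. v \<in> V \<Longrightarrow> lab' v = lab v"
  shows "graph_rep s' V lab' E vid \<longleftrightarrow> graph_rep s V lab E vid"
  using assms by (simp add: graph_rep_def)

lemma graph_rep_emit:
  assumes g: "graph_rep s V lab E vid" and ab: "a \<in> V" "b \<in> V" "(a, b) \<notin> E"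
    and s': "s' ''source'' = (s ''source'')(s ''arcs'' 0 := vid a)"
      "s' ''target'' = (s ''target'')(s ''arcs'' 0 := vid b)" "s' ''arcs'' 0 = Suc (s ''arcs'' 0)"
      "s' ''verts'' = s ''verts''" "s' ''birth'' = s ''birth''" "s' ''death'' = s ''death''"
      "s' ''height'' = s ''height''"
  shows "graph_rep s' V lab (insert (a, b) E) vid"
proof -
  let ?N = "s ''arcs'' 0"
  have E: "E \<subseteq> V \<times> V" and vid: "inj_on vid V" and inj: "inj_on (arc s) {..<?N}"
    and im: "arc s ` {..<?N} = map_prod vid vid ` E"
    using g by (auto simp: graph_rep_def bij_betw_def)
  have new: "(vid a, vid b) \<notin> map_prod vid vid ` E"
  proof
    assume "(vid a, vid b) \<in> map_prod vid vid ` E"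
    then obtain a' b' where *: "(a', b') \<in> E" "vid a' = vid a" "vid b' = vid b" by auto
    then have "a' = a" "b' = b" using E ab(1,2) inj_onD [OF vid] by blast+
    with * ab(3) show False by simp
  qed
  have arcs: "{..<s' ''arcs'' 0} = insert ?N {..<?N}" using s' by (auto simp: less_Suc_eq)
  have old: "arc s' e = arc s e" if "e \<in> {..<?N}" for e using that s' by simp
  have "arc s' ` {..<?N} = arc s ` {..<?N}" using old by (intro image_cong) auto
  moreover have "arc s' ?N = (vid a, vid b)" using s' by simp
  ultimately have "arc s' ` {..<s' ''arcs'' 0} = map_prod vid vid ` insert (a, b) E"
    unfolding arcs by (simp add: im)
  moreover have "inj_on (arc s') {..<s' ''arcs'' 0}"
    unfolding arcs
  proof (subst inj_on_insert, intro conjI)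
    show "inj_on (arc s') {..<?N}" using inj old by (subst inj_on_cong [of _ _ "arc s"]) auto
    show "arc s' ?N \<notin> arc s' ` ({..<?N} - {?N})"
    proof -
      have "{..<?N} - {?N} = {..<?N}" by auto
      then show ?thesis
        unfolding \<open>arc s' ?N = (vid a, vid b)\<close> using new \<open>arc s' ` {..<?N} = arc s ` {..<?N}\<close> im by simp
    qed
  qed
  ultimately show ?thesis using g ab s' by (simp add: graph_rep_def)
qed

lemma graph_rep_vertex:
  assumes g: "graph_rep s V lab E vid" and v: "v \<notin> V"
    and s': "s' ''verts'' 0 = Suc (s ''verts'' 0)" "s' ''birth'' = (s ''birth'')(s ''verts'' 0 := b)"
      "s' ''death'' = (s ''death'')(s ''verts'' 0 := d)" "s' ''height'' = (s ''height'')(s ''verts'' 0 := h)"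
      "s' ''source'' = s ''source''" "s' ''target'' = s ''target''" "s' ''arcs'' = s ''arcs''"
    and lab': "lab' v = (b, d, h)" "\<And>w. w \<in> V \<Longrightarrow> lab' w = lab w"
  shows "graph_rep s' (insert v V) lab' E (vid(v := s ''verts'' 0))"
proof -
  let ?N = "s ''verts'' 0" and ?vid = "vid(v := s ''verts'' 0)"
  have bij: "bij_betw vid V {..<?N}" and E: "E \<subseteq> V \<times> V"
    and lab: "\<And>v. v \<in> V \<Longrightarrow> lab v = (s ''birth'' (vid v), s ''death'' (vid v), s ''height'' (vid v))"
    using g by (auto simp: graph_rep_def)
  have vid: "?vid w = vid w" "vid w < ?N" if "w \<in> V" for w
    using that v bij by (auto simp: bij_betw_def)
  have "bij_betw ?vid V {..<?N}" using bij vid(1) by (subst bij_betw_cong [of _ _ vid]) auto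
  then have "bij_betw ?vid (insert v V) (insert ?N {..<?N})"
    using v by (auto simp: bij_betw_def)
  moreover have "insert ?N {..<?N} = {..<s' ''verts'' 0}" using s' by (auto simp: less_Suc_eq)
  moreover have "map_prod ?vid ?vid ` E = map_prod vid vid ` E"
    using E vid(1) by (intro image_cong) auto
  moreover have "lab' w = (s' ''birth'' (?vid w), s' ''death'' (?vid w), s' ''height'' (?vid w))"
    if "w \<in> insert v V" for w
  proof (cases "w = v")
    case True
    then show ?thesis using lab' s' by simp
  next
    case False
    then have w: "w \<in> V" using that by simp
    show ?thesis using lab'(2) [OF w] lab [OF w] vid [OF w] s' by simp
  qed
  ultimately show ?thesis using g s' by (simp add: graph_rep_def subset_insertI2) blast
qed

context machine_instance
begin

sublocale row_ranking R rk
proof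
  show "inj_on rk {..<R}" using rank_inj [of "gen_x P" R] by (auto simp: inj_on_def rk_def)
qed (simp add: rk_def)

abbreviation bx :: "(nat \<Rightarrow> bit) \<Rightarrow> nat" where
  "bx \<equiv> max_on_support R (gen_x P)"

lemma piv_le: "piv v \<le> R"
  using rank_less by (auto simp: max_on_support_le_iff rk_def Suc_le_eq)

definition alive_at :: "nat \<Rightarrow> (nat \<Rightarrow> nat \<Rightarrow> bit) \<Rightarrow> nat \<Rightarrow> bool" where
  "alive_at h u j \<longleftrightarrow> j < C \<and> col_y P j \<le> h \<and> 0 < piv (u j) \<and> bx (u j) < col_x m P j"

text \<open>One reduction step costs at most \<open>200 * (R + 1)\<close>, and its loop test a
  constant, while the pivot of one column drops by at least 1. All columns are counted, active or
  not, so nothing is added when a column becomes active.\<close>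

definition potential :: "store \<Rightarrow> nat" where
  "potential s = 400 * (R + 1) * (\<Sum>j<C. piv (column R s j))"

lemma potential_cong: "s' ''w'' = s ''w'' \<Longrightarrow> potential s' = potential s"
  by (simp add: potential_def column_def [abs_def])

lemma crk_inj: "j < C \<Longrightarrow> j' < C \<Longrightarrow> crk j = crk j' \<longleftrightarrow> j = j'"
  using rank_inj [of "col_x m P" C] by (auto simp: crk_def inj_on_def)

end

text \<open>
  The step from height \<open>g\<close> with columns \<open>u\<close> to height \<open>Suc g\<close>. Vertices are named by pairs of a height
  and a column; \<open>hp\<close> is the last kept height up to \<open>g\<close>, and \<open>V0\<close>, \<open>E0\<close> is the graph built so far.
\<close>

locale height_step = machine_instance m n P for m n and P :: presentation +
  fixes g hp :: nat and u :: "nat \<Rightarrow> nat \<Rightarrow> bit" and V0 :: "(nat \<times> nat) set"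
    and lab0 :: "nat \<times> nat \<Rightarrow> nat \<times> nat \<times> nat" and E0 :: "((nat \<times> nat) \<times> (nat \<times> nat)) set"
  assumes V0_height: "(h, j) \<in> V0 \<Longrightarrow> h \<le> g" and E0: "E0 \<subseteq> V0 \<times> V0"
    and V0_old: "alive_at g u j \<Longrightarrow> (hp, j) \<in> V0 \<and> lab0 (hp, j) = (bx (u j), col_x m P j, hp)"
begin

abbreviation "H \<equiv> Suc g"

text \<open>
  Here \<open>q\<close> columns have been processed, \<open>u'\<close> holds the current columns and \<open>a'\<close> the additions made. In
  \<open>inner_inv\<close> column \<open>j\<close> is being reduced: \<open>v\<close> is its current value and \<open>B\<close> the set of columns already
  added to it, while \<open>u' j\<close> is still the old value.
\<close>

definition settled :: "nat \<Rightarrow> (nat \<Rightarrow> nat \<Rightarrow> bit) \<Rightarrow> nat set" where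
  "settled q u' = {j. j < C \<and> col_y P j \<le> H \<and> crk j < q \<and> 0 < piv (u' j)}"

definition verts_upto :: "nat \<Rightarrow> (nat \<Rightarrow> nat \<Rightarrow> bit) \<Rightarrow> (nat \<times> nat) set" where
  "verts_upto q u' = V0 \<union> {(H, j) | j. alive_at H u' j \<and> crk j < q}"

definition edges_of :: "(nat \<Rightarrow> nat \<Rightarrow> bit) \<Rightarrow> nat \<Rightarrow> nat set \<Rightarrow> ((nat \<times> nat) \<times> (nat \<times> nat)) set" where
  "edges_of u' j B = {((hp, j), (H, k)) | k. k \<in> B \<and> alive_at g u j \<and> alive_at H u' k \<and> bx (u j) < col_x m P k}"

definition edges_upto :: "nat \<Rightarrow> (nat \<Rightarrow> nat \<Rightarrow> bit) \<Rightarrow> (nat \<Rightarrow> nat set) \<Rightarrow> ((nat \<times> nat) \<times> (nat \<times> nat)) set" where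
  "edges_upto q u' a' = E0 \<union> (\<Union>j\<in>{j. j < C \<and> col_y P j \<le> H \<and> crk j < q}. edges_of u' j (insert j (a' j)))"

definition lab :: "(nat \<Rightarrow> nat \<Rightarrow> bit) \<Rightarrow> nat \<times> nat \<Rightarrow> nat \<times> nat \<times> nat" where
  "lab u' v = (if fst v = H then (bx (u' (snd v)), col_x m P (snd v), H) else lab0 v)"

definition reduced :: "(nat \<Rightarrow> nat \<Rightarrow> bit) \<Rightarrow> (nat \<Rightarrow> nat set) \<Rightarrow> nat \<Rightarrow> bool" where
  "reduced u' a' j \<longleftrightarrow> u j = (\<lambda>i. u' j i + (\<Sum>k\<in>a' j. u' k i)) \<and>
     a' j \<subseteq> {k. k < C \<and> col_y P k \<le> H \<and> crk k < crk j \<and> 0 < piv (u' k) \<and> piv (u' k) \<le> piv (u j)} \<and>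
     (a' j \<noteq> {} \<longrightarrow> (\<exists>k\<in>a' j. piv (u' k) = piv (u j)))"

definition owners :: "nat \<Rightarrow> (nat \<Rightarrow> nat \<Rightarrow> bit) \<Rightarrow> store \<Rightarrow> bool" where
  "owners q u' s \<longleftrightarrow> (\<forall>p. 0 < p \<and> p \<le> R \<longrightarrow>
     (s ''own'' p = 0 \<and> (\<forall>j\<in>settled q u'. piv (u' j) \<noteq> p)) \<or>
     (\<exists>j\<in>settled q u'. piv (u' j) = p \<and> s ''own'' p = Suc j))"

definition ids :: "nat \<Rightarrow> (nat \<Rightarrow> nat \<Rightarrow> bit) \<Rightarrow> (nat \<times> nat \<Rightarrow> nat) \<Rightarrow> store \<Rightarrow> bool" where
  "ids q u' vid s \<longleftrightarrow> (\<forall>j<C. s ''al'' j =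
     (if crk j < q \<and> col_y P j \<le> H then if alive_at H u' j then vid (H, j) + 1 else 0
      else if alive_at g u j then vid (hp, j) + 1 else 0))"

definition before :: "nat \<Rightarrow> (nat \<Rightarrow> nat \<Rightarrow> bit) \<Rightarrow> (nat \<Rightarrow> nat set) \<Rightarrow> bool" where
  "before q u' a' \<longleftrightarrow> (\<forall>j<C. if crk j < q \<and> col_y P j \<le> H then reduced u' a' j else u' j = u j \<and> a' j = {}) \<and>
     inj_on (\<lambda>j. piv (u' j)) (settled q u')"

text \<open>The last inequality counts edges: one that comes from an addition is paid by the drop of
  a pivot, one from a column to itself by the vertex created with it. Over the whole run there are
  at most \<open>C * R\<close> more edges than vertices.\<close>

definition outer_inv :: "nat \<Rightarrow> (nat \<Rightarrow> nat \<Rightarrow> bit) \<Rightarrow> (nat \<Rightarrow> nat set) \<Rightarrow> (nat \<times> nat \<Rightarrow> nat) \<Rightarrow> store \<Rightarrow> bool" where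
  "outer_inv q u' a' vid s \<longleftrightarrow> const s \<and> (\<forall>a. s ''w'' a \<le> 1) \<and> s ''h'' 0 = H \<and> (\<forall>j<C. column R s j = u' j) \<and>
     before q u' a' \<and> owners q u' s \<and> ids q u' vid s \<and>
     graph_rep s (verts_upto q u') (lab u') (edges_upto q u' a') vid \<and>
     s ''arcs'' 0 + (\<Sum>j<C. piv (u' j)) \<le> s ''verts'' 0 + C * R"

text \<open>All members of \<open>B\<close> have pivots above the present one, and the next column
  to be added has exactly the present one. So it is not in \<open>B\<close>, no edge is emitted
  twice, and a set can record the sequence of additions. The member with pivot
  \<open>piv (u j)\<close>, the first one added, becomes the witness in
  \<open>A_witness\<close>.\<close>

definition inner_inv :: "nat \<Rightarrow> (nat \<Rightarrow> nat \<Rightarrow> bit) \<Rightarrow> (nat \<Rightarrow> nat set) \<Rightarrow> (nat \<times> nat \<Rightarrow> nat) \<Rightarrow> nat \<Rightarrow>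
    (nat \<Rightarrow> bit) \<Rightarrow> nat set \<Rightarrow> store \<Rightarrow> bool" where
  "inner_inv q u' a' vid j v B s \<longleftrightarrow> const s \<and> (\<forall>a. s ''w'' a \<le> 1) \<and> s ''h'' 0 = H \<and>
     s ''q'' 0 = q \<and> s ''j'' 0 = j \<and> s ''o'' 0 = (if alive_at g u j then vid (hp, j) + 1 else 0) \<and>
     s ''p'' 0 = piv v \<and> s ''x'' 0 = bx v \<and>
     (\<forall>k<C. column R s k = (if k = j then v else u' k)) \<and> owners q u' s \<and> ids q u' vid s \<and>
     u j = (\<lambda>i. v i + (\<Sum>k\<in>B. u' k i)) \<and> B \<subseteq> settled q u' \<and>
     (\<forall>k\<in>B. piv v < piv (u' k) \<and> piv (u' k) \<le> piv (u j)) \<and>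
     (if B = {} then v = u j else \<exists>k\<in>B. piv (u' k) = piv (u j)) \<and>
     graph_rep s (verts_upto q u') (lab u') (edges_upto q u' a' \<union> edges_of u' j B) vid \<and>
     s ''arcs'' 0 + (\<Sum>k<C. piv (if k = j then v else u' k)) \<le> s ''verts'' 0 + C * R"

lemma sum_piv_upd:
  assumes "j < C"
  shows "(\<Sum>k<C. piv (if k = j then v else u' k)) = piv v + (\<Sum>k\<in>{..<C} - {j}. piv (u' k))"
proof -
  have "(\<Sum>k<C. piv (if k = j then v else u' k))
      = piv v + (\<Sum>k\<in>{..<C} - {j}. piv (if k = j then v else u' k))"
    using assms by (subst sum.remove [of _ j]) auto
  also have "(\<Sum>k\<in>{..<C} - {j}. piv (if k = j then v else u' k)) = (\<Sum>k\<in>{..<C} - {j}. piv (u' k))"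
    by (rule sum.cong) auto
  finally show ?thesis .
qed

text \<open>The owner \<open>k\<close> of the present pivot is settled. Adding it lowers the pivot,
  and the decomposition of the old column persists because \<open>k\<close> enters \<open>B\<close>
  at the same time and 1 + 1 vanishes.\<close>

lemma reduce_step:
  assumes j: "j < C" "crk j = q" "col_y P j \<le> H" and bf: "before q u' a'"
    and I: "inner_inv q u' a' vid j v B s"
    and p: "0 < s ''p'' 0" "0 < s ''own'' (s ''p'' 0)"
  shows "\<exists>t s'. run reduce_body s t s' \<and> t \<le> 200 * (R + 1) \<and>
    (\<exists>v' B'. inner_inv q u' a' vid j v' B' s' \<and> piv v' < piv v)"
proof -
  note I' = I [unfolded inner_inv_def]
  have pv: "s ''p'' 0 = piv v" using I' by blast
  have "owners q u' s" using I' by blast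
  then have "(s ''own'' (piv v) = 0 \<and> (\<forall>j\<in>settled q u'. piv (u' j) \<noteq> piv v)) \<or>
     (\<exists>j\<in>settled q u'. piv (u' j) = piv v \<and> s ''own'' (piv v) = Suc j)"
    using p(1) piv_le [of v] unfolding owners_def pv by simp
  then obtain k where k: "k \<in> settled q u'" "piv (u' k) = piv v" "s ''own'' (piv v) = Suc k"
    using p(2) unfolding pv by auto
  have kC: "k < C" "crk k < q" "col_y P k \<le> H" using k by (auto simp: settled_def)
  have kj: "k \<noteq> j" using kC j by auto
  have kB: "k \<notin> B" using I' k(2) by auto
  have finB: "finite B" by (rule finite_subset [of _ "{..<C}"]) (use I' in \<open>auto simp: settled_def\<close>)
  define v' where "v' = (\<lambda>i. v i + u' k i)"
  have less: "piv v' < piv v" unfolding v'_def using piv_add_less [of v "u' k"] k p pv by simp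
  have cs: "s ''gens'' 0 = R" "\<And>j. j < C \<Longrightarrow> s ''off'' j = j * R" "\<And>i. i < R \<Longrightarrow> s ''genx'' i = gen_x P i"
    "\<And>i. i < R \<Longrightarrow> s ''rk'' i = rk i" "\<And>j. j < C \<Longrightarrow> s ''cx'' j = col_x m P j"
    using I' by (auto simp: const_def)
  define s1 where "s1 = s(''k'' := (s ''k'')(0 := k))"
  let ?e = "alive_at g u j \<and> alive_at H u' k \<and> bx (u j) < col_x m P k"
  have sj: "s ''j'' 0 = j" using I' by blast
  have "runs (\<lambda>_. 0) reduce_body s (20 + (60 * (R + 1) + (60 + 60 * (R + 1))))
    (\<lambda>s'. inner_inv q u' a' vid j v' (insert k B) s')" (is "runs _ _ _ _ ?Q")
    unfolding reduce_body_def
  proof (rule runs_Seq [where R = "\<lambda>s'. s' = s1"])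
    show "runs (\<lambda>_. 0) (assign ''k'' (Minus (Get ''own'' (var ''p'')) (Const 1))) s 20 (\<lambda>s'. s' = s1)"
      by (rule runs_exec) (auto simp: s1_def k pv)
    have "runs (\<lambda>_. 0) add_prog s1 (60 * (R + 1)) (\<lambda>s2. frame {''i'', ''w''} s1 s2 \<and>
        (\<forall>a. s2 ''w'' a \<le> 1) \<and> column R s2 j = (\<lambda>i. column R s1 j i + column R s1 k i) \<and>
        (\<forall>j'. j' \<noteq> j \<longrightarrow> column R s2 j' = column R s1 j'))"
      by (rule runs_add) (use cs sj kj j kC I' in \<open>auto simp: s1_def\<close>)
    then show "runs (\<lambda>_. 0) (Seq add_prog (Seq reduce_edge_prog pivot_prog)) s'
        (60 * (R + 1) + (60 + 60 * (R + 1))) ?Q" if "s' = s1" for s'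
      unfolding that
    proof (rule runs_Seq)
      fix s2 assume s2: "frame {''i'', ''w''} s1 s2 \<and>
        (\<forall>a. s2 ''w'' a \<le> 1) \<and> column R s2 j = (\<lambda>i. column R s1 j i + column R s1 k i) \<and>
        (\<forall>j'. j' \<noteq> j \<longrightarrow> column R s2 j' = column R s1 j')"
      have F2: "frame {''i'', ''w'', ''k''} s s2"
        by (rule frame_trans [of "{''k''}" s s1 "{''i'', ''w''}"]) (use s2 in \<open>auto simp: s1_def\<close>)
      note f2 = frameD [OF F2]
      have k2: "s2 ''k'' 0 = k" using s2 frameD [of _ s1 s2 "''k''"] by (auto simp: s1_def)
      have col_s1: "column R s1 = column R s" by (simp add: column_def [abs_def] s1_def)
      have col2: "column R s2 k' = (if k' = j then v' else u' k')" if "k' < C" for k'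
        using s2 I' that kj kC j by (auto simp: col_s1 v'_def)
      have al: "s ''al'' k = (if alive_at H u' k then vid (H, k) + 1 else 0)"
        using I' kC by (auto simp: ids_def)
      have o: "s ''o'' 0 = (if alive_at g u j then vid (hp, j) + 1 else 0)" using I' by blast
      have gr: "graph_rep s (verts_upto q u') (lab u') (edges_upto q u' a' \<union> edges_of u' j B) vid"
        using I' by blast
      \<comment> \<open>The old label was recorded when the vertex was created, at the height
        \<open>hp\<close>, which differs from \<open>H\<close>.\<close>
      have birth: "s ''birth'' (vid (hp, j)) = bx (u j)" if "alive_at g u j"
      proof -
        have "(hp, j) \<in> verts_upto q u'" "lab0 (hp, j) = (bx (u j), col_x m P j, hp)" "hp \<noteq> H"
          using V0_old [OF that] V0_height [of hp j] by (auto simp: verts_upto_def)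
        with gr have "lab u' (hp, j) = (s ''birth'' (vid (hp, j)), s ''death'' (vid (hp, j)), s ''height'' (vid (hp, j)))"
          unfolding graph_rep_def by blast
        with \<open>lab0 (hp, j) = _\<close> \<open>hp \<noteq> H\<close> show ?thesis by (simp add: lab_def)
      qed
      define s3 where "s3 = exec reduce_edge_prog s2"
      have cond: "bval (Conj (Less (Const 0) (var ''o'')) (Conj (Less (Const 0) (Get ''al'' (var ''k'')))
       (Less (Get ''birth'' (Minus (var ''o'') (Const 1))) (Get ''cx'' (var ''k''))))) s2 \<longleftrightarrow> ?e"
        using birth kC by (auto simp: f2 k2 al o cs)
      have s3: "s3 = (if ?e then s2(''source'' := (s ''source'')(s ''arcs'' 0 := vid (hp, j)),
          ''target'' := (s ''target'')(s ''arcs'' 0 := vid (H, k)),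
          ''arcs'' := (s ''arcs'')(0 := Suc (s ''arcs'' 0))) else s2)"
        unfolding s3_def reduce_edge_prog_def exec.simps cond by (auto simp: emit_prog_def f2 k2 al o)
      have "runs (\<lambda>_. 0) reduce_edge_prog s2 60 (\<lambda>s'. s' = s3)"
        by (rule runs_exec) (auto simp: reduce_edge_prog_def emit_prog_def s3_def)
      then show "runs (\<lambda>_. 0) (Seq reduce_edge_prog pivot_prog) s2 (60 + 60 * (R + 1)) ?Q"
      proof (rule runs_Seq)
        have F3: "frame {''i'', ''w'', ''k'', ''source'', ''target'', ''arcs''} s s3"
          unfolding s3 using frame_trans [OF F2 frame_refl [of "{}"], of "{''i'', ''w'', ''k'', ''source'', ''target'', ''arcs''}"]
          by auto
        note f3 = frameD [OF F3]
        have w3: "s3 ''w'' = s2 ''w''" by (simp add: s3)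
        have col3: "column R s3 = column R s2" by (simp add: column_def [abs_def] w3)
        have "runs (\<lambda>_. 0) pivot_prog s3 (60 * (R + 1)) (\<lambda>s'. frame {''i'', ''p'', ''x''} s3 s' \<and>
          s' ''p'' 0 = max_on_support R rk (column R s3 (s3 ''j'' 0)) \<and>
          s' ''x'' 0 = max_on_support R (gen_x P) (column R s3 (s3 ''j'' 0)))"
          by (rule runs_pivot) (auto simp: f3 cs sj j)
        then show "runs (\<lambda>_. 0) pivot_prog s' (60 * (R + 1)) ?Q" if "s' = s3" for s'
          unfolding that
        proof (rule runs_mono)
          fix s4 assume s4: "frame {''i'', ''p'', ''x''} s3 s4 \<and>
            s4 ''p'' 0 = max_on_support R rk (column R s3 (s3 ''j'' 0)) \<and>
            s4 ''x'' 0 = max_on_support R (gen_x P) (column R s3 (s3 ''j'' 0))"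
          note f4 = frameD [OF conjunct1 [OF s4]]
          have s4': "s4 ''p'' 0 = piv v'" "s4 ''x'' 0 = bx v'" using s4 j by (auto simp: f3 sj col3 col2)
          have w4: "s4 ''w'' = s2 ''w''" by (simp add: f4 w3)
          have col4: "column R s4 = column R s2" by (simp add: column_def [abs_def] w4)
          have lt: "u' k i + (v' i + (\<Sum>k\<in>B. u' k i)) = v i + (\<Sum>k\<in>B. u' k i)" for i
            by (simp add: v'_def ac_simps)
          have "graph_rep s3 (verts_upto q u') (lab u') (edges_upto q u' a' \<union> edges_of u' j (insert k B)) vid"
          proof (cases ?e)
            case True
            have "((hp, j), (H, k)) \<notin> edges_upto q u' a' \<union> edges_of u' j B"
              using E0 V0_height [of H k] kB j by (auto simp: edges_upto_def edges_of_def)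
            moreover have "(hp, j) \<in> verts_upto q u'" "(H, k) \<in> verts_upto q u'"
              using V0_old True kC by (auto simp: verts_upto_def)
            ultimately have "graph_rep s3 (verts_upto q u') (lab u')
                (insert ((hp, j), (H, k)) (edges_upto q u' a' \<union> edges_of u' j B)) vid"
              using True by (intro graph_rep_emit [OF gr]) (auto simp: s3 f2)
            moreover have "edges_of u' j (insert k B) = insert ((hp, j), (H, k)) (edges_of u' j B)"
              using True by (auto simp: edges_of_def)
            ultimately show ?thesis by simp
          next
            case False
            then have "edges_of u' j (insert k B) = edges_of u' j B" by (auto simp: edges_of_def)
            moreover have "s3 = s2" unfolding s3 using False by (rule if_not_P)
            moreover have "graph_rep s2 (verts_upto q u') (lab u') (edges_upto q u' a' \<union> edges_of u' j B) vid"
              using gr by (subst graph_rep_cong [of s2 s _ "lab u'" "lab u'"]) (auto simp: f2)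
            ultimately show ?thesis by simp
          qed
          moreover have "graph_rep s4 (verts_upto q u') (lab u') (edges_upto q u' a' \<union> edges_of u' j (insert k B)) vid
              \<longleftrightarrow> graph_rep s3 (verts_upto q u') (lab u') (edges_upto q u' a' \<union> edges_of u' j (insert k B)) vid"
            by (rule graph_rep_cong) (auto simp: f4)
          ultimately have gr4: "graph_rep s4 (verts_upto q u') (lab u')
              (edges_upto q u' a' \<union> edges_of u' j (insert k B)) vid" by simp
          have arcs4: "s4 ''arcs'' 0 \<le> Suc (s ''arcs'' 0)" by (simp add: f4 s3 f2)
          have count: "s4 ''arcs'' 0 + (\<Sum>k<C. piv (if k = j then v' else u' k)) \<le> s4 ''verts'' 0 + C * R"
            using I' arcs4 less unfolding sum_piv_upd [OF j(1)] by (simp add: f4 f3)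
          have uj: "u j = (\<lambda>i. v' i + (\<Sum>k\<in>insert k B. u' k i))"
            using I' finB kB by (auto simp: v'_def ac_simps)
          have B0: "B \<subseteq> settled q u'" "\<And>k. k \<in> B \<Longrightarrow> piv v < piv (u' k) \<and> piv (u' k) \<le> piv (u j)"
            "if B = {} then v = u j else \<exists>k\<in>B. piv (u' k) = piv (u j)"
            using I' by blast+
          have B: "insert k B \<subseteq> settled q u'" using B0(1) k(1) by simp
          have Bk: "piv v' < piv (u' k') \<and> piv (u' k') \<le> piv (u j)" if "k' \<in> insert k B" for k'
          proof (cases "k' \<in> B")
            case True
            then show ?thesis using B0(2) [of k'] less by simp
          next
            case False
            then have "k' = k" using that by simp
            moreover have "piv v \<le> piv (u j)" using B0(2,3) by (cases "B = {}") fastforce+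
            ultimately show ?thesis using k(2) less by simp
          qed
          have Bw: "\<exists>k'\<in>insert k B. piv (u' k') = piv (u j)"
            using B0(3) k(2) by (cases "B = {}") auto
          show "?Q s4"
            unfolding inner_inv_def
            using I' s2 s4' col2 uj B Bk Bw gr4 count
            by (simp add: const_def owners_def ids_def f4 f3 w4 col4)
        qed simp
      qed
    qed
  qed
  then obtain t s' where "run reduce_body s t s'" "t \<le> 20 + (60 * (R + 1) + (60 + 60 * (R + 1)))" "?Q s'"
    by (auto simp: runs_def)
  with less show ?thesis by (intro exI [of _ t] exI [of _ s']) auto
qed

end

context height_step
begin

lemma potential_inner:
  assumes "inner_inv q u' a' vid j v B s"
  shows "potential s = 400 * (R + 1) * (\<Sum>k<C. piv (if k = j then v else u' k))"
proof -
  have "(\<Sum>k<C. piv (column R s k)) = (\<Sum>k<C. piv (if k = j then v else u' k))"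
    using assms unfolding inner_inv_def by (intro sum.cong) auto
  then show ?thesis by (simp add: potential_def)
qed

text \<open>The steps are paid entirely by the falling pivots, so the loop has constant amortized
  time; 20 covers the last test.\<close>

lemma runs_reduce_loop:
  assumes j: "j < C" "crk j = q" "col_y P j \<le> H" and bf: "before q u' a'"
    and I: "inner_inv q u' a' vid j v B s"
  shows "runs potential (Loop (Conj (Less (Const 0) (var ''p'')) (Less (Const 0) (Get ''own'' (var ''p'')))) reduce_body)
    s 20 (\<lambda>s'. (\<exists>v B. inner_inv q u' a' vid j v B s') \<and> \<not> (0 < s' ''p'' 0 \<and> 0 < s' ''own'' (s' ''p'' 0)))"
proof -
  let ?b = "Conj (Less (Const 0) (var ''p'')) (Less (Const 0) (Get ''own'' (var ''p'')))"
  have "runs potential (Loop ?b reduce_body) s (1 + bcost ?b)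
      (\<lambda>s'. (\<exists>v B. inner_inv q u' a' vid j v B s') \<and> \<not> bval ?b s')"
  proof (rule runs_Loop_potential)
    show "\<exists>v B. inner_inv q u' a' vid j v B s" using I by blast
    fix s assume "\<exists>v B. inner_inv q u' a' vid j v B s" and b: "bval ?b s"
    then obtain v B where I: "inner_inv q u' a' vid j v B s" by blast
    have p: "0 < s ''p'' 0" "0 < s ''own'' (s ''p'' 0)" using b by auto
    from reduce_step [OF j bf I p] obtain t s' v' B' where
      1: "run reduce_body s t s'" "t \<le> 200 * (R + 1)" "inner_inv q u' a' vid j v' B' s'" "piv v' < piv v"
      by auto
    have "Suc (\<Sum>k<C. piv (if k = j then v' else u' k)) \<le> (\<Sum>k<C. piv (if k = j then v else u' k))"
      using 1(4) unfolding sum_piv_upd [OF j(1)] by simp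
    then have "400 * (R + 1) * Suc (\<Sum>k<C. piv (if k = j then v' else u' k)) \<le> potential s"
      unfolding potential_inner [OF I] by (rule mult_left_mono) simp
    then have "400 * (R + 1) + potential s' \<le> potential s"
      unfolding potential_inner [OF 1(3)] by (simp only: mult_Suc_right)
    with 1 have "1 + bcost ?b + t + potential s' \<le> potential s" by simp
    with 1 show "\<exists>t s'. run reduce_body s t s' \<and> 1 + bcost ?b + t + potential s' \<le> potential s \<and>
        (\<exists>v B. inner_inv q u' a' vid j v B s')" by blast
  qed
  then show ?thesis by (rule runs_mono) auto
qed

lemma less_Suc_crk: "j < C \<Longrightarrow> crk j = q \<Longrightarrow> k < C \<Longrightarrow> crk k < Suc q \<longleftrightarrow> crk k < q \<or> k = j"
  using crk_inj [of k j] by (auto simp: less_Suc_eq)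

text \<open>The loop stops with a zero column or with a pivot that has no owner, so the pivots of
  settled columns stay distinct. Storing \<open>v\<close> for column \<open>j\<close> does not
  disturb the columns settled earlier, since their additions came from further left than
  themselves.\<close>

lemma settle_step:
  assumes j: "j < C" "crk j = q" "col_y P j \<le> H" and bf: "before q u' a'"
    and I: "inner_inv q u' a' vid j v B s"
    and p: "\<not> (0 < s ''p'' 0 \<and> 0 < s ''own'' (s ''p'' 0))"
  shows "\<exists>vid'. outer_inv (Suc q) (u'(j := v)) (a'(j := B)) vid' (exec settle_prog s)"
proof -
  note I' = I [unfolded inner_inv_def]
  define u2 where "u2 = u'(j := v)"
  define a2 where "a2 = a'(j := B)"
  have pv: "s ''p'' 0 = piv v" "s ''x'' 0 = bx v" "s ''j'' 0 = j" "s ''h'' 0 = H" using I' by blast+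
  have o: "s ''o'' 0 = (if alive_at g u j then vid (hp, j) + 1 else 0)" using I' by blast
  have cx: "s ''cx'' j = col_x m P j" using I' j by (simp add: const_def)
  have sub: "B \<subseteq> settled q u'" using I' by blast
  have jB: "j \<notin> B" using sub j by (auto simp: settled_def)
  have bfD: "reduced u' a' k" if "k < C" "crk k < q" "col_y P k \<le> H" for k
    using bf that unfolding before_def by auto
  have bfN: "u' k = u k \<and> a' k = {}" if "k < C" "\<not> (crk k < q \<and> col_y P k \<le> H)" for k
    using bf that unfolding before_def by metis
  note crk_Suc = less_Suc_crk [OF j(1,2)]
  have al_ne: "alive_at H u2 k \<longleftrightarrow> alive_at H u' k" if "k \<noteq> j" for k
    using that by (simp add: alive_at_def u2_def)
  have al_j: "alive_at H u2 j \<longleftrightarrow> 0 < piv v \<and> bx v < col_x m P j"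
    using j by (simp add: alive_at_def u2_def)
  have settled2: "settled (Suc q) u2 = settled q u' \<union> (if 0 < piv v then {j} else {})"
    using j crk_Suc by (auto simp: settled_def u2_def)
  have jset: "j \<notin> settled q u'" using j by (simp add: settled_def)
  have free: "piv (u' k) \<noteq> piv v" if "0 < piv v" "k \<in> settled q u'" for k
  proof -
    have "s ''own'' (piv v) = 0" using p that by (simp add: pv)
    moreover have "owners q u' s" using I' by blast
    ultimately show ?thesis using that piv_le [of v] unfolding owners_def by auto
  qed
  have inj2: "inj_on (\<lambda>k. piv (u2 k)) (settled (Suc q) u2)"
  proof -
    have "inj_on (\<lambda>k. piv (u' k)) (settled q u')" using bf by (simp add: before_def)
    then have "inj_on (\<lambda>k. piv (u2 k)) (settled q u')"
      using jset by (subst inj_on_cong [of _ _ "\<lambda>k. piv (u' k)"]) (auto simp: u2_def)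
    moreover have "piv (u2 j) \<notin> (\<lambda>k. piv (u2 k)) ` settled q u'" if "0 < piv v"
    proof
      assume "piv (u2 j) \<in> (\<lambda>k. piv (u2 k)) ` settled q u'"
      then obtain k where "k \<in> settled q u'" "piv (u2 j) = piv (u2 k)" by blast
      moreover then have "k \<noteq> j" using jset by blast
      ultimately show False using free [OF that, of k] by (simp add: u2_def)
    qed
    ultimately show ?thesis unfolding settled2 using jset by auto
  qed
  have red_cong: "reduced u2 a2 k" if "k < C" "crk k < q" "col_y P k \<le> H" for k
  proof -
    have r: "reduced u' a' k" using bfD that by blast
    have kj: "k \<noteq> j" using that j by auto
    have ja: "j \<notin> a' k" using r that j by (auto simp: reduced_def)
    have a2k: "a2 k = a' k" using kj by (simp add: a2_def)
    have u2k: "u2 k' = u' k'" if "k' \<in> insert k (a' k)" for k' using that kj ja by (auto simp: u2_def)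
    have "(\<lambda>i. u2 k i + (\<Sum>k'\<in>a2 k. u2 k' i)) = (\<lambda>i. u' k i + (\<Sum>k'\<in>a' k. u' k' i))"
      using u2k by (simp add: a2k)
    moreover have "a2 k \<subseteq> {k'. k' < C \<and> col_y P k' \<le> H \<and> crk k' < crk k \<and> 0 < piv (u2 k') \<and> piv (u2 k') \<le> piv (u k)}"
      using r u2k unfolding reduced_def a2k by auto
    moreover have "a2 k \<noteq> {} \<longrightarrow> (\<exists>k'\<in>a2 k. piv (u2 k') = piv (u k))"
      using r u2k unfolding reduced_def a2k by auto
    moreover have "u k = (\<lambda>i. u' k i + (\<Sum>k'\<in>a' k. u' k' i))" using r unfolding reduced_def by blast
    ultimately show ?thesis unfolding reduced_def by simp
  qed
  have red_j: "reduced u2 a2 j"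
  proof -
    have "(\<Sum>k\<in>B. u2 k i) = (\<Sum>k\<in>B. u' k i)" for i using jB by (intro sum.cong) (auto simp: u2_def)
    moreover have "u j = (\<lambda>i. v i + (\<Sum>k\<in>B. u' k i))" using I' by blast
    moreover have "B \<subseteq> {k. k < C \<and> col_y P k \<le> H \<and> crk k < crk j \<and> 0 < piv (u2 k) \<and> piv (u2 k) \<le> piv (u j)}"
      using I' sub j jB by (auto simp: settled_def u2_def)
    moreover have "B \<noteq> {} \<longrightarrow> (\<exists>k\<in>B. piv (u2 k) = piv (u j))"
    proof
      assume "B \<noteq> {}"
      then obtain k where "k \<in> B" "piv (u' k) = piv (u j)" using I' by auto
      moreover then have "k \<noteq> j" using jB by auto
      ultimately show "\<exists>k\<in>B. piv (u2 k) = piv (u j)" by (intro bexI [of _ k]) (simp_all add: u2_def)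
    qed
    ultimately show ?thesis by (simp add: reduced_def a2_def) (simp add: u2_def)
  qed
  have before2: "before (Suc q) u2 a2"
    unfolding before_def
  proof (intro conjI allI impI inj2)
    fix k assume k: "k < C"
    show "if crk k < Suc q \<and> col_y P k \<le> H then reduced u2 a2 k else u2 k = u k \<and> a2 k = {}"
    proof (cases "k = j")
      case True
      then show ?thesis using red_j j by simp
    next
      case False
      then show ?thesis using red_cong [OF k] bfN [OF k] crk_Suc [OF k] by (auto simp: u2_def a2_def)
    qed
  qed
  have verts2: "verts_upto (Suc q) u2 = verts_upto q u' \<union> (if alive_at H u2 j then {(H, j)} else {})"
  proof -
    have "{(H, k) | k. alive_at H u2 k \<and> crk k < Suc q} =
      {(H, k) | k. alive_at H u' k \<and> crk k < q} \<union> (if alive_at H u2 j then {(H, j)} else {})"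
    proof -
      have "alive_at H u2 k \<and> crk k < Suc q \<longleftrightarrow> alive_at H u' k \<and> crk k < q \<or> k = j \<and> alive_at H u2 j" for k
      proof (cases "k < C")
        case True
        then show ?thesis using crk_Suc [OF True] al_ne [of k] j by auto
      next
        case False
        then show ?thesis by (auto simp: alive_at_def)
      qed
      then show ?thesis by auto
    qed
    then show ?thesis by (auto simp: verts_upto_def)
  qed
  have new_v: "(H, j) \<notin> verts_upto q u'" using V0_height [of H j] j by (auto simp: verts_upto_def)
  have edges_cong: "edges_of u2 k S = edges_of u' k S" if "j \<notin> S" for k S
  proof -
    have "alive_at H u2 k' \<longleftrightarrow> alive_at H u' k'" if "k' \<in> S" for k'
      using al_ne [of k'] that \<open>j \<notin> S\<close> by blast
    then show ?thesis unfolding edges_of_def by blast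
  qed
  have edges_j: "edges_of u2 j (insert j B) = edges_of u' j B \<union>
      (if alive_at g u j \<and> alive_at H u2 j then {((hp, j), (H, j))} else {})"
  proof -
    have "edges_of u2 j (insert j B) = edges_of u2 j B \<union> edges_of u2 j {j}" by (auto simp: edges_of_def)
    moreover have "edges_of u2 j {j} = (if alive_at g u j \<and> alive_at H u2 j then {((hp, j), (H, j))} else {})"
      by (auto simp: edges_of_def alive_at_def)
    ultimately show ?thesis using edges_cong [OF jB] by simp
  qed
  have edges2: "edges_upto (Suc q) u2 a2 = edges_upto q u' a' \<union> edges_of u' j B \<union>
      (if alive_at g u j \<and> alive_at H u2 j then {((hp, j), (H, j))} else {})"
  proof -
    have "{k. k < C \<and> col_y P k \<le> H \<and> crk k < Suc q} = insert j {k. k < C \<and> col_y P k \<le> H \<and> crk k < q}"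
      using crk_Suc j by auto
    moreover have "edges_of u2 k (insert k (a2 k)) = edges_of u' k (insert k (a' k))"
      if "k < C" "col_y P k \<le> H" "crk k < q" for k
    proof -
      have "reduced u' a' k" using bfD that by blast
      then have "j \<notin> a' k" "j \<noteq> k" using that j by (auto simp: reduced_def)
      then show ?thesis using edges_cong [of "insert k (a' k)" k] by (simp add: a2_def)
    qed
    then have "(\<Union>k\<in>{k. k < C \<and> col_y P k \<le> H \<and> crk k < q}. edges_of u2 k (insert k (a2 k))) =
        (\<Union>k\<in>{k. k < C \<and> col_y P k \<le> H \<and> crk k < q}. edges_of u' k (insert k (a' k)))"
      by (intro SUP_cong) auto
    ultimately show ?thesis using edges_j by (simp add: edges_upto_def a2_def Un_ac)
  qed
  have lab2: "lab u2 w = lab u' w" if "w \<in> verts_upto q u'" for w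
  proof -
    have "snd w \<noteq> j" if "fst w = H"
    proof
      assume "snd w = j"
      with that have "w = (H, j)" by (cases w) simp
      with \<open>w \<in> verts_upto q u'\<close> new_v show False by simp
    qed
    then show ?thesis by (auto simp: lab_def u2_def)
  qed
  have gr: "graph_rep s (verts_upto q u') (lab u') (edges_upto q u' a' \<union> edges_of u' j B) vid"
    using I' by blast
  have count: "s ''arcs'' 0 + (\<Sum>k<C. piv (u2 k)) \<le> s ''verts'' 0 + C * R"
    using I' by (simp add: u2_def fun_upd_def)
  let ?N = "s ''verts'' 0"
  define s' where "s' = exec settle_prog s"
  define vid' where "vid' = (if alive_at H u2 j then vid((H, j) := ?N) else vid)"
  have fr: "s' a = s a"
    if "a \<notin> {''al'', ''own'', ''birth'', ''death'', ''height'', ''verts'', ''arcs'', ''source'', ''target''}" for a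
    using that by (auto simp: s'_def settle_prog_def vertex_prog_def emit_prog_def)
  have own': "s' ''own'' = (if 0 < piv v then (s ''own'')(piv v := Suc j) else s ''own'')"
    by (simp add: s'_def settle_prog_def vertex_prog_def emit_prog_def pv)
  have al': "s' ''al'' = (s ''al'')(j := if alive_at H u2 j then Suc ?N else 0)"
    by (auto simp: s'_def settle_prog_def vertex_prog_def emit_prog_def pv cx al_j)
  have vs': "s' ''verts'' 0 = (if alive_at H u2 j then Suc ?N else ?N)"
    "s' ''birth'' = (if alive_at H u2 j then (s ''birth'')(?N := bx v) else s ''birth'')"
    "s' ''death'' = (if alive_at H u2 j then (s ''death'')(?N := col_x m P j) else s ''death'')"
    "s' ''height'' = (if alive_at H u2 j then (s ''height'')(?N := H) else s ''height'')"
    by (simp_all add: s'_def settle_prog_def vertex_prog_def emit_prog_def pv cx al_j)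
  have es': "s' ''arcs'' 0 = (if alive_at g u j \<and> alive_at H u2 j then Suc (s ''arcs'' 0) else s ''arcs'' 0)"
    "s' ''source'' = (if alive_at g u j \<and> alive_at H u2 j then (s ''source'')(s ''arcs'' 0 := vid (hp, j)) else s ''source'')"
    "s' ''target'' = (if alive_at g u j \<and> alive_at H u2 j then (s ''target'')(s ''arcs'' 0 := ?N) else s ''target'')"
    by (simp_all add: s'_def settle_prog_def vertex_prog_def emit_prog_def pv cx al_j o)
  have hp: "hp \<noteq> H" if "alive_at g u k" for k using V0_old [OF that] V0_height [of hp k] by auto
  have gr': "graph_rep s' (verts_upto (Suc q) u2) (lab u2) (edges_upto (Suc q) u2 a2) vid'"
  proof (cases "alive_at H u2 j")
    case False
    have "graph_rep s' (verts_upto q u') (lab u2) (edges_upto q u' a' \<union> edges_of u' j B) vid"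
      using gr lab2 vs' es' False by (simp add: graph_rep_def)
    then show ?thesis using False unfolding verts2 edges2 vid'_def by simp
  next
    case True
    define sv where "sv = s(''verts'' := (s ''verts'')(0 := Suc ?N), ''birth'' := (s ''birth'')(?N := bx v),
      ''death'' := (s ''death'')(?N := col_x m P j), ''height'' := (s ''height'')(?N := H))"
    have gv: "graph_rep sv (insert (H, j) (verts_upto q u')) (lab u2) (edges_upto q u' a' \<union> edges_of u' j B)
        (vid((H, j) := ?N))"
      by (rule graph_rep_vertex [OF gr new_v]) (auto simp: sv_def lab2, simp add: lab_def u2_def)
    show ?thesis
    proof (cases "alive_at g u j")
      case False
      have "graph_rep s' (insert (H, j) (verts_upto q u')) (lab u2) (edges_upto q u' a' \<union> edges_of u' j B)
          (vid((H, j) := ?N))"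
        using gv vs' es' False True by (simp add: graph_rep_def sv_def)
      then show ?thesis using False True unfolding verts2 edges2 vid'_def by simp
    next
      case alive_g: True
      have new_e: "((hp, j), (H, j)) \<notin> edges_upto q u' a' \<union> edges_of u' j B"
        using E0 V0_height [of H j] jB j by (auto simp: edges_upto_def edges_of_def)
      have old_v: "(hp, j) \<in> verts_upto q u'" using V0_old [OF alive_g] by (simp add: verts_upto_def)
      have "graph_rep s' (insert (H, j) (verts_upto q u')) (lab u2)
          (insert ((hp, j), (H, j)) (edges_upto q u' a' \<union> edges_of u' j B)) (vid((H, j) := ?N))"
      proof (rule graph_rep_emit [OF gv _ _ new_e])
        show "s' ''source'' = (sv ''source'')(sv ''arcs'' 0 := (vid((H, j) := ?N)) (hp, j))"
          using es' True alive_g hp [OF alive_g] by (simp add: sv_def)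
        show "s' ''verts'' = sv ''verts''"
          using True by (simp add: sv_def s'_def settle_prog_def vertex_prog_def emit_prog_def pv cx al_j)
      qed (use vs' es' True alive_g old_v in \<open>auto simp: sv_def\<close>)
      then show ?thesis using alive_g True unfolding verts2 edges2 vid'_def by simp
    qed
  qed
  have u2j: "u2 j = v" and u2k: "\<And>k. k \<noteq> j \<Longrightarrow> u2 k = u' k" by (simp_all add: u2_def)
  have owners': "owners (Suc q) u2 s'"
    unfolding owners_def
  proof (intro allI impI)
    fix p assume p: "0 < p \<and> p \<le> R"
    have "owners q u' s" using I' by blast
    note D = this [unfolded owners_def, THEN spec, THEN mp, OF p]
    show "(s' ''own'' p = 0 \<and> (\<forall>k\<in>settled (Suc q) u2. piv (u2 k) \<noteq> p)) \<or>
      (\<exists>k\<in>settled (Suc q) u2. piv (u2 k) = p \<and> s' ''own'' p = Suc k)"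
    proof (cases "s ''own'' p = 0")
      case True
      then have a: "s ''own'' p = 0" "\<forall>k\<in>settled q u'. piv (u' k) \<noteq> p" using D by auto
      show ?thesis
      proof (cases "piv v = p")
        case True
        then have "j \<in> settled (Suc q) u2" "piv (u2 j) = p" "s' ''own'' p = Suc j"
          using p by (auto simp: settled2 own' u2j u2k)
        then show ?thesis by blast
      next
        case False
        have "s' ''own'' p = 0" using False a by (simp add: own')
        moreover have "piv (u2 k) \<noteq> p" if "k \<in> settled (Suc q) u2" for k
          using that a(2) False jset by (cases "k = j") (auto simp: settled2 u2j u2k split: if_splits)
        ultimately show ?thesis by blast
      qed
    next
      case False
      then obtain k where b: "k \<in> settled q u'" "piv (u' k) = p" "s ''own'' p = Suc k" using D by auto
      have "k \<noteq> j" using b jset by auto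
      have "piv v \<noteq> p" using free [of k] b p by auto
      then have "k \<in> settled (Suc q) u2" "piv (u2 k) = p" "s' ''own'' p = Suc k"
        using b \<open>k \<noteq> j\<close> by (auto simp: settled2 own' u2j u2k)
      then show ?thesis by blast
    qed
  qed
  have ids': "ids (Suc q) u2 vid' s'"
    unfolding ids_def
  proof (intro allI impI)
    fix k assume k: "k < C"
    show "s' ''al'' k = (if crk k < Suc q \<and> col_y P k \<le> H then if alive_at H u2 k then vid' (H, k) + 1 else 0
      else if alive_at g u k then vid' (hp, k) + 1 else 0)"
    proof (cases "k = j")
      case True
      then show ?thesis using j by (simp add: al' vid'_def)
    next
      case False
      have "ids q u' vid s" using I' by blast
      with k have "s ''al'' k = (if crk k < q \<and> col_y P k \<le> H then if alive_at H u' k then vid (H, k) + 1 else 0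
        else if alive_at g u k then vid (hp, k) + 1 else 0)" unfolding ids_def by blast
      then show ?thesis using False crk_Suc [OF k] al_ne [OF False] hp [of k] by (auto simp: al' vid'_def)
    qed
  qed
  have "column R s' k = u2 k" if "k < C" for k
  proof -
    have "column R s' = column R s" by (simp add: column_def [abs_def] fr)
    then show ?thesis using I' that by (simp add: u2_def)
  qed
  moreover have "s' ''arcs'' 0 + (\<Sum>k<C. piv (u2 k)) \<le> s' ''verts'' 0 + C * R"
    using count vs'(1) es'(1) by auto
  moreover have "const s'" using I' by (simp add: const_def fr)
  moreover have "(\<forall>a. s' ''w'' a \<le> 1) \<and> s' ''h'' 0 = H" using I' by (simp add: fr)
  ultimately have "outer_inv (Suc q) u2 a2 vid' s'"
    unfolding outer_inv_def using before2 owners' ids' gr' by blast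
  then show ?thesis unfolding u2_def a2_def s'_def by blast
qed

end

section \<open>Advancing to the next kept height\<close>

definition reset_prog :: com where
  "reset_prog = for_loop ''i'' (Plus (var ''gens'') (Const 1)) (Put ''own'' (var ''i'') (Const 0))"

lemma runs_reset:
  assumes R: "s ''gens'' 0 = R"
  shows "runs (\<lambda>_. 0) reset_prog s (60 * (R + 2)) (\<lambda>s'. frame {''i'', ''own''} s s' \<and>
    (\<forall>p\<le>R. s' ''own'' p = 0))" (is "runs _ _ _ _ ?Q")
proof -
  let ?X = "{''i'', ''own''}"
  define I where "I k s' \<longleftrightarrow> frame ?X s s' \<and> (\<forall>p<k. s' ''own'' p = 0)" for k s'
  have "runs (\<lambda>_. 0) reset_prog s (((R + 1) + 1) * (10 + acost (Plus (var ''gens'') (Const 1)) + 12)) ?Q"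
    unfolding reset_prog_def
  proof (rule runs_for_loop [where I = I])
    show "I 0 (s(''i'' := (s ''i'')(0 := 0)))" by (simp add: I_def)
    show "aval (Plus (var ''gens'') (Const 1)) s' = R + 1" if "I k s'" for k s'
      using frameD [of ?X s s' "''gens''"] that R by (simp add: I_def)
    show "?Q s'" if "I (R + 1) s'" for s' using that by (simp add: I_def less_Suc_eq_le)
    show "runs (\<lambda>_. 0) (Put ''own'' (var ''i'') (Const 0)) s' 10
        (\<lambda>s'. s' ''i'' 0 = k \<and> I (Suc k) (s'(''i'' := (s' ''i'')(0 := Suc k))))"
      if "s' ''i'' 0 = k" "I k s'" for k s'
      using that by (intro runs_exec) (auto simp: I_def less_Suc_eq)
  qed auto
  then show ?thesis by (rule runs_mono) auto
qed

text \<open>A kept height other than \<open>n\<close> is a column grade or one less than a column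
  grade. The next one is therefore the least such value above \<open>h\<close>, or \<open>n\<close>,
  and finding it takes time linear in the number of columns however many heights are
  skipped.\<close>

definition next_prog :: com where
  "next_prog = Seq (assign ''nx'' (var ''n'')) (Seq (for_loop ''j'' (var ''cn'')
     (Seq (Cond (Conj (Less (var ''h'') (Get ''cy'' (var ''j''))) (Less (Get ''cy'' (var ''j'')) (var ''nx'')))
         (assign ''nx'' (Get ''cy'' (var ''j''))) Skip)
       (Cond (Conj (Less (var ''h'') (Minus (Get ''cy'' (var ''j'')) (Const 1)))
           (Less (Minus (Get ''cy'' (var ''j'')) (Const 1)) (var ''nx'')))
         (assign ''nx'' (Minus (Get ''cy'' (var ''j'')) (Const 1))) Skip)))
     (assign ''h'' (var ''nx'')))"

lemma runs_next:
  assumes n: "s ''n'' 0 = n" and C: "s ''cn'' 0 = C" and h: "s ''h'' 0 < n"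
  shows "runs (\<lambda>_. 0) next_prog s (100 * (C + 1)) (\<lambda>s'. frame {''nx'', ''j'', ''h''} s s' \<and>
    s ''h'' 0 < s' ''h'' 0 \<and> s' ''h'' 0 \<le> n \<and>
    (s' ''h'' 0 = n \<or> (\<exists>j<C. s ''cy'' j = s' ''h'' 0 \<or> s ''cy'' j = Suc (s' ''h'' 0))) \<and>
    (\<forall>j<C. \<forall>k. s ''h'' 0 < k \<and> k < s' ''h'' 0 \<longrightarrow> s ''cy'' j \<noteq> k \<and> s ''cy'' j \<noteq> Suc k))"
    (is "runs _ _ _ _ ?Q")
proof -
  let ?X = "{''nx'', ''j'', ''h''}" and ?h = "s ''h'' 0"
  \<comment> \<open>The minimum so far: \<open>x\<close> is a kept height above \<open>?h\<close>,
    and the first \<open>i\<close> columns force no kept height in between.\<close>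
  define good where "good i x \<longleftrightarrow> ?h < x \<and> x \<le> n \<and>
    (x = n \<or> (\<exists>j<C. s ''cy'' j = x \<or> s ''cy'' j = Suc x)) \<and>
    (\<forall>j<i. \<forall>k. ?h < k \<and> k < x \<longrightarrow> s ''cy'' j \<noteq> k \<and> s ''cy'' j \<noteq> Suc k)" for i x
  define I where "I i s' \<longleftrightarrow> frame {''nx'', ''j''} s s' \<and> good i (s' ''nx'' 0)" for i s'
  let ?c1 = "Cond (Conj (Less (var ''h'') (Get ''cy'' (var ''j''))) (Less (Get ''cy'' (var ''j'')) (var ''nx'')))
         (assign ''nx'' (Get ''cy'' (var ''j''))) Skip"
  let ?c2 = "Cond (Conj (Less (var ''h'') (Minus (Get ''cy'' (var ''j'')) (Const 1)))
           (Less (Minus (Get ''cy'' (var ''j'')) (Const 1)) (var ''nx'')))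
         (assign ''nx'' (Minus (Get ''cy'' (var ''j'')) (Const 1))) Skip"
  have loop: "runs (\<lambda>_. 0) (for_loop ''j'' (var ''cn'') (Seq ?c1 ?c2)) s1 ((C + 1) * (60 + acost (var ''cn'') + 12))
      (I C)" if s1: "s1 = s(''nx'' := (s ''nx'')(0 := n))" for s1
  proof (rule runs_for_loop [where I = I])
    show "I 0 (s1(''j'' := (s1 ''j'')(0 := 0)))" using s1 h by (simp add: I_def good_def)
    show "aval (var ''cn'') s' = C" if "I i s'" for i s'
      using frameD [of "{''nx'', ''j''}" s s' "''cn''"] that C by (simp add: I_def)
    fix i s' assume i: "i < C" "s' ''j'' 0 = i" and I: "I i s'"
    have fr: "b \<notin> {''nx'', ''j''} \<Longrightarrow> s' b = s b" for b
      using frameD [of "{''nx'', ''j''}" s s' b] I unfolding I_def by blast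
    let ?x = "s' ''nx'' 0" and ?y = "s ''cy'' i"
    let ?x1 = "if ?h < ?y \<and> ?y < ?x then ?y else ?x"
    let ?x2 = "if ?h < ?y - 1 \<and> ?y - 1 < ?x1 then ?y - 1 else ?x1"
    have g: "good i ?x" using I by (simp add: I_def)
    have "good (Suc i) x" if x: "?h < x" "x \<le> ?x" "x = ?x \<or> x = ?y \<or> Suc x = ?y"
      and new: "\<And>k. ?h < k \<Longrightarrow> k < x \<Longrightarrow> ?y \<noteq> k \<and> ?y \<noteq> Suc k" for x
      unfolding good_def
    proof (intro conjI allI impI)
      show "?h < x" "x \<le> n" using x g by (auto simp: good_def)
      show "x = n \<or> (\<exists>j<C. s ''cy'' j = x \<or> s ''cy'' j = Suc x)"
        using x(3)
      proof (elim disjE)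
        assume "x = ?x"
        then show ?thesis using g unfolding good_def by blast
      qed (use i(1) in auto)
      fix j k assume "j < Suc i" "?h < k \<and> k < x"
      have "s ''cy'' j \<noteq> k \<and> s ''cy'' j \<noteq> Suc k"
      proof (cases "j = i")
        case True
        then show ?thesis using new \<open>?h < k \<and> k < x\<close> by blast
      next
        case False
        then have "j < i" "k < ?x" using \<open>j < Suc i\<close> \<open>?h < k \<and> k < x\<close> x(2) by auto
        then show ?thesis using g \<open>?h < k \<and> k < x\<close> unfolding good_def by blast
      qed
      then show "s ''cy'' j \<noteq> k" "s ''cy'' j \<noteq> Suc k" by blast+
    qed
    moreover have "?h < ?x" using g by (simp add: good_def)
    then have "?h < ?x2" "?x2 \<le> ?x" "?x2 = ?x \<or> ?x2 = ?y \<or> Suc ?x2 = ?y" by auto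
    moreover have "?y \<noteq> k \<and> ?y \<noteq> Suc k" if "?h < k" "k < ?x2" for k
      using that by (auto split: if_splits)
    ultimately have "good (Suc i) ?x2" by blast
    moreover have "exec (Seq ?c1 ?c2) s' = s'(''nx'' := (s' ''nx'')(0 := ?x2))"
      by (auto simp: fr i)
    moreover have "frame {''nx'', ''j''} s s'" using I by (simp add: I_def)
    ultimately show "runs (\<lambda>_. 0) (Seq ?c1 ?c2) s' 60
        (\<lambda>s'. s' ''j'' 0 = i \<and> I (Suc i) (s'(''j'' := (s' ''j'')(0 := Suc i))))"
      using i by (intro runs_exec) (auto simp: I_def simp del: exec.simps)
  qed auto
  have "runs (\<lambda>_. 0) next_prog s (5 + ((C + 1) * (60 + acost (var ''cn'') + 12) + 5)) ?Q"
    unfolding next_prog_def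
  proof (rule runs_Seq [where R = "\<lambda>s1. s1 = s(''nx'' := (s ''nx'')(0 := n))"])
    show "runs (\<lambda>_. 0) (assign ''nx'' (var ''n'')) s 5 (\<lambda>s1. s1 = s(''nx'' := (s ''nx'')(0 := n)))"
      by (rule runs_exec) (auto simp: n)
    show "runs (\<lambda>_. 0) (Seq (for_loop ''j'' (var ''cn'') (Seq ?c1 ?c2)) (assign ''h'' (var ''nx''))) s1
        ((C + 1) * (60 + acost (var ''cn'') + 12) + 5) ?Q" if "s1 = s(''nx'' := (s ''nx'')(0 := n))" for s1
    proof (rule runs_Seq [OF loop [OF that]])
      fix s2 assume I: "I C s2"
      have "frame ?X s s2" using I frame_trans [OF _ frame_refl [of "{}" s2], of "{''nx'', ''j''}" s ?X]
        by (auto simp: I_def)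
      then show "runs (\<lambda>_. 0) (assign ''h'' (var ''nx'')) s2 5 ?Q"
        using I by (intro runs_exec) (auto simp: I_def good_def)
    qed
  qed
  then show ?thesis by (rule runs_mono) auto
qed

section \<open>One pass over all columns\<close>

context height_step
begin

lemma outer_inv_cong:
  assumes "\<And>a. a \<in> {''n'', ''gens'', ''cn'', ''genx'', ''rk'', ''off'', ''cx'', ''cy'', ''ord'', ''w'', ''h'', ''own'', ''al'',
    ''verts'', ''birth'', ''death'', ''height'', ''source'', ''target'', ''arcs''} \<Longrightarrow> s' a = s a"
  shows "outer_inv q u' a' vid s' \<longleftrightarrow> outer_inv q u' a' vid s"
proof -
  have eq: "s' ''n'' = s ''n''" "s' ''gens'' = s ''gens''" "s' ''cn'' = s ''cn''" "s' ''genx'' = s ''genx''"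
    "s' ''rk'' = s ''rk''" "s' ''off'' = s ''off''" "s' ''cx'' = s ''cx''" "s' ''cy'' = s ''cy''" "s' ''ord'' = s ''ord''"
    "s' ''w'' = s ''w''" "s' ''h'' = s ''h''" "s' ''own'' = s ''own''" "s' ''al'' = s ''al''" "s' ''verts'' = s ''verts''"
    "s' ''birth'' = s ''birth''" "s' ''death'' = s ''death''" "s' ''height'' = s ''height''"
    "s' ''source'' = s ''source''" "s' ''target'' = s ''target''" "s' ''arcs'' = s ''arcs''"
    by (rule assms; simp)+
  show ?thesis
    by (simp only: outer_inv_def const_def column_def [abs_def] owners_def ids_def graph_rep_def eq)
qed

text \<open>The bound is amortized: only the first pivot computation and the bookkeeping around it
  are charged here, and all additions are paid by the potential. The inner invariant starts with the
  unreduced column and \<open>B = {}\<close>.\<close>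

lemma runs_process:
  assumes I: "outer_inv q u' a' vid s" and q: "s ''q'' 0 = q" "q < C"
  shows "runs potential process_prog s (300 * (R + 1))
    (\<lambda>s'. s' ''q'' 0 = q \<and> (\<exists>u' a' vid. outer_inv (Suc q) u' a' vid s'))" (is "runs _ _ _ _ ?Q")
proof -
  obtain j where j: "j < C" "crk j = q" using rank_surj [OF q(2), of "col_x m P"] by (auto simp: crk_def)
  note I' = I [unfolded outer_inv_def]
  have cs: "s ''gens'' 0 = R" "\<And>j. j < C \<Longrightarrow> s ''off'' j = j * R" "\<And>i. i < R \<Longrightarrow> s ''genx'' i = gen_x P i"
    "\<And>i. i < R \<Longrightarrow> s ''rk'' i = rk i" "\<And>j. j < C \<Longrightarrow> s ''cy'' j = col_y P j" "s ''ord'' q = j"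
    using I' j by (auto simp: const_def)
  have h: "s ''h'' 0 = H" using I' by blast
  have bf: "before q u' a'" using I' by blast
  define s1 where "s1 = s(''j'' := (s ''j'')(0 := j))"
  have I1: "outer_inv q u' a' vid s1" using I by (subst outer_inv_cong [of s1 s]) (auto simp: s1_def)
  have "runs potential process_prog s (10 + (1 + bcost (Less (var ''h'') (Get ''cy'' (var ''j''))) +
      ((10 + (60 * (R + 1) + 20)) + 150))) ?Q"
    unfolding process_prog_def
  proof (rule runs_Seq [where R = "\<lambda>s'. s' = s1"])
    show "runs potential (assign ''j'' (Get ''ord'' (var ''q''))) s 10 (\<lambda>s'. s' = s1)"
      by (rule runs_exec) (auto simp: s1_def q cs intro!: eq_refl potential_cong)
    fix s' assume s': "s' = s1"
    show "runs potential (Cond (Less (var ''h'') (Get ''cy'' (var ''j''))) Skip (Seq reduce_prog settle_prog)) s'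
        (1 + bcost (Less (var ''h'') (Get ''cy'' (var ''j''))) + ((10 + (60 * (R + 1) + 20)) + 150)) ?Q"
      unfolding s'
    proof (rule runs_Cond)
      assume "bval (Less (var ''h'') (Get ''cy'' (var ''j''))) s1"
      then have Y: "\<not> col_y P j \<le> H" using h cs j by (simp add: s1_def)
      have crk_Suc: "crk k < Suc q \<and> col_y P k \<le> H \<longleftrightarrow> crk k < q \<and> col_y P k \<le> H" if "k < C" for k
        using less_Suc_crk [OF j that] Y by auto
      have "settled (Suc q) u' = settled q u'" using crk_Suc by (auto simp: settled_def)
      moreover have "verts_upto (Suc q) u' = verts_upto q u'"
      proof -
        have "alive_at H u' k \<and> crk k < Suc q \<longleftrightarrow> alive_at H u' k \<and> crk k < q" for k
          using crk_Suc [of k] by (auto simp: alive_at_def)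
        then show ?thesis by (simp add: verts_upto_def)
      qed
      moreover have "edges_upto (Suc q) u' a' = edges_upto q u' a'"
      proof -
        have "{k. k < C \<and> col_y P k \<le> H \<and> crk k < Suc q} = {k. k < C \<and> col_y P k \<le> H \<and> crk k < q}"
          using crk_Suc by auto
        then show ?thesis by (simp add: edges_upto_def)
      qed
      moreover have "before (Suc q) u' a'"
        using bf crk_Suc \<open>settled (Suc q) u' = settled q u'\<close> by (simp add: before_def)
      moreover have "ids (Suc q) u' vid s1" using I1 crk_Suc by (simp add: outer_inv_def ids_def)
      moreover have "owners (Suc q) u' s1"
        using I1 \<open>settled (Suc q) u' = settled q u'\<close> by (simp add: outer_inv_def owners_def)
      ultimately have "outer_inv (Suc q) u' a' vid s1" using I1 by (simp add: outer_inv_def)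
      then show "runs potential Skip s1 ((10 + (60 * (R + 1) + 20)) + 150) ?Q"
        using q by (intro runs_exec) (auto simp: s1_def)
    next
      assume "\<not> bval (Less (var ''h'') (Get ''cy'' (var ''j''))) s1"
      then have Y: "col_y P j \<le> H" using h cs j by (simp add: s1_def)
      have uj: "u' j = u j" using bf j by (auto simp: before_def)
      let ?R = "\<lambda>s'. (\<exists>v B. inner_inv q u' a' vid j v B s') \<and> \<not> (0 < s' ''p'' 0 \<and> 0 < s' ''own'' (s' ''p'' 0))"
      have red: "runs potential reduce_prog s1 (10 + (60 * (R + 1) + 20)) ?R"
        unfolding reduce_prog_def
      proof (rule runs_Seq [where R = "\<lambda>s'. s' = s1(''o'' := (s1 ''o'')(0 := s ''al'' j))"])
        let ?s2 = "s1(''o'' := (s1 ''o'')(0 := s ''al'' j))"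
        show "runs potential (assign ''o'' (Get ''al'' (var ''j''))) s1 10 (\<lambda>s'. s' = ?s2)"
          by (rule runs_exec) (auto simp: s1_def intro!: eq_refl potential_cong)
        fix s2 assume s2: "s2 = ?s2"
        have piv: "runs (\<lambda>_. 0) pivot_prog s2 (60 * (R + 1)) (\<lambda>s'. frame {''i'', ''p'', ''x''} s2 s' \<and>
          s' ''p'' 0 = max_on_support R rk (column R s2 (s2 ''j'' 0)) \<and>
          s' ''x'' 0 = max_on_support R (gen_x P) (column R s2 (s2 ''j'' 0)))"
          by (rule runs_pivot) (auto simp: s2 s1_def cs j)
        have "runs potential pivot_prog s2 (60 * (R + 1)) (\<lambda>s'. inner_inv q u' a' vid j (u j) {} s')"
        proof (rule runs_mono [OF runs_potential [OF piv]])
          fix s3 assume s3: "frame {''i'', ''p'', ''x''} s2 s3 \<and>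
            s3 ''p'' 0 = max_on_support R rk (column R s2 (s2 ''j'' 0)) \<and>
            s3 ''x'' 0 = max_on_support R (gen_x P) (column R s2 (s2 ''j'' 0))"
          have F: "frame {''i'', ''p'', ''x'', ''o'', ''j''} s s3"
            by (rule frame_trans [of "{''o'', ''j''}" s s2 "{''i'', ''p'', ''x''}"])
               (use s3 in \<open>auto simp: s2 s1_def\<close>)
          note f = frameD [OF F]
          have f2: "b \<notin> {''i'', ''p'', ''x''} \<Longrightarrow> s3 b = s2 b" for b using s3 frameD by blast
          show "potential s3 \<le> potential s2" by (intro eq_refl potential_cong) (simp add: f2)
          have c2: "column R s2 = column R s" by (simp add: column_def [abs_def] s2 s1_def)
          have c3: "column R s3 = column R s" by (simp add: column_def [abs_def] f)
          have j3: "s3 ''j'' 0 = j" "s2 ''j'' 0 = j" "s3 ''o'' 0 = s ''al'' j" by (simp_all add: f2 s2 s1_def)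
          have cols: "\<forall>k<C. column R s k = u' k" using I' by blast
          have al: "s ''al'' j = (if alive_at g u j then vid (hp, j) + 1 else 0)"
            using I' j by (auto simp: ids_def)
          have "graph_rep s3 (verts_upto q u') (lab u') (edges_upto q u' a' \<union> edges_of u' j {}) vid"
          proof -
            have "graph_rep s (verts_upto q u') (lab u') (edges_upto q u' a') vid" using I' by blast
            moreover have "edges_of u' j {} = {}" by (simp add: edges_of_def)
            ultimately show ?thesis
              using f by (simp add: graph_rep_def)
          qed
          moreover have "s3 ''p'' 0 = piv (u j)" "s3 ''x'' 0 = bx (u j)"
            using s3 cols j by (auto simp: j3 c2 uj)
          moreover have "(\<Sum>k<C. piv (if k = j then u j else u' k)) = (\<Sum>k<C. piv (u' k))"
            by (rule sum.cong) (auto simp: uj)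
          ultimately show "inner_inv q u' a' vid j (u j) {} s3"
            unfolding inner_inv_def using I' cols al uj q
            by (simp add: const_def owners_def ids_def f j3 c3)
        qed simp
        then show "runs potential (Seq pivot_prog (Loop (Conj (Less (Const 0) (var ''p''))
          (Less (Const 0) (Get ''own'' (var ''p'')))) reduce_body)) s2 (60 * (R + 1) + 20) ?R"
          by (rule runs_Seq) (rule runs_reduce_loop [OF j Y bf])
      qed
      then show "runs potential (Seq reduce_prog settle_prog) s1 ((10 + (60 * (R + 1) + 20)) + 150) ?Q"
      proof (rule runs_Seq)
        fix s2 assume s2: "?R s2"
        then obtain v B where v: "inner_inv q u' a' vid j v B s2" by blast
        from settle_step [OF j Y bf v] s2 obtain vid' where
          "outer_inv (Suc q) (u'(j := v)) (a'(j := B)) vid' (exec settle_prog s2)" by blast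
        moreover have "exec settle_prog s2 ''q'' 0 = q"
          using v by (simp add: settle_prog_def vertex_prog_def emit_prog_def inner_inv_def)
        moreover have "exec settle_prog s2 ''w'' = s2 ''w''"
          by (simp add: settle_prog_def vertex_prog_def emit_prog_def)
        then have "potential (exec settle_prog s2) = potential s2" by (rule potential_cong)
        moreover have "loop_free settle_prog" "max_cost settle_prog \<le> 150"
          by (simp_all add: settle_prog_def vertex_prog_def emit_prog_def)
        ultimately show "runs potential settle_prog s2 150 ?Q" by (intro runs_exec) auto
      qed
    qed
  qed
  then show ?thesis by (rule runs_mono) auto
qed

lemma runs_columns:
  assumes I: "outer_inv 0 u' a' vid s"
  shows "runs potential (for_loop ''q'' (var ''cn'') process_prog) s ((C + 1) * (320 * (R + 1)))
    (\<lambda>s'. \<exists>u' a' vid. outer_inv C u' a' vid s')" (is "runs _ _ _ _ ?Q")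
proof -
  have q: "outer_inv k u' a' vid (s(''q'' := f)) \<longleftrightarrow> outer_inv k u' a' vid s" for k u' a' vid s f
    by (rule outer_inv_cong) auto
  have "runs potential (for_loop ''q'' (var ''cn'') process_prog) s
      ((C + 1) * (300 * (R + 1) + acost (var ''cn'') + 12)) ?Q"
  proof (rule runs_for_loop [where I = "\<lambda>k s. \<exists>u' a' vid. outer_inv k u' a' vid s"])
    show "\<exists>u' a' vid. outer_inv 0 u' a' vid (s(''q'' := (s ''q'')(0 := 0)))" using I q by blast
    show "aval (var ''cn'') s = C" if "\<exists>u' a' vid. outer_inv i u' a' vid s" for i s
      using that by (auto simp: outer_inv_def const_def)
    show "potential (s(''q'' := (s ''q'')(0 := i))) = potential s" for s i by (rule potential_cong) simp
    show "runs potential process_prog s (300 * (R + 1)) (\<lambda>s'. s' ''q'' 0 = i \<and>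
        (\<exists>u' a' vid. outer_inv (Suc i) u' a' vid (s'(''q'' := (s' ''q'')(0 := Suc i)))))"
      if "i < C" "s ''q'' 0 = i" "\<exists>u' a' vid. outer_inv i u' a' vid s" for i s
      using that runs_process [of i _ _ _ s] unfolding q by blast
  qed
  moreover have "(C + 1) * (300 * (R + 1) + acost (var ''cn'') + 12) \<le> (C + 1) * (320 * (R + 1))"
    by (rule mult_left_mono) auto
  ultimately show ?thesis by (rule runs_mono)
qed

end

section \<open>The graphcode algorithm\<close>

definition height_prog :: com where
  "height_prog = Seq next_prog (Seq reset_prog (for_loop ''q'' (var ''cn'') process_prog))"

definition graphcode_prog :: com where
  "graphcode_prog = Seq init_prog (Seq (assign ''h'' (Const 0)) (Loop (Less (var ''h'') (var ''n'')) height_prog))"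

context machine_instance
begin

abbreviation "kept \<equiv> kept_heights n P"
abbreviation "prev_kept \<equiv> last_kept n P"

text \<open>The height \<open>h\<close> takes the place of \<open>n\<close> in
  \<open>reduction_trace\<close>: the trace grows with the run and is complete at height
  \<open>n\<close>. It exists only in the proof; the store holds just the last matrix.\<close>

definition trace :: "nat \<Rightarrow> (nat \<Rightarrow> nat \<Rightarrow> nat \<Rightarrow> bit) \<Rightarrow> (nat \<Rightarrow> nat \<Rightarrow> nat set) \<Rightarrow> bool" where
  "trace h U A \<longleftrightarrow> reduction_trace R rk m h C (gen_x P) (gen_y P) (col_x m P) (col_y P) crk (col_vec P) U A"

lemma gen_range: "i < R \<Longrightarrow> 1 \<le> gen_x P i \<and> gen_x P i \<le> m \<and> 1 \<le> gen_y P i \<and> gen_y P i \<le> n"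
  using subsetD [OF gens_grid nth_mem [of i "gens P"]] by (auto simp: grid_def gen_x_def gen_y_def mem_Times_iff)

lemma col_range: "j < C \<Longrightarrow> col_x m P j \<le> m + 1 \<and> 1 \<le> col_y P j \<and> col_y P j \<le> n"
proof (cases "j < c")
  case True
  then show ?thesis using subsetD [OF rels_grid nth_mem [of j "rels P"]]
    by (auto simp: grid_def col_x_def col_y_def mem_Times_iff)
next
  case False
  assume "j < C"
  with False show ?thesis using gen_range [of "j - c"] by (auto simp: col_x_def col_y_def gen_y_def n_cols_def)
qed

lemma trace_0: "trace 0 (\<lambda>_. col_vec P) (\<lambda>_ _. {})"
  unfolding trace_def
proof (unfold_locales)
  show "rk i \<le> rk i' \<Longrightarrow> gen_x P i \<le> gen_x P i'" if "i < R" "i' < R" for i i'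
    using rank_mono [OF that, of "gen_x P"] by (simp add: rk_def)
  show "crk j \<le> crk j' \<Longrightarrow> col_x m P j \<le> col_x m P j'" if "j < C" "j' < C" for j j'
    using rank_mono [OF that, of "col_x m P"] by (simp add: crk_def)
  show "i < R \<and> gen_x P i \<le> col_x m P j \<and> gen_y P i \<le> col_y P j" if "j < C" "col_vec P j i \<noteq> 0" for j i
  proof (cases "j < c")
    case True
    then have "i < R" using that by (auto simp: col_vec_def split: if_splits)
    then show ?thesis using col_vec_grid [OF True that(2)] True
      by (simp add: less_eq_prod_def col_x_def col_y_def gen_x_def gen_y_def)
  next
    case False
    then have "i = j - c" "i < R" using that by (auto simp: col_vec_def n_cols_def split: if_splits)
    then show ?thesis using False gen_range [of i] by (simp add: col_x_def col_y_def gen_y_def)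
  qed
  show "\<exists>j<C. col_y P j = gen_y P i \<and> col_x m P j = m + 1 \<and> col_vec P j = (\<lambda>i'. if i' = i then 1 else 0)"
    if "i < R" for i
    using that by (intro exI [of _ "c + i"])
      (auto simp: n_cols_def col_x_def col_y_def gen_y_def col_vec_def fun_eq_iff)
  show "inj_on (\<lambda>j. piv (col_vec P j)) {j. j < C \<and> col_y P j \<le> h \<and> 0 < piv (col_vec P j)}" if "h \<le> 0" for h
    using that col_range by (fastforce simp: inj_on_def)
qed (use gen_range col_range in auto)

text \<open>The new height is appended by function update, which leaves the conditions at earlier
  heights untouched. The condition \<open>step\<close> is the property \<open>reduced\<close> that a
  pass over all columns establishes.\<close>

lemma trace_Suc:
  assumes "trace g U A"
    and step: "\<And>j. j < C \<Longrightarrow> col_y P j \<le> Suc g \<Longrightarrow> U g j = (\<lambda>i. u' j i + (\<Sum>k\<in>a' j. u' k i)) \<and>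
      a' j \<subseteq> {k. k < C \<and> col_y P k \<le> Suc g \<and> crk k < crk j \<and> 0 < piv (u' k) \<and> piv (u' k) \<le> piv (U g j)} \<and>
      (a' j \<noteq> {} \<longrightarrow> (\<exists>k\<in>a' j. piv (u' k) = piv (U g j)))"
    and idle: "\<And>j. j < C \<Longrightarrow> Suc g < col_y P j \<Longrightarrow> u' j = U g j"
    and inj: "inj_on (\<lambda>j. piv (u' j)) {j. j < C \<and> col_y P j \<le> Suc g \<and> 0 < piv (u' j)}"
  shows "trace (Suc g) (U(Suc g := u')) (A(Suc g := a'))"
proof -
  interpret T: reduction_trace R rk m g C "gen_x P" "gen_y P" "col_x m P" "col_y P" crk "col_vec P" U A
    using assms(1) by (simp add: trace_def)
  show ?thesis
    unfolding trace_def
  proof (unfold_locales)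
    show "(U(Suc g := u')) h j = col_vec P j" if "h \<le> Suc g" "j < C" "h < col_y P j" for h j
      using that T.U_inactive [of h j] T.U_inactive [of g j] idle [of j] by (cases "h = Suc g") auto
    show "(U(Suc g := u')) h j = (\<lambda>i. (U(Suc g := u')) (Suc h) j i + (\<Sum>k\<in>(A(Suc g := a')) (Suc h) j. (U(Suc g := u')) (Suc h) k i))"
      if "h < Suc g" "j < C" "col_y P j \<le> Suc h" for h j
      using that T.U_Suc [of h j] step [of j] by (cases "h = g") auto
    show "(A(Suc g := a')) (Suc h) j \<subseteq> {k. k < C \<and> col_y P k \<le> Suc h \<and> crk k < crk j \<and>
        0 < piv ((U(Suc g := u')) (Suc h) k) \<and> piv ((U(Suc g := u')) (Suc h) k) \<le> piv ((U(Suc g := u')) h j)}"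
      if "h < Suc g" "j < C" "col_y P j \<le> Suc h" for h j
      using that T.A_subset [of h j] step [of j] by (cases "h = g") auto
    show "\<exists>k\<in>(A(Suc g := a')) (Suc h) j. piv ((U(Suc g := u')) (Suc h) k) = piv ((U(Suc g := u')) h j)"
      if "h < Suc g" "j < C" "col_y P j \<le> Suc h" "(A(Suc g := a')) (Suc h) j \<noteq> {}" for h j
      using that T.A_witness [of h j] step [of j] by (cases "h = g") auto
    show "inj_on (\<lambda>j. piv ((U(Suc g := u')) h j)) {j. j < C \<and> col_y P j \<le> h \<and> 0 < piv ((U(Suc g := u')) h j)}"
      if "h \<le> Suc g" for h
      using that T.U_inj [of h] inj by (cases "h = Suc g") auto
  qed (use T.rk_mono T.crk_mono T.gx_range T.X_le T.Y_pos T.W_supp T.W_virtual T.U_0 in \<open>auto simp del: bit_not_zero_iff\<close>)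
qed

section \<open>The graph built up to a height\<close>

definition all_verts :: "nat \<Rightarrow> (nat \<Rightarrow> nat \<Rightarrow> nat \<Rightarrow> bit) \<Rightarrow> (nat \<times> nat) set" where
  "all_verts h U = {(h', j). h' \<in> kept \<and> h' \<le> h \<and> alive_at h' (U h') j}"

definition vert_label :: "(nat \<Rightarrow> nat \<Rightarrow> nat \<Rightarrow> bit) \<Rightarrow> nat \<times> nat \<Rightarrow> nat \<times> nat \<times> nat" where
  "vert_label U v = (bx (U (fst v) (snd v)), col_x m P (snd v), fst v)"

definition step_edges :: "nat \<Rightarrow> (nat \<Rightarrow> nat \<Rightarrow> nat \<Rightarrow> bit) \<Rightarrow> (nat \<Rightarrow> nat \<Rightarrow> nat set) \<Rightarrow>
    ((nat \<times> nat) \<times> (nat \<times> nat)) set" where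
  "step_edges h U A = {((prev_kept h, j), (Suc h, k)) | j k. alive_at h (U h) j \<and> alive_at (Suc h) (U (Suc h)) k \<and>
     k \<in> insert j (A (Suc h) j) \<and> bx (U h j) < col_x m P k}"

definition all_edges :: "nat \<Rightarrow> (nat \<Rightarrow> nat \<Rightarrow> nat \<Rightarrow> bit) \<Rightarrow> (nat \<Rightarrow> nat \<Rightarrow> nat set) \<Rightarrow>
    ((nat \<times> nat) \<times> (nat \<times> nat)) set" where
  "all_edges h U A = (\<Union>h'\<in>{h'. Suc h' \<in> kept \<and> Suc h' \<le> h}. step_edges h' U A)"

text \<open>\<open>al\<close> refers to vertices at the last kept height, since skipped heights
  create none. The equation on \<open>bx\<close> lets such a vertex stand for the bar at height
  \<open>h\<close>.\<close>

definition state_inv :: "nat \<Rightarrow> (nat \<Rightarrow> nat \<Rightarrow> nat \<Rightarrow> bit) \<Rightarrow> (nat \<Rightarrow> nat \<Rightarrow> nat set) \<Rightarrow> (nat \<times> nat \<Rightarrow> nat) \<Rightarrow>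
    store \<Rightarrow> bool" where
  "state_inv h U A vid s \<longleftrightarrow> trace h U A \<and> const s \<and> (\<forall>a. s ''w'' a \<le> 1) \<and> (\<forall>j<C. column R s j = U h j) \<and>
     (\<forall>j<C. s ''al'' j = (if alive_at h (U h) j then vid (prev_kept h, j) + 1 else 0)) \<and>
     (\<forall>j. alive_at h (U h) j \<longrightarrow> (prev_kept h, j) \<in> all_verts h U \<and> bx (U (prev_kept h) j) = bx (U h j)) \<and>
     graph_rep s (all_verts h U) (vert_label U) (all_edges h U A) vid \<and>
     s ''arcs'' 0 + (\<Sum>j<C. piv (U h j)) \<le> s ''verts'' 0 + C * R"

lemma state_inv_cong:
  assumes "\<And>a. a \<in> {''n'', ''gens'', ''cn'', ''genx'', ''rk'', ''off'', ''cx'', ''cy'', ''ord'', ''w'', ''al'',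
    ''verts'', ''birth'', ''death'', ''height'', ''source'', ''target'', ''arcs''} \<Longrightarrow> s' a = s a"
  shows "state_inv h U A vid s' \<longleftrightarrow> state_inv h U A vid s"
proof -
  have eq: "s' ''n'' = s ''n''" "s' ''gens'' = s ''gens''" "s' ''cn'' = s ''cn''" "s' ''genx'' = s ''genx''"
    "s' ''rk'' = s ''rk''" "s' ''off'' = s ''off''" "s' ''cx'' = s ''cx''" "s' ''cy'' = s ''cy''" "s' ''ord'' = s ''ord''"
    "s' ''w'' = s ''w''" "s' ''al'' = s ''al''" "s' ''verts'' = s ''verts''"
    "s' ''birth'' = s ''birth''" "s' ''death'' = s ''death''" "s' ''height'' = s ''height''"
    "s' ''source'' = s ''source''" "s' ''target'' = s ''target''" "s' ''arcs'' = s ''arcs''"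
    by (rule assms; simp)+
  show ?thesis
    by (simp only: state_inv_def const_def column_def [abs_def] graph_rep_def eq)
qed

lemma step_edges_cong:
  "h \<le> g \<Longrightarrow> Suc h \<le> g \<Longrightarrow> step_edges h (U(Suc g := u')) (A(Suc g := a')) = step_edges h U A"
  by (simp add: step_edges_def)

lemma all_edges_upd: "all_edges g (U(Suc g := u')) (A(Suc g := a')) = all_edges g U A"
  unfolding all_edges_def by (intro SUP_cong step_edges_cong) auto

lemma all_edges_Suc: "all_edges (Suc g) U A =
    all_edges g U A \<union> (if Suc g \<in> kept then step_edges g U A else {})"
proof -
  have "{h'. Suc h' \<in> kept \<and> Suc h' \<le> Suc g} =
    {h'. Suc h' \<in> kept \<and> Suc h' \<le> g} \<union> (if Suc g \<in> kept then {g} else {})"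
    by (auto simp: le_Suc_eq)
  then show ?thesis by (auto simp: all_edges_def)
qed

lemma all_verts_upd: "all_verts g (U(Suc g := u')) = all_verts g U"
  by (auto simp: all_verts_def)

lemma all_verts_Suc: "all_verts (Suc g) U = all_verts g U \<union>
    (if Suc g \<in> kept then {(Suc g, j) | j. alive_at (Suc g) (U (Suc g)) j} else {})"
  by (auto simp: all_verts_def le_Suc_eq)

lemma vert_label_upd: "v \<in> all_verts g U \<Longrightarrow> vert_label (U(Suc g := u')) v = vert_label U v"
  by (auto simp: vert_label_def all_verts_def)

text \<open>The store stays as it is, but the trace needs an entry for every height; it is extended
  by a copy of the last matrix without additions.\<close>

lemma idle_step:
  assumes I: "state_inv g U A vid s" and g: "Suc g \<le> n" "Suc g \<notin> kept"
  shows "state_inv (Suc g) (U(Suc g := U g)) (A(Suc g := \<lambda>_. {})) vid s"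
proof -
  note I' = I [unfolded state_inv_def]
  let ?U = "U(Suc g := U g)" and ?A = "A(Suc g := \<lambda>_. {})"
  have Y: "col_y P j \<noteq> Suc g" if "j < C" for j using g that by (auto simp: kept_heights_def)
  then have le: "col_y P j \<le> Suc g \<longleftrightarrow> col_y P j \<le> g" if "j < C" for j using that by (auto simp: le_Suc_eq)
  have alive: "alive_at (Suc g) (U g) j \<longleftrightarrow> alive_at g (U g) j" for j using le by (auto simp: alive_at_def)
  have "{j. j < C \<and> col_y P j \<le> Suc g \<and> 0 < piv (U g j)} = {j. j < C \<and> col_y P j \<le> g \<and> 0 < piv (U g j)}"
    using le by auto
  moreover have "inj_on (\<lambda>j. piv (U g j)) {j. j < C \<and> col_y P j \<le> g \<and> 0 < piv (U g j)}"
    using I' reduction_trace.U_inj [of R rk m g C "gen_x P" "gen_y P" "col_x m P" "col_y P" crk "col_vec P" U A g]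
    by (simp add: trace_def)
  ultimately have tr: "trace (Suc g) ?U ?A"
    using I' by (intro trace_Suc) auto
  have lk: "prev_kept (Suc g) = prev_kept g" by (rule last_kept_Suc [OF g(2)])
  have vs: "all_verts (Suc g) ?U = all_verts g U" using g(2) by (simp add: all_verts_Suc all_verts_upd)
  have es: "all_edges (Suc g) ?U ?A = all_edges g U A" using g(2) by (simp add: all_edges_Suc all_edges_upd)
  have gr: "graph_rep s (all_verts g U) (vert_label ?U) (all_edges g U A) vid"
    using I' by (subst graph_rep_cong [of s s _ _ "vert_label U"]) (auto simp: vert_label_upd)
  have "prev_kept g \<noteq> Suc g" using last_kept_le [of n P g] by auto
  then show ?thesis
    unfolding state_inv_def lk vs es using I' tr gr by (simp add: alive)
qed

lemma idle_steps:
  assumes "state_inv g U A vid s" "g \<le> h" "h \<le> n" "\<And>k. g < k \<Longrightarrow> k \<le> h \<Longrightarrow> k \<notin> kept"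
  shows "\<exists>U A. state_inv h U A vid s"
  using assms(2-4)
proof (induction h rule: dec_induct)
  case base
  then show ?case using assms(1) by blast
next
  case (step h)
  have "\<exists>U A. state_inv h U A vid s" using step.prems by (intro step.IH) auto
  then obtain U A where "state_inv h U A vid s" by blast
  moreover have "Suc h \<le> n" "Suc h \<notin> kept" using step.prems step.hyps(1) by auto
  ultimately show ?case using idle_step by blast
qed

text \<open>The trace catches up through \<open>idle_steps\<close> to the height \<open>g\<close>
  just below the next kept one. The step from there is an instance of \<open>height_step\<close>
  with \<open>hp\<close> equal to \<open>prev_kept g\<close>.\<close>

lemma runs_height:
  assumes I: "state_inv h U A vid s" and h: "s ''h'' 0 = h" "h < n"
  shows "runs potential height_prog s (600 * (C + 1) * (R + 1))
    (\<lambda>s'. h < s' ''h'' 0 \<and> s' ''h'' 0 \<in> kept \<and> (\<exists>U A vid. state_inv (s' ''h'' 0) U A vid s'))"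
    (is "runs _ _ _ _ ?Q")
proof -
  note I' = I [unfolded state_inv_def]
  have cs: "s ''n'' 0 = n" "s ''cn'' 0 = C" "s ''gens'' 0 = R" "\<And>j. j < C \<Longrightarrow> s ''cy'' j = col_y P j"
    using I' by (auto simp: const_def)
  have nxt: "runs (\<lambda>_. 0) next_prog s (100 * (C + 1)) (\<lambda>s'. frame {''nx'', ''j'', ''h''} s s' \<and>
    s ''h'' 0 < s' ''h'' 0 \<and> s' ''h'' 0 \<le> n \<and>
    (s' ''h'' 0 = n \<or> (\<exists>j<C. s ''cy'' j = s' ''h'' 0 \<or> s ''cy'' j = Suc (s' ''h'' 0))) \<and>
    (\<forall>j<C. \<forall>k. s ''h'' 0 < k \<and> k < s' ''h'' 0 \<longrightarrow> s ''cy'' j \<noteq> k \<and> s ''cy'' j \<noteq> Suc k))"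
    (is "runs _ _ _ _ ?N")
    by (rule runs_next) (use cs h in auto)
  have "runs potential height_prog s (100 * (C + 1) + (60 * (R + 2) + (C + 1) * (320 * (R + 1)))) ?Q"
    unfolding height_prog_def
  proof (rule runs_Seq [OF runs_potential [OF nxt]])
    show "potential s' \<le> potential s" if "?N s'" for s'
      by (intro eq_refl potential_cong frameD [OF conjunct1 [OF that]]) auto
    fix s1 assume s1: "?N s1"
    note f1 = frameD [OF conjunct1 [OF s1]]
    obtain g where g: "s1 ''h'' 0 = Suc g" "h \<le> g" using s1 h by (cases "s1 ''h'' 0") auto
    have cy: "s ''cy'' j = col_y P j" if "j < C" for j using cs that by blast
    have kept: "Suc g \<in> kept" using s1 g cy by (auto simp: kept_heights_def)
    have gap: "k \<notin> kept" if "h < k" "k \<le> g" for k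
      using s1 g cy that h by (auto simp: kept_heights_def)
    have gn: "Suc g \<le> n" using s1 g by simp
    have "state_inv h U A vid s1" using I by (subst state_inv_cong [of s1 s]) (auto simp: f1)
    from idle_steps [OF this g(2) _ gap] gn obtain U A where I1: "state_inv g U A vid s1" by auto
    note I1' = I1 [unfolded state_inv_def]
    have r: "runs (\<lambda>_. 0) reset_prog s1 (60 * (R + 2)) (\<lambda>s'. frame {''i'', ''own''} s1 s' \<and>
        (\<forall>p\<le>R. s' ''own'' p = 0))"
      by (rule runs_reset) (simp add: f1 cs)
    show "runs potential (Seq reset_prog (for_loop ''q'' (var ''cn'') process_prog)) s1
        (60 * (R + 2) + (C + 1) * (320 * (R + 1))) ?Q"
    proof (rule runs_Seq [OF runs_potential [OF r]])
      show "potential s' \<le> potential s1" if "frame {''i'', ''own''} s1 s' \<and> (\<forall>p\<le>R. s' ''own'' p = 0)" for s'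
        by (intro eq_refl potential_cong frameD [OF conjunct1 [OF that]]) auto
      fix s2 assume s2: "frame {''i'', ''own''} s1 s2 \<and> (\<forall>p\<le>R. s2 ''own'' p = 0)"
      note f2 = frameD [OF conjunct1 [OF s2]]
      have "state_inv g U A vid s2" using I1 by (subst state_inv_cong [of s2 s1]) (auto simp: f2)
      note I2 = this [unfolded state_inv_def]
      let ?V0 = "all_verts g U" and ?E0 = "all_edges g U A"
      interpret S: height_step m n P g "prev_kept g" "U g" ?V0 "vert_label U" ?E0
      proof
        show "hh \<le> g" if "(hh, j) \<in> ?V0" for hh j using that by (simp add: all_verts_def)
        show "?E0 \<subseteq> ?V0 \<times> ?V0" using I2 by (simp add: graph_rep_def)
        show "(prev_kept g, j) \<in> ?V0 \<and> vert_label U (prev_kept g, j) = (bx (U g j), col_x m P j, prev_kept g)"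
          if "alive_at g (U g) j" for j
          using I2 that by (simp add: vert_label_def)
      qed
      have h2: "s2 ''h'' 0 = Suc g" by (simp add: f2 g)
      have "S.outer_inv 0 (U g) (\<lambda>_. {}) vid s2"
        unfolding S.outer_inv_def
      proof (intro conjI)
        have V: "S.verts_upto 0 (U g) = ?V0" by (simp add: S.verts_upto_def)
        have E: "S.edges_upto 0 (U g) (\<lambda>_. {}) = ?E0" by (simp add: S.edges_upto_def)
        have "S.lab (U g) v = vert_label U v" if "v \<in> ?V0" for v
          using S.V0_height [of "fst v" "snd v"] that by (auto simp: S.lab_def)
        then show "graph_rep s2 (S.verts_upto 0 (U g)) (S.lab (U g)) (S.edges_upto 0 (U g) (\<lambda>_. {})) vid"
          unfolding V E using I2 by (subst graph_rep_cong [of s2 s2 _ _ "vert_label U"]) auto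
        show "S.before 0 (U g) (\<lambda>_. {})" by (simp add: S.before_def S.settled_def)
        show "S.owners 0 (U g) s2" using s2 by (simp add: S.owners_def S.settled_def)
        show "S.ids 0 (U g) vid s2" using I2 by (simp add: S.ids_def)
      qed (use I2 h2 in blast)+
      from S.runs_columns [OF this]
      show "runs potential (for_loop ''q'' (var ''cn'') process_prog) s2 ((C + 1) * (320 * (R + 1))) ?Q"
      proof (rule runs_mono)
        fix s3 assume "\<exists>u' a' vid. S.outer_inv C u' a' vid s3"
        then obtain u' a' vid' where O: "S.outer_inv C u' a' vid' s3" by blast
        note O' = O [unfolded S.outer_inv_def]
        let ?U = "U(Suc g := u')" and ?A = "A(Suc g := a')"
        have crk: "crk j < C" if "j < C" for j using rank_less [OF that] by (simp add: crk_def)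
        have bf: "S.before C u' a'" using O' by blast
        have red: "S.reduced u' a' j" if "j < C" "col_y P j \<le> Suc g" for j
          using bf that crk unfolding S.before_def by auto
        have idle: "u' j = U g j" if "j < C" "Suc g < col_y P j" for j
          using bf that unfolding S.before_def by auto
        have settled: "S.settled C u' = {j. j < C \<and> col_y P j \<le> Suc g \<and> 0 < piv (u' j)}"
          using crk by (auto simp: S.settled_def)
        have tr: "trace (Suc g) ?U ?A"
        proof (rule trace_Suc)
          show "trace g U A" using I2 by blast
          show "inj_on (\<lambda>j. piv (u' j)) {j. j < C \<and> col_y P j \<le> Suc g \<and> 0 < piv (u' j)}"
            using bf by (simp add: S.before_def settled)
          show "u' j = U g j" if "j < C" "Suc g < col_y P j" for j using idle that .
          show "U g j = (\<lambda>i. u' j i + (\<Sum>k\<in>a' j. u' k i)) \<and>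
            a' j \<subseteq> {k. k < C \<and> col_y P k \<le> Suc g \<and> crk k < crk j \<and> 0 < piv (u' k) \<and> piv (u' k) \<le> piv (U g j)} \<and>
            (a' j \<noteq> {} \<longrightarrow> (\<exists>k\<in>a' j. piv (u' k) = piv (U g j)))"
            if "j < C" "col_y P j \<le> Suc g" for j
            using red [OF that] unfolding S.reduced_def .
        qed
        have lk: "prev_kept (Suc g) = Suc g" by (rule last_kept_self [OF kept])
        have vs: "S.verts_upto C u' = all_verts (Suc g) ?U"
          using crk kept by (auto simp: S.verts_upto_def all_verts_Suc all_verts_upd alive_at_def)
        have lab: "S.lab u' v = vert_label ?U v" if "v \<in> all_verts (Suc g) ?U" for v
          using that by (auto simp: S.lab_def vert_label_def)
        have es: "S.edges_upto C u' a' = all_edges (Suc g) ?U ?A"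
        proof -
          have "(\<Union>j\<in>{j. j < C \<and> col_y P j \<le> Suc g \<and> crk j < C}. S.edges_of u' j (insert j (a' j))) = step_edges g ?U ?A"
            using crk by (fastforce simp: S.edges_of_def step_edges_def alive_at_def)
          then show ?thesis using kept by (simp add: S.edges_upto_def all_edges_Suc all_edges_upd)
        qed
        have "graph_rep s3 (S.verts_upto C u') (S.lab u') (S.edges_upto C u' a') vid'" using O' by blast
        then have gr: "graph_rep s3 (all_verts (Suc g) ?U) (vert_label ?U) (all_edges (Suc g) ?U ?A) vid'"
          unfolding vs es using lab by (subst (asm) graph_rep_cong [of s3 s3 _ _ "vert_label ?U"]) auto
        have ids: "s3 ''al'' j = (if alive_at (Suc g) u' j then vid' (Suc g, j) + 1 else 0)" if "j < C" for j
        proof -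
          have "\<not> alive_at g (U g) j \<and> \<not> alive_at (Suc g) u' j" if "\<not> col_y P j \<le> Suc g"
            using that by (auto simp: alive_at_def)
          then show ?thesis using O' that crk by (auto simp: S.ids_def)
        qed
        have "state_inv (Suc g) ?U ?A vid' s3"
          unfolding state_inv_def lk
        proof (intro conjI)
          show "\<forall>j. alive_at (Suc g) (?U (Suc g)) j \<longrightarrow>
              (Suc g, j) \<in> all_verts (Suc g) ?U \<and> bx (?U (Suc g) j) = bx (?U (Suc g) j)"
            using kept by (simp add: all_verts_def)
          show "\<forall>j<C. s3 ''al'' j = (if alive_at (Suc g) (?U (Suc g)) j then vid' (Suc g, j) + 1 else 0)"
            using ids by simp
        qed (use O' tr gr in simp_all)
        moreover have "s3 ''h'' 0 = Suc g" using O' by blast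
        ultimately show "?Q s3" using kept g by auto
      qed simp
    qed
  qed
  then show ?thesis
  proof (rule runs_mono)
    have "100 * (x + 1) + (60 * (y + 2) + (x + 1) * (320 * (y + 1))) \<le> 600 * (x + 1) * (y + 1)" for x y :: nat
      by (simp add: algebra_simps)
    then show "100 * (C + 1) + (60 * (R + 2) + (C + 1) * (320 * (R + 1))) \<le> 600 * (C + 1) * (R + 1)" .
  qed
qed

section \<open>Kept heights and the total running time\<close>

lemma finite_kept: "finite kept"
  by (rule finite_subset [of _ "{..n}"]) (auto simp: kept_heights_def)

lemma card_kept: "card kept \<le> 2 * C + 1"
proof -
  have "kept \<subseteq> insert n (col_y P ` {..<C} \<union> (\<lambda>j. col_y P j - 1) ` {..<C})"
    by (force simp: kept_heights_def)
  then have "card kept \<le> card (insert n (col_y P ` {..<C} \<union> (\<lambda>j. col_y P j - 1) ` {..<C}))"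
    by (intro card_mono) auto
  also have "\<dots> \<le> Suc (card (col_y P ` {..<C} \<union> (\<lambda>j. col_y P j - 1) ` {..<C}))"
    by (rule card_insert_le_m1) simp_all
  also have "card (col_y P ` {..<C} \<union> (\<lambda>j. col_y P j - 1) ` {..<C}) \<le> C + C"
    using card_Un_le [of "col_y P ` {..<C}" "(\<lambda>j. col_y P j - 1) ` {..<C}"]
      card_image_le [of "{..<C}" "col_y P"] card_image_le [of "{..<C}" "\<lambda>j. col_y P j - 1"] by simp
  finally show ?thesis by simp
qed

lemma state_inv_init:
  assumes "const s" "\<And>a. s ''w'' a \<le> 1" "\<And>j. j < C \<Longrightarrow> column R s j = col_vec P j"
    and fr: "\<And>a. a \<in> {''al'', ''arcs'', ''verts''} \<Longrightarrow> s a = (\<lambda>_. 0)"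
  shows "state_inv 0 (\<lambda>_. col_vec P) (\<lambda>_ _. {}) (\<lambda>_. 0) s"
proof -
  have not_alive: "\<not> alive_at 0 u j" for u j using col_range [of j] by (auto simp: alive_at_def)
  have "all_verts 0 U = {}" "all_edges 0 U A = {}" for U A
    by (auto simp: all_verts_def all_edges_def kept_heights_def)
  moreover have "(\<Sum>j<C. piv (col_vec P j)) \<le> C * R"
    using sum_bounded_above [of "{..<C}" "\<lambda>j. piv (col_vec P j)" R] piv_le by simp
  ultimately show ?thesis
    unfolding state_inv_def using assms trace_0 not_alive by (simp add: graph_rep_def bij_betw_def)
qed

text \<open>The loop is measured by the kept heights still ahead, so its number of iterations is
  linear in \<open>C\<close> and does not depend on \<open>n\<close>. Each takes quadratic amortized
  time, and the initial potential adds a single cubic term.\<close>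

lemma runs_graphcode:
  "runs (\<lambda>_. 0) graphcode_prog s0 (5000 * (R + C + 1) ^ 3)
    (\<lambda>s. \<exists>U A vid. state_inv n U A vid s)" (is "runs _ _ _ _ ?Q")
proof -
  let ?L = "R + C + 1"
  let ?X = "{''cn'', ''o'', ''off'', ''i'', ''j'', ''e'', ''w'', ''cx'', ''cy'', ''k'', ''t'', ''rk'', ''ord''}"
  let ?I = "\<lambda>s. const s \<and> (\<forall>a. s ''w'' a \<le> 1) \<and> (\<forall>j<C. column R s j = col_vec P j) \<and> frame ?X s0 s"
  have pot: "potential s \<le> 400 * (R + 1) * (C * R)" for s
    unfolding potential_def using sum_bounded_above [of "{..<C}" "\<lambda>j. piv (column R s j)" R] piv_le
    by (intro mult_left_mono) auto
  obtain t1 s1 where "run init_prog s0 t1 s1 \<and> t1 + 0 \<le> 1000 * ?L ^ 2 + 0 \<and> ?I s1"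
    using runs_init unfolding runs_def by blast
  then have 1: "run init_prog s0 t1 s1" "t1 \<le> 1000 * ?L ^ 2" "?I s1" by simp_all
  define s2 where "s2 = s1(''h'' := (s1 ''h'')(0 := 0))"
  have 2: "run (assign ''h'' (Const 0)) s1 3 s2"
    using run_Put [of "''h''" "Const 0" "Const 0" s1] by (simp add: s2_def numeral_eq_Suc)
  have "state_inv 0 (\<lambda>_. col_vec P) (\<lambda>_ _. {}) (\<lambda>_. 0) s1"
  proof (rule state_inv_init)
    have "s1 ''al'' = s0 ''al''" "s1 ''arcs'' = s0 ''arcs''" "s1 ''verts'' = s0 ''verts''"
      by (rule frameD [of ?X]; use 1(3) in simp)+
    then show "s1 a = (\<lambda>_. 0)" if "a \<in> {''al'', ''arcs'', ''verts''}" for a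
      using that by (auto simp: input_store_def)
  qed (use 1(3) in blast)+
  then have I2: "state_inv 0 (\<lambda>_. col_vec P) (\<lambda>_ _. {}) (\<lambda>_. 0) s2"
    by (subst state_inv_cong [of s2 s1]) (auto simp: s2_def)
  let ?J = "\<lambda>s. s ''h'' 0 \<le> n \<and> (\<exists>U A vid. state_inv (s ''h'' 0) U A vid s)"
  let ?m = "\<lambda>s. card {k \<in> kept. s ''h'' 0 < k}"
  let ?T = "600 * (C + 1) * (R + 1)"
  have "runs potential (Loop (Less (var ''h'') (var ''n'')) height_prog) s2
      ((?m s2 + 1) * (1 + bcost (Less (var ''h'') (var ''n'')) + ?T))
      (\<lambda>s. ?J s \<and> \<not> bval (Less (var ''h'') (var ''n'')) s)"
  proof (rule runs_Loop_measure [where \<mu> = ?m])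
    show "?J s2" using I2 by (auto simp: s2_def)
    fix s assume J: "?J s" and b: "bval (Less (var ''h'') (var ''n'')) s"
    then obtain U A vid where I: "state_inv (s ''h'' 0) U A vid s" by blast
    then have "s ''n'' 0 = n" by (simp add: state_inv_def const_def)
    with b have "s ''h'' 0 < n" by simp
    from runs_height [OF I refl this] show "runs potential height_prog s ?T (\<lambda>s'. ?J s' \<and> ?m s' < ?m s)"
    proof (rule runs_mono)
      fix s' assume s': "s ''h'' 0 < s' ''h'' 0 \<and> s' ''h'' 0 \<in> kept \<and>
        (\<exists>U A vid. state_inv (s' ''h'' 0) U A vid s')"
      have "?m s' < ?m s"
        by (rule psubset_card_mono) (use s' finite_kept in auto)
      moreover have "s' ''h'' 0 \<le> n" using s' by (auto simp: kept_heights_def)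
      ultimately show "?J s' \<and> ?m s' < ?m s" using s' by blast
    qed simp
  qed
  then obtain t3 s3 where 3: "run (Loop (Less (var ''h'') (var ''n'')) height_prog) s2 t3 s3"
    "t3 + potential s3 \<le> (?m s2 + 1) * (1 + bcost (Less (var ''h'') (var ''n'')) + ?T) + potential s2"
    "?J s3" "\<not> bval (Less (var ''h'') (var ''n'')) s3"
    unfolding runs_def by blast
  have "s3 ''n'' 0 = n" using 3(3) by (auto simp: state_inv_def const_def)
  with 3 have "s3 ''h'' 0 = n" by simp
  with 3(3) have Q: "?Q s3" by auto
  have run: "run graphcode_prog s0 (t1 + (3 + t3)) s3"
    unfolding graphcode_prog_def by (rule run_Seq [OF 1(1) run_Seq [OF 2 3(1)]])
  have "?m s2 \<le> card kept" by (intro card_mono finite_kept) auto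
  then have m: "?m s2 + 1 \<le> 2 * ?L" using card_kept by simp
  have p2: "(C + 1) * (R + 1) \<le> ?L ^ 2" unfolding power2_eq_square by (intro mult_mono) auto
  have "1 + bcost (Less (var ''h'') (var ''n'')) + 600 * x \<le> 610 * y" if "x \<le> y" "1 \<le> y" for x y
    using that by simp
  from this [OF p2] have "1 + bcost (Less (var ''h'') (var ''n'')) + ?T \<le> 610 * ?L ^ 2"
    by (simp only: mult.assoc) simp
  with m have "(?m s2 + 1) * (1 + bcost (Less (var ''h'') (var ''n'')) + ?T) \<le> (2 * ?L) * (610 * ?L ^ 2)"
    by (rule mult_mono) auto
  also have "(2 * x) * (610 * x ^ 2) = 1220 * x ^ 3" for x :: nat
    by (simp add: power2_eq_square power3_eq_cube)
  finally have loop: "(?m s2 + 1) * (1 + bcost (Less (var ''h'') (var ''n'')) + ?T) \<le> 1220 * ?L ^ 3" .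
  have "potential s2 \<le> 400 * ((R + 1) * (C * R))" using pot [of s2] by (simp only: mult.assoc)
  also have "(R + 1) * (C * R) \<le> ?L * (?L * ?L)" by (intro mult_mono) auto
  also have "?L * (?L * ?L) = ?L ^ 3" by (simp add: power3_eq_cube)
  finally have pot2: "potential s2 \<le> 400 * ?L ^ 3" by simp
  have L: "?L ^ 2 \<le> ?L ^ 3" "1 \<le> ?L ^ 3" by (rule power_increasing) simp_all
  have "t1 + (3 + t3) \<le> 5000 * y"
    if "t1 \<le> 1000 * x" "t3 \<le> a + b" "a \<le> 1220 * y" "b \<le> 400 * y" "x \<le> y" "1 \<le> y" for x y a b :: nat
    using that by linarith
  from this [OF 1(2) add_leD1 [OF 3(2)] loop pot2 L] run Q show ?thesis
    unfolding runs_def by (intro exI [of _ "t1 + (3 + t3)"] exI [of _ s3]) simp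
qed

end

text \<open>At the grade of relation \<open>j\<close>, its basis vector is mapped to column
  \<open>j\<close> of the matrix. The image has to lie in the free module on the generators present
  at that grade, so the entries at all other generators vanish.\<close>

lemma machine_instance_presents:
  assumes "presents m n P M"
  shows "machine_instance m n P"
proof
  let ?F = "direct_sum_pm (map free_pm (rels P)) :: (nat \<times> nat, nat \<Rightarrow> bit) pmod"
  let ?G = "direct_sum_pm (map free_pm (gens P)) :: (nat \<times> nat, nat \<Rightarrow> bit) pmod"
  have grid: "set (gens P) \<subseteq> grid m n" "set (rels P) \<subseteq> grid m n"
    and morph: "pm_morphism (grid m n) ?F ?G (presentation_map P)"
    using assms by (auto simp: presents_def Let_def)
  show "set (gens P) \<subseteq> grid m n" "set (rels P) \<subseteq> grid m n" by (rule grid)+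
  fix j i assume j: "j < length (rels P)" and nz: "col_vec P j i \<noteq> 0"
  then have i: "i < length (gens P)" "pmat P $$ (i, j) \<noteq> 0"
    by (auto simp: col_vec_def split: if_splits)
  let ?z = "rels P ! j"
  have "?z \<in> grid m n" using grid(2) j by auto
  then have "linear_map class_ring (vsp ?F ?z) (vsp ?G ?z) (presentation_map P ?z)"
    using morph by (simp add: pm_morphism_def)
  then interpret L: linear_map class_ring "vsp ?F ?z" "vsp ?G ?z" "presentation_map P ?z" .
  let ?e = "\<lambda>j'\<in>{..<length (rels P)}. if j' = j then 1 else (0 :: bit)"
  have "?e \<in> carrier (vsp ?F ?z)"
    by (auto simp: direct_sum_pm_def free_pm_def bit_space_def)
  then have "presentation_map P ?z ?e \<in> carrier (vsp ?G ?z)" by (rule L.f_im)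
  then have "presentation_map P ?z ?e i \<in> carrier (vsp (map free_pm (gens P) ! i) ?z)"
    using i(1) by (auto simp: direct_sum_pm_def PiE_iff)
  moreover have "presentation_map P ?z ?e i = pmat P $$ (i, j)"
  proof -
    have "presentation_map P ?z ?e i = (\<Sum>j'<length (rels P). pmat P $$ (i, j') * ?e j')"
      using i(1) by (simp add: presentation_map_def)
    also have "\<dots> = (\<Sum>j'<length (rels P). if j' = j then pmat P $$ (i, j) else 0)"
      by (rule sum.cong) auto
    finally show ?thesis using j by simp
  qed
  ultimately have "pmat P $$ (i, j) \<in> carrier (bit_space (gens P ! i \<le> ?z))"
    using i(1) by (simp add: free_pm_def)
  then show "gens P ! i \<le> ?z" using i(2) by (auto simp: bit_space_def split: if_splits)
qed

context machine_instance
begin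

text \<open>Store and trace describe the same graph, with the alive columns at kept heights as
  vertices. The size bound combines at most \<open>(2 * C + 1) * C\<close> vertices with at most
  \<open>C * R\<close> more edges than vertices.\<close>

lemma graphcode_correct:
  fixes M :: "(nat \<times> nat, 'v) pmod"
  assumes pm: "persistence_module (grid m n) M" and pres: "presents m n P M"
    and I: "state_inv n U A vid s"
  shows "\<exists>B \<mu> H. barcode_basis m n M B \<mu> \<and> compression m n (graphcode m n M B \<mu>) H \<and>
    outputs s H \<and> graph_size H \<le> 7 * (pres_size P + 1) ^ 2"
proof -
  note I' = I [unfolded state_inv_def]
  have "trace n U A" using I' by blast
  then have "presented_trace P rk m n crk U A M"
    unfolding trace_def by (intro presented_trace.intro presented_trace_axioms.intro pm pres)
  then interpret T: presented_trace P rk m n crk U A M .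
  have alive: "T.alive h j \<longleftrightarrow> alive_at h (U h) j" for h j
    by (auto simp: T.alive_def T.nz_def alive_at_def)
  have edge: "T.edge h j k \<longleftrightarrow> alive_at h (U h) j \<and> alive_at (Suc h) (U (Suc h)) k \<and>
     k \<in> insert j (A (Suc h) j) \<and> bx (U h j) < col_x m P k" for h j k
    by (simp add: T.edge_def alive)
  have V: "all_verts n U = {(h, j). h \<in> kept \<and> T.alive h j}"
    by (auto simp: all_verts_def alive kept_heights_def)
  have gr: "graph_rep s (all_verts n U) (vert_label U) (all_edges n U A) vid" using I' by blast
  have out: "outputs s T.compressed"
  proof (rule T.outputs_compressed)
    show "bij_betw vid {(h, j). h \<in> kept \<and> T.alive h j} {..<s ''verts'' 0}"
      using gr by (simp add: graph_rep_def V)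
    show "s ''birth'' (vid (h, j)) = T.bx (U h j) \<and> s ''death'' (vid (h, j)) = col_x m P j \<and>
        s ''height'' (vid (h, j)) = h" if "h \<in> kept" "T.alive h j" for h j
    proof -
      have "(h, j) \<in> all_verts n U" using that by (simp add: V)
      with gr have "vert_label U (h, j) = (s ''birth'' (vid (h, j)), s ''death'' (vid (h, j)), s ''height'' (vid (h, j)))"
        unfolding graph_rep_def by blast
      then show ?thesis by (simp add: vert_label_def)
    qed
    have not_alive: "\<not> alive_at 0 u j" for u j using col_range [of j] by (auto simp: alive_at_def)
    have "map_prod vid vid ` all_edges n U A =
      {(vid (prev_kept h, j), vid (Suc h, k)) | h j k. 1 \<le> h \<and> Suc h \<in> kept \<and> T.edge h j k}" (is "?L = ?R")
    proof
      show "?L \<subseteq> ?R"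
      proof
        fix x assume "x \<in> ?L"
        then obtain v w where vw: "(v, w) \<in> all_edges n U A" "x = (vid v, vid w)" by auto
        then obtain h where h: "Suc h \<in> kept" "(v, w) \<in> step_edges h U A"
          by (auto simp: all_edges_def)
        then obtain j k where e: "v = (prev_kept h, j)" "w = (Suc h, k)" "T.edge h j k"
          unfolding step_edges_def edge by blast
        then have "1 \<le> h" using not_alive by (cases h) (auto simp: edge)
        with e h vw show "x \<in> ?R" by blast
      qed
      show "?R \<subseteq> ?L"
      proof
        fix x assume "x \<in> ?R"
        then obtain h j k where *: "x = (vid (prev_kept h, j), vid (Suc h, k))" "Suc h \<in> kept" "T.edge h j k"
          by blast
        then have "((prev_kept h, j), (Suc h, k)) \<in> step_edges h U A" by (auto simp: step_edges_def edge)
        moreover have "Suc h \<le> n" using * by (auto simp: kept_heights_def)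
        ultimately have "((prev_kept h, j), (Suc h, k)) \<in> all_edges n U A" using * by (auto simp: all_edges_def)
        then show "x \<in> ?L"
          by (rule image_eqI [rotated]) (simp add: *)
      qed
    qed
    then show "arc s ` {..<s ''arcs'' 0} =
      {(vid (prev_kept h, j), vid (Suc h, k)) | h j k. 1 \<le> h \<and> Suc h \<in> kept \<and> T.edge h j k}"
      using gr by (simp add: graph_rep_def)
    show "inj_on (arc s) {..<s ''arcs'' 0}" using gr by (simp add: graph_rep_def)
  qed
  have "s ''verts'' 0 = card (all_verts n U)"
    using gr bij_betw_same_card [of vid "all_verts n U" "{..<s ''verts'' 0}"] by (simp add: graph_rep_def)
  also have "\<dots> \<le> card (kept \<times> {..<C})"
    by (rule card_mono) (auto simp: all_verts_def alive_at_def finite_kept)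
  also have "\<dots> \<le> (2 * C + 1) * C"
    using mult_le_mono1 [OF card_kept, of C] by (simp only: card_cartesian_product card_lessThan)
  finally have verts: "s ''verts'' 0 \<le> (2 * C + 1) * C" .
  have arcs: "s ''arcs'' 0 \<le> s ''verts'' 0 + C * R" using I' by linarith
  have C: "C = pres_size P" "R \<le> pres_size P" by (simp_all add: n_cols_def pres_size_def)
  have "C * R \<le> C * C" using C by (intro mult_left_mono) auto
  \<comment> \<open>The left side is \<open>5 * C ^ 2 + 2 * C\<close>, hence the factor 7.\<close>
  moreover have "2 * ((2 * C + 1) * C) + C * C \<le> 7 * (C + 1) ^ 2"
  proof -
    have "2 * ((2 * x + 1) * x) + x * x \<le> 7 * (x + 1) ^ 2" for x :: nat
      by (simp add: power2_eq_square algebra_simps)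
    then show ?thesis .
  qed
  ultimately have "s ''verts'' 0 + s ''arcs'' 0 \<le> 7 * (C + 1) ^ 2" using verts arcs by linarith
  then have "graph_size T.compressed \<le> 7 * (pres_size P + 1) ^ 2"
    using T.graph_size_output [OF out] C by simp
  with out T.barcode_basis T.compression_compressed show ?thesis by blast
qed

end

theorem theorem9:
  shows "\<exists>(c :: com) (T :: nat \<Rightarrow> real) (S :: nat \<Rightarrow> real).
    T \<in> O(\<lambda>N. real N ^ 3) \<and> S \<in> O(\<lambda>N. real N ^ 2) \<and>
    (\<forall>(m :: nat) (n :: nat) (P :: presentation) (M :: (nat \<times> nat, 'v) pmod).
       persistence_module (grid m n) M \<longrightarrow> presents m n P M \<longrightarrow>
       (\<exists>t s B \<mu> H.
          run c (input_store m n P) t s \<and> real t \<le> T (pres_size P) \<and>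
          barcode_basis m n M B \<mu> \<and>
          compression m n (graphcode m n M B \<mu>) H \<and>
          outputs s H \<and> real (graph_size H) \<le> S (pres_size P)))"
proof (rule exI [of _ graphcode_prog], rule exI [of _ "\<lambda>N. 5000 * (2 * real N + 1) ^ 3"],
    rule exI [of _ "\<lambda>N. 7 * (real N + 1) ^ 2"], intro conjI allI impI)
  show "(\<lambda>N. 5000 * (2 * real N + 1) ^ 3) \<in> O(\<lambda>N. real N ^ 3)"
  \<comment> \<open>From \<open>N = 1\<close> on, \<open>2 * N + 1 \<le> 3 * N\<close>, and 27 is
    the cube of 3. The summand 1 in the bound covers the empty presentation, on which the program
    still takes some steps.\<close>
  proof (rule bigoI [of _ "5000 * 27"], rule eventually_sequentiallyI [of 1])
    fix N :: nat assume "1 \<le> N"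
    then have "(2 * real N + 1) ^ 3 \<le> (3 * real N) ^ 3" by (intro power_mono) auto
    then show "norm (5000 * (2 * real N + 1) ^ 3) \<le> 5000 * 27 * norm (real N ^ 3)"
      by (simp add: power_mult_distrib)
  qed
  show "(\<lambda>N. 7 * (real N + 1) ^ 2) \<in> O(\<lambda>N. real N ^ 2)"
  proof (rule bigoI [of _ "7 * 4"], rule eventually_sequentiallyI [of 1])
    fix N :: nat assume "1 \<le> N"
    then have "(real N + 1) ^ 2 \<le> (2 * real N) ^ 2" by (intro power_mono) auto
    then show "norm (7 * (real N + 1) ^ 2) \<le> 7 * 4 * norm (real N ^ 2)"
      by (simp add: power_mult_distrib)
  qed
next
  fix m n :: nat and P :: presentation and M :: "(nat \<times> nat, 'v) pmod"
  assume pm: "persistence_module (grid m n) M" and pres: "presents m n P M"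
  interpret machine_instance m n P by (rule machine_instance_presents [OF pres])
  have "\<exists>t s. run graphcode_prog s0 t s \<and> t \<le> 5000 * (R + C + 1) ^ 3 \<and> (\<exists>U A vid. state_inv n U A vid s)"
    using runs_graphcode by (simp add: runs_def)
  then obtain t s U A vid where 1: "run graphcode_prog s0 t s" "t \<le> 5000 * (R + C + 1) ^ 3"
    "state_inv n U A vid s" by blast
  from graphcode_correct [OF pm pres 1(3)] obtain B \<mu> H where
    2: "barcode_basis m n M B \<mu>" "compression m n (graphcode m n M B \<mu>) H" "outputs s H"
      "graph_size H \<le> 7 * (pres_size P + 1) ^ 2" by blast
  \<comment> \<open>\<open>C\<close> equals the size of the presentation and \<open>R\<close> is at
    most \<open>C\<close>.\<close>
  have "R + C + 1 \<le> 2 * pres_size P + 1" by (simp add: n_cols_def pres_size_def)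
  then have "(R + C + 1) ^ 3 \<le> (2 * pres_size P + 1) ^ 3" by (rule power_mono) simp
  with 1(2) have "t \<le> 5000 * (2 * pres_size P + 1) ^ 3" by linarith
  then have "real t \<le> real (5000 * (2 * pres_size P + 1) ^ 3)" by (rule of_nat_mono)
  then have t: "real t \<le> 5000 * (2 * real (pres_size P) + 1) ^ 3" by (simp add: add.commute)
  have "real (graph_size H) \<le> real (7 * (pres_size P + 1) ^ 2)" using 2(4) by (rule of_nat_mono)
  then have "real (graph_size H) \<le> 7 * (real (pres_size P) + 1) ^ 2" by (simp add: add.commute)
  with 1(1) 2 t show "\<exists>t s B \<mu> H. run graphcode_prog (input_store m n P) t s \<and>
      real t \<le> 5000 * (2 * real (pres_size P) + 1) ^ 3 \<and> barcode_basis m n M B \<mu> \<and>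
      compression m n (graphcode m n M B \<mu>) H \<and> outputs s H \<and>
      real (graph_size H) \<le> 7 * (real (pres_size P) + 1) ^ 2" by blast
qed

end
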